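(* Let $R$ be a commutative unital ring and $\mathsf{Operad}$ the category of symmetric operads in $R$-modules. The operation which takes an operad $P$ to its algebraic tangent category $\mathsf{Alg}(P)=(\mathsf{Alg}_P,\bar{\mathbb T}^{(P)})$ extends to a functor $\mathsf{Alg}^*:\mathsf{Operad}^{\mathrm{op}}\to\mathsf{TngCat}_{=}$ which sends a morphism of operads $\varphi:P\to Q$ to the strict tangent morphism $\varphi^*:\mathsf{Alg}(Q)\to\mathsf{Alg}(P)$ whose underlying functor is restriction along $\varphi$.
   Context: Tangent categories (Cockett–Cruttwell). A tangent category $(\mathbb X,\mathbb T)$ is a category $\mathbb X$ with an endofunctor $T$ and natural transformations $p:T\Rightarrow \mathrm{id}$ (projection), $z:\mathrm{id}\Rightarrow T$ (zero), $s:T_2\Rightarrow T$ (sum), $l:T\Rightarrow T^2$ (vertical lift), $c:T^2\Rightarrow T^2$ (canonical flip), where $T_nX$ is the $n$-fold pullback of $p_X$ along itself (assumed to exist and to be preserved by all $T^m$), such that: $(p_X,z_X,s_X)$ is a commutative monoid in $\mathbb X/X$ (an additive bundle); $(l,z):p\to Tp$ and $(c,\mathrm{id}):Tp\to p_T$ are morphisms of additive bundles; $c\circ c=\mathrm{id}$, $c\circ l=l$, $Tl\circ l=l_T\circ l$, $Tc\circ c_T\circ Tc=c_T\circ Tc\circ c_T$, $c_T\circ Tc\circ l_T=Tl\circ c$; and the square formed by $Ts\circ\langle l\pi_1,z_T\pi_2\rangle:T_2X\to T^2X$, $p\pi_1:T_2X\to X$, $Tp:T^2X\to TX$, $z:X\to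 TX$ is a pullback preserved by all $T^m$. A lax tangent morphism $(F,\alpha):(\mathbb X,\mathbb T)\to(\mathbb X',\mathbb T')$ is a functor $F$ with a natural transformation $\alpha:F\circ T\Rightarrow T'\circ F$ satisfying $p'_F\circ\alpha=Fp$, $\alpha\circ Fz=z'_F$, $\alpha\circ Fs=s'_F\circ\alpha_2$ (with $\alpha_2=\langle\alpha\circ F\pi_1,\alpha\circ F\pi_2\rangle:F T_2\Rightarrow T_2'F$), $l'_F\circ\alpha=T'\alpha\circ\alpha_T\circ Fl$, $c'_F\circ T'\alpha\circ\alpha_T=T'\alpha\circ\alpha_T\circ Fc$. It is strict if $F\circ T=T'\circ F$ and $\alpha$ is the identity. $\mathsf{TngCat}_=$ is the category of tangent categories and strict tangent morphisms. Operads. An operad $P$ is a symmetric operad in $(\mathsf{Mod}_R,\otimes_R)$; $\mathsf{Alg}_P$ is its category of algebras, $\mu_A(a_1,\dots,a_m)$ denotes the action of $\mu\in P(m)$. A morphism of operads $\varphi:P\to Q$ is a family of equivariant $R$-linear maps $P(n)\to Q(n)$ compatible with units and compositions. The functor $\varphi^*:\mathsf{Alg}_Q\to\mathsf{Alg}_P$ sends $B$ to the same $R$-module with $\mu_{\varphi^*B}(b_1,\dots,b_m)=\varphi(\mu)_B(b_1,\dots,b_m)$. Algebraic tangent structure $\bar{\mathbb T}^{(P)}$ on $\mathsf{Alg}_P$: $\bar TA=A\ltimes A$ is the $R$-module $A\times A$ with $\mu((a_1,b_1),\dots,(a_m,b_m))=(\mu(a_1,\dots,a_m),\sum_{k=1}^m\mu(a_1,\dots,b_k,\dots,a_m))$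 ($b_k$ in the $k$-th slot); $p(a,b)=a$; $\bar T_nA=A\ltimes(A\times\dots\times A)$ with projections $\pi_k(a;b_1,\dots,b_n)=(a,b_k)$; $z(a)=(a,0)$; $s(a;b_1,b_2)=(a,b_1+b_2)$; $l(a,b)=(a,0,0,b)$; $c(a_1,b_1,a_2,b_2)=(a_1,a_2,b_1,b_2)$. *)

theory Defs
  imports "HOL-Algebra.Module" "HOL-Combinatorics.Permutations"
begin

text \<open>
  Functions and operations with a restricted domain are required throughout to be
  \<^const>\<open>undefined\<close> outside that domain.  HOL equality of structures and of morphisms is then
  the equality of the mathematics; in particular the equation of functors in the definition of a
  strict tangent morphism and the functor laws can be stated literally.
\<close>

section \<open>Categories, functors and natural transformations\<close>

record ('o, 'm) cat =
  Obj :: "'o set"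
  Arr :: "'m set"
  Dom :: "'m \<Rightarrow> 'o"
  Cod :: "'m \<Rightarrow> 'o"
  Ident :: "'o \<Rightarrow> 'm"
  Comp :: "'m \<Rightarrow> 'm \<Rightarrow> 'm"  (infixl "\<cdot>\<index>" 70)

definition in_hom :: "('o, 'm) cat \<Rightarrow> 'm \<Rightarrow> 'o \<Rightarrow> 'o \<Rightarrow> bool" where
  "in_hom C f X Y \<longleftrightarrow> f \<in> Arr C \<and> Dom C f = X \<and> Cod C f = Y"

locale category =
  fixes C :: "('o, 'm) cat" (structure)
  assumes dom_obj: "Dom C \<in> Arr C \<rightarrow>\<^sub>E Obj C"
    and cod_obj: "Cod C \<in> Arr C \<rightarrow>\<^sub>E Obj C"
    and ident_ext: "Ident C \<in> extensional (Obj C)"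
    and ident_hom: "X \<in> Obj C \<Longrightarrow> in_hom C (Ident C X) X X"
    and comp_hom: "\<lbrakk>in_hom C f X Y; in_hom C g Y Z\<rbrakk> \<Longrightarrow> in_hom C (g \<cdot> f) X Z"
    and comp_undefined:
      "\<not> (f \<in> Arr C \<and> g \<in> Arr C \<and> Cod C f = Dom C g) \<Longrightarrow> g \<cdot> f = undefined"
    and comp_assoc: "\<lbrakk>in_hom C f W X; in_hom C g X Y; in_hom C h Y Z\<rbrakk>
      \<Longrightarrow> (h \<cdot> g) \<cdot> f = h \<cdot> (g \<cdot> f)"
    and ident_left: "in_hom C f X Y \<Longrightarrow> Ident C Y \<cdot> f = f"
    and ident_right: "in_hom C f X Y \<Longrightarrow> f \<cdot> Ident C X = f"

definition op_cat :: "('o, 'm) cat \<Rightarrow> ('o, 'm) cat" where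
  "op_cat C = \<lparr>Obj = Obj C, Arr = Arr C, Dom = Cod C, Cod = Dom C, Ident = Ident C,
     Comp = (\<lambda>g f. f \<cdot>\<^bsub>C\<^esub> g)\<rparr>"

text \<open>
  A category presented by its class of objects and, for any two objects, a set of morphisms.
  These sets need not be disjoint, so an arrow also records its source and target.
\<close>

datatype ('o, 'f) arrow = Arrow (src: 'o) (arrow_map: 'f) (tgt: 'o)

definition hom_category ::
  "'o set \<Rightarrow> ('o \<Rightarrow> 'o \<Rightarrow> 'f set) \<Rightarrow> ('o \<Rightarrow> 'f) \<Rightarrow> ('o \<Rightarrow> 'o \<Rightarrow> 'o \<Rightarrow> 'f \<Rightarrow> 'f \<Rightarrow> 'f)
    \<Rightarrow> ('o, ('o, 'f) arrow) cat" where
  "hom_category Ob H i k = (let A = {Arrow X f Y | X f Y. X \<in> Ob \<and> Y \<in> Ob \<and> f \<in> H X Y} in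
     \<lparr>Obj = Ob, Arr = A, Dom = restrict src A, Cod = restrict tgt A,
      Ident = (\<lambda>X\<in>Ob. Arrow X (i X) X),
      Comp = (\<lambda>g f. if f \<in> A \<and> g \<in> A \<and> tgt f = src g
        then Arrow (src f) (k (src f) (tgt f) (tgt g) (arrow_map g) (arrow_map f)) (tgt g)
        else undefined)\<rparr>)"

record ('o, 'm, 'p, 'n) cfunctor =
  fobj :: "'o \<Rightarrow> 'p"
  fmor :: "'m \<Rightarrow> 'n"

definition is_functor ::
  "('o, 'm) cat \<Rightarrow> ('p, 'n) cat \<Rightarrow> ('o, 'm, 'p, 'n) cfunctor \<Rightarrow> bool" where
  "is_functor C D F \<longleftrightarrow> category C \<and> category D \<and>
     fobj F \<in> Obj C \<rightarrow>\<^sub>E Obj D \<and> fmor F \<in> Arr C \<rightarrow>\<^sub>E Arr D \<and>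
     (\<forall>f\<in>Arr C. in_hom D (fmor F f) (fobj F (Dom C f)) (fobj F (Cod C f))) \<and>
     (\<forall>X\<in>Obj C. fmor F (Ident C X) = Ident D (fobj F X)) \<and>
     (\<forall>f\<in>Arr C. \<forall>g\<in>Arr C. Cod C f = Dom C g \<longrightarrow>
        fmor F (g \<cdot>\<^bsub>C\<^esub> f) = fmor F g \<cdot>\<^bsub>D\<^esub> fmor F f)"

definition id_functor :: "('o, 'm) cat \<Rightarrow> ('o, 'm, 'o, 'm) cfunctor" where
  "id_functor C = \<lparr>fobj = (\<lambda>X\<in>Obj C. X), fmor = (\<lambda>f\<in>Arr C. f)\<rparr>"

text \<open>The first argument is the source category of the inner functor.\<close>

definition comp_functor :: "('o, 'm) cat \<Rightarrow> ('p, 'n, 'q, 'k) cfunctor \<Rightarrow>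
    ('o, 'm, 'p, 'n) cfunctor \<Rightarrow> ('o, 'm, 'q, 'k) cfunctor" where
  "comp_functor C G F =
     \<lparr>fobj = (\<lambda>X\<in>Obj C. fobj G (fobj F X)), fmor = (\<lambda>f\<in>Arr C. fmor G (fmor F f))\<rparr>"

definition nat_trans :: "('o, 'm) cat \<Rightarrow> ('p, 'n) cat \<Rightarrow> ('o, 'm, 'p, 'n) cfunctor \<Rightarrow>
    ('o, 'm, 'p, 'n) cfunctor \<Rightarrow> ('o \<Rightarrow> 'n) \<Rightarrow> bool" where
  "nat_trans C D F G \<alpha> \<longleftrightarrow> is_functor C D F \<and> is_functor C D G \<and> \<alpha> \<in> extensional (Obj C) \<and>
     (\<forall>X\<in>Obj C. in_hom D (\<alpha> X) (fobj F X) (fobj G X)) \<and>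
     (\<forall>f\<in>Arr C. \<alpha> (Cod C f) \<cdot>\<^bsub>D\<^esub> fmor F f = fmor G f \<cdot>\<^bsub>D\<^esub> \<alpha> (Dom C f))"


section \<open>Pullbacks\<close>

definition is_pullback :: "('o, 'm) cat \<Rightarrow> 'm \<Rightarrow> 'm \<Rightarrow> 'm \<Rightarrow> 'm \<Rightarrow> bool" where
  "is_pullback C f g a b \<longleftrightarrow>
     f \<in> Arr C \<and> g \<in> Arr C \<and> Cod C f = Cod C g \<and>
     (\<exists>Q. in_hom C a Q (Dom C f) \<and> in_hom C b Q (Dom C g) \<and> f \<cdot>\<^bsub>C\<^esub> a = g \<cdot>\<^bsub>C\<^esub> b \<and>
       (\<forall>Z u v. in_hom C u Z (Dom C f) \<and> in_hom C v Z (Dom C g) \<and> f \<cdot>\<^bsub>C\<^esub> u = g \<cdot>\<^bsub>C\<^esub> v \<longrightarrow>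
          (\<exists>!h. in_hom C h Z Q \<and> a \<cdot>\<^bsub>C\<^esub> h = u \<and> b \<cdot>\<^bsub>C\<^esub> h = v)))"

text \<open>
  \<open>Q\<close> with the projections \<open>\<pi> 1, \<dots>, \<pi> n\<close> is the \<open>n\<close>-fold pullback of \<open>q\<close> along
  itself (\<open>n \<ge> 1\<close>).
\<close>

definition nfold_pullback ::
  "('o, 'm) cat \<Rightarrow> nat \<Rightarrow> 'm \<Rightarrow> 'o \<Rightarrow> (nat \<Rightarrow> 'm) \<Rightarrow> bool" where
  "nfold_pullback C n q Q \<pi> \<longleftrightarrow> q \<in> Arr C \<and> Q \<in> Obj C \<and>
     (\<forall>k\<in>{1..n}. in_hom C (\<pi> k) Q (Dom C q) \<and> q \<cdot>\<^bsub>C\<^esub> \<pi> k = q \<cdot>\<^bsub>C\<^esub> \<pi> 1) \<and>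
     (\<forall>Z f. (\<forall>k\<in>{1..n}. in_hom C (f k) Z (Dom C q) \<and> q \<cdot>\<^bsub>C\<^esub> f k = q \<cdot>\<^bsub>C\<^esub> f 1) \<longrightarrow>
        (\<exists>!h. in_hom C h Z Q \<and> (\<forall>k\<in>{1..n}. \<pi> k \<cdot>\<^bsub>C\<^esub> h = f k)))"

text \<open>
  The arrow \<open>\<langle>f\<^sub>1, \<dots>, f\<^sub>n\<rangle>\<close> into such a pullback, for a nonempty list of arrows.
\<close>

definition pb_tuple :: "('o, 'm) cat \<Rightarrow> 'o \<Rightarrow> (nat \<Rightarrow> 'm) \<Rightarrow> 'm list \<Rightarrow> 'm" where
  "pb_tuple C Q \<pi> fs = (THE h. in_hom C h (Dom C (hd fs)) Q \<and>
     (\<forall>k\<in>{1..length fs}. \<pi> k \<cdot>\<^bsub>C\<^esub> h = fs ! (k - 1)))"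


section \<open>Additive bundles\<close>

text \<open>\<open>bpow n\<close> and \<open>bpr n\<close> are the \<open>n\<close>-fold pullback of \<open>bproj\<close> and its projections.\<close>

record ('o, 'm) fbundle =
  bproj :: 'm
  bpow :: "nat \<Rightarrow> 'o"
  bpr :: "nat \<Rightarrow> nat \<Rightarrow> 'm"
  bzero :: 'm
  bsum :: 'm

definition additive_bundle :: "('o, 'm) cat \<Rightarrow> ('o, 'm) fbundle \<Rightarrow> bool" where
  "additive_bundle C B \<longleftrightarrow>
    (let q = bproj B; E = Dom C q; M = Cod C q; \<zeta> = bzero B; \<sigma> = bsum B;
         pair = (\<lambda>f g. pb_tuple C (bpow B 2) (bpr B 2) [f, g]);
         \<pi> = bpr B 2; \<rho> = bpr B 3
     in q \<in> Arr C \<and>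
        (\<forall>n\<ge>1. nfold_pullback C n q (bpow B n) (bpr B n)) \<and>
        \<comment> \<open>\<open>\<zeta>\<close> and \<open>\<sigma>\<close> are morphisms over the base\<close>
        in_hom C \<zeta> M E \<and> q \<cdot>\<^bsub>C\<^esub> \<zeta> = Ident C M \<and>
        in_hom C \<sigma> (bpow B 2) E \<and> q \<cdot>\<^bsub>C\<^esub> \<sigma> = q \<cdot>\<^bsub>C\<^esub> \<pi> 1 \<and>
        \<comment> \<open>unit, commutativity and associativity\<close>
        \<sigma> \<cdot>\<^bsub>C\<^esub> pair (\<zeta> \<cdot>\<^bsub>C\<^esub> q) (Ident C E) = Ident C E \<and>
        \<sigma> \<cdot>\<^bsub>C\<^esub> pair (Ident C E) (\<zeta> \<cdot>\<^bsub>C\<^esub> q) = Ident C E \<and>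
        \<sigma> \<cdot>\<^bsub>C\<^esub> pair (\<pi> 2) (\<pi> 1) = \<sigma> \<and>
        \<sigma> \<cdot>\<^bsub>C\<^esub> pair (\<sigma> \<cdot>\<^bsub>C\<^esub> pair (\<rho> 1) (\<rho> 2)) (\<rho> 3) =
          \<sigma> \<cdot>\<^bsub>C\<^esub> pair (\<rho> 1) (\<sigma> \<cdot>\<^bsub>C\<^esub> pair (\<rho> 2) (\<rho> 3)))"

text \<open>A morphism \<open>(f, g)\<close> has total part \<open>f\<close> and base part \<open>g\<close>.\<close>

definition additive_bundle_morphism ::
  "('o, 'm) cat \<Rightarrow> ('o, 'm) fbundle \<Rightarrow> ('o, 'm) fbundle \<Rightarrow> 'm \<Rightarrow> 'm \<Rightarrow> bool" where
  "additive_bundle_morphism C B B' f g \<longleftrightarrow>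
     additive_bundle C B \<and> additive_bundle C B' \<and>
     in_hom C f (Dom C (bproj B)) (Dom C (bproj B')) \<and>
     in_hom C g (Cod C (bproj B)) (Cod C (bproj B')) \<and>
     bproj B' \<cdot>\<^bsub>C\<^esub> f = g \<cdot>\<^bsub>C\<^esub> bproj B \<and>
     f \<cdot>\<^bsub>C\<^esub> bzero B = bzero B' \<cdot>\<^bsub>C\<^esub> g \<and>
     f \<cdot>\<^bsub>C\<^esub> bsum B = bsum B' \<cdot>\<^bsub>C\<^esub>
       pb_tuple C (bpow B' 2) (bpr B' 2) [f \<cdot>\<^bsub>C\<^esub> bpr B 2 1, f \<cdot>\<^bsub>C\<^esub> bpr B 2 2]"


section \<open>Tangent categories\<close>

text \<open>
  \<open>tanN n X\<close> is the chosen \<open>n\<close>-fold pullback of the projection at \<open>X\<close>, with projections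
  \<open>tanpr n X 1, \<dots>, tanpr n X n\<close>.
\<close>

record ('o, 'm) tangent_cat =
  ucat :: "('o, 'm) cat"
  tanT :: "('o, 'm, 'o, 'm) cfunctor"
  tanN :: "nat \<Rightarrow> 'o \<Rightarrow> 'o"
  tanpr :: "nat \<Rightarrow> 'o \<Rightarrow> nat \<Rightarrow> 'm"
  tanp :: "'o \<Rightarrow> 'm"
  tanz :: "'o \<Rightarrow> 'm"
  tans :: "'o \<Rightarrow> 'm"
  tanl :: "'o \<Rightarrow> 'm"
  tanc :: "'o \<Rightarrow> 'm"

definition tan_pair :: "('o, 'm) tangent_cat \<Rightarrow> 'o \<Rightarrow> 'm \<Rightarrow> 'm \<Rightarrow> 'm" where
  "tan_pair \<X> X f g = pb_tuple (ucat \<X>) (tanN \<X> 2 X) (tanpr \<X> 2 X) [f, g]"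

definition tanT2 :: "('o, 'm) tangent_cat \<Rightarrow> ('o, 'm, 'o, 'm) cfunctor" where
  "tanT2 \<X> = (let C = ucat \<X> in
     \<lparr>fobj = (\<lambda>X\<in>Obj C. tanN \<X> 2 X),
      fmor = (\<lambda>f\<in>Arr C. tan_pair \<X> (Cod C f)
        (fmor (tanT \<X>) f \<cdot>\<^bsub>C\<^esub> tanpr \<X> 2 (Dom C f) 1)
        (fmor (tanT \<X>) f \<cdot>\<^bsub>C\<^esub> tanpr \<X> 2 (Dom C f) 2))\<rparr>)"

definition tan_bundle :: "('o, 'm) tangent_cat \<Rightarrow> 'o \<Rightarrow> ('o, 'm) fbundle" where
  "tan_bundle \<X> X = \<lparr>bproj = tanp \<X> X, bpow = (\<lambda>n. tanN \<X> n X), bpr = (\<lambda>n. tanpr \<X> n X),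
     bzero = tanz \<X> X, bsum = tans \<X> X\<rparr>"

definition map_bundle :: "('o, 'm, 'p, 'n) cfunctor \<Rightarrow> ('o, 'm) fbundle \<Rightarrow> ('p, 'n) fbundle" where
  "map_bundle F B = \<lparr>bproj = fmor F (bproj B), bpow = (\<lambda>n. fobj F (bpow B n)),
     bpr = (\<lambda>n k. fmor F (bpr B n k)), bzero = fmor F (bzero B), bsum = fmor F (bsum B)\<rparr>"

locale tangent_structure =
  fixes \<X> :: "('o, 'm) tangent_cat"
    and C :: "('o, 'm) cat" (structure)
    and T :: "('o, 'm, 'o, 'm) cfunctor"
  assumes functor_T: "is_functor C C T"
    and nat_p: "nat_trans C C T (id_functor C) (tanp \<X>)"
    and powers_undefined: "\<not> (n \<ge> 1 \<and> X \<in> Obj C) \<Longrightarrow> tanN \<X> n X = undefined"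
    and projections_undefined:
      "\<not> (n \<ge> 1 \<and> X \<in> Obj C \<and> k \<in> {1..n}) \<Longrightarrow> tanpr \<X> n X k = undefined"
    and powers: "\<lbrakk>n \<ge> 1; X \<in> Obj C\<rbrakk> \<Longrightarrow>
      nfold_pullback C n ((fmor T ^^ m) (tanp \<X> X)) ((fobj T ^^ m) (tanN \<X> n X))
        (\<lambda>k. (fmor T ^^ m) (tanpr \<X> n X k))"
    and nat_z: "nat_trans C C (id_functor C) T (tanz \<X>)"
    and nat_s: "nat_trans C C (tanT2 \<X>) T (tans \<X>)"
    and nat_l: "nat_trans C C T (comp_functor C T T) (tanl \<X>)"
    and nat_c: "nat_trans C C (comp_functor C T T) (comp_functor C T T) (tanc \<X>)"
    and additive_p: "X \<in> Obj C \<Longrightarrow> additive_bundle C (tan_bundle \<X> X)"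
    and additive_l: "X \<in> Obj C \<Longrightarrow>
      additive_bundle_morphism C (tan_bundle \<X> X) (map_bundle T (tan_bundle \<X> X))
        (tanl \<X> X) (tanz \<X> X)"
    and additive_c: "X \<in> Obj C \<Longrightarrow>
      additive_bundle_morphism C (map_bundle T (tan_bundle \<X> X)) (tan_bundle \<X> (fobj T X))
        (tanc \<X> X) (Ident C (fobj T X))"
    and c_c: "X \<in> Obj C \<Longrightarrow> tanc \<X> X \<cdot> tanc \<X> X = Ident C (fobj T (fobj T X))"
    and c_l: "X \<in> Obj C \<Longrightarrow> tanc \<X> X \<cdot> tanl \<X> X = tanl \<X> X"
    and l_l: "X \<in> Obj C \<Longrightarrow>
      fmor T (tanl \<X> X) \<cdot> tanl \<X> X = tanl \<X> (fobj T X) \<cdot> tanl \<X> X"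
    and c_c_c: "X \<in> Obj C \<Longrightarrow>
      fmor T (tanc \<X> X) \<cdot> tanc \<X> (fobj T X) \<cdot> fmor T (tanc \<X> X) =
      tanc \<X> (fobj T X) \<cdot> fmor T (tanc \<X> X) \<cdot> tanc \<X> (fobj T X)"
    and c_c_l: "X \<in> Obj C \<Longrightarrow>
      tanc \<X> (fobj T X) \<cdot> fmor T (tanc \<X> X) \<cdot> tanl \<X> (fobj T X) =
      fmor T (tanl \<X> X) \<cdot> tanc \<X> X"
    and lift_universal: "X \<in> Obj C \<Longrightarrow>
      (let \<pi> = tanpr \<X> 2 X;
           \<nu> = fmor T (tans \<X> X) \<cdot>
             pb_tuple C (fobj T (tanN \<X> 2 X)) (\<lambda>k. fmor T (\<pi> k))
               [tanl \<X> X \<cdot> \<pi> 1, tanz \<X> (fobj T X) \<cdot> \<pi> 2]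
       in is_pullback C
            ((fmor T ^^ m) (fmor T (tanp \<X> X))) ((fmor T ^^ m) (tanz \<X> X))
            ((fmor T ^^ m) \<nu>) ((fmor T ^^ m) (tanp \<X> X \<cdot> \<pi> 1)))"

definition tangent_category :: "('o, 'm) tangent_cat \<Rightarrow> bool" where
  "tangent_category \<X> \<longleftrightarrow> tangent_structure \<X> (ucat \<X>) (tanT \<X>)"

definition lax_tangent_morphism ::
  "('o, 'm) tangent_cat \<Rightarrow> ('p, 'n) tangent_cat \<Rightarrow> ('o, 'm, 'p, 'n) cfunctor \<Rightarrow> ('o \<Rightarrow> 'n) \<Rightarrow> bool"
where
  "lax_tangent_morphism \<X> \<X>' F \<alpha> \<longleftrightarrow>
    (let C = ucat \<X>; C' = ucat \<X>'; T = tanT \<X>; T' = tanT \<X>' in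
      is_functor C C' F \<and>
      nat_trans C C' (comp_functor C F T) (comp_functor C T' F) \<alpha> \<and>
      (\<forall>X\<in>Obj C.
        tanp \<X>' (fobj F X) \<cdot>\<^bsub>C'\<^esub> \<alpha> X = fmor F (tanp \<X> X) \<and>
        \<alpha> X \<cdot>\<^bsub>C'\<^esub> fmor F (tanz \<X> X) = tanz \<X>' (fobj F X) \<and>
        \<alpha> X \<cdot>\<^bsub>C'\<^esub> fmor F (tans \<X> X) = tans \<X>' (fobj F X) \<cdot>\<^bsub>C'\<^esub>
          tan_pair \<X>' (fobj F X) (\<alpha> X \<cdot>\<^bsub>C'\<^esub> fmor F (tanpr \<X> 2 X 1))
            (\<alpha> X \<cdot>\<^bsub>C'\<^esub> fmor F (tanpr \<X> 2 X 2)) \<and>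
        tanl \<X>' (fobj F X) \<cdot>\<^bsub>C'\<^esub> \<alpha> X =
          fmor T' (\<alpha> X) \<cdot>\<^bsub>C'\<^esub> \<alpha> (fobj T X) \<cdot>\<^bsub>C'\<^esub> fmor F (tanl \<X> X) \<and>
        tanc \<X>' (fobj F X) \<cdot>\<^bsub>C'\<^esub> fmor T' (\<alpha> X) \<cdot>\<^bsub>C'\<^esub> \<alpha> (fobj T X) =
          fmor T' (\<alpha> X) \<cdot>\<^bsub>C'\<^esub> \<alpha> (fobj T X) \<cdot>\<^bsub>C'\<^esub> fmor F (tanc \<X> X)))"

definition strict_tangent_morphism ::
  "('o, 'm) tangent_cat \<Rightarrow> ('p, 'n) tangent_cat \<Rightarrow> ('o, 'm, 'p, 'n) cfunctor \<Rightarrow> ('o \<Rightarrow> 'n) \<Rightarrow> bool"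
where
  "strict_tangent_morphism \<X> \<X>' F \<alpha> \<longleftrightarrow>
     lax_tangent_morphism \<X> \<X>' F \<alpha> \<and>
     comp_functor (ucat \<X>) F (tanT \<X>) = comp_functor (ucat \<X>) (tanT \<X>') F \<and>
     (\<forall>X\<in>Obj (ucat \<X>). \<alpha> X = Ident (ucat \<X>') (fobj F (fobj (tanT \<X>) X)))"

type_synonym ('o, 'm) tangent_map = "('o, 'm, 'o, 'm) cfunctor \<times> ('o \<Rightarrow> 'm)"

definition TngCat_strict ::
  "(('o, 'm) tangent_cat, (('o, 'm) tangent_cat, ('o, 'm) tangent_map) arrow) cat" where
  "TngCat_strict = hom_category {\<X>. tangent_category \<X>}
     (\<lambda>\<X> \<Y>. {(F, \<alpha>). strict_tangent_morphism \<X> \<Y> F \<alpha>})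
     (\<lambda>\<X>. (id_functor (ucat \<X>), \<lambda>X\<in>Obj (ucat \<X>). Ident (ucat \<X>) (fobj (tanT \<X>) X)))
     (\<lambda>\<X> \<Y> \<Z> (G, \<beta>) (F, \<alpha>).
        (comp_functor (ucat \<X>) G F,
         \<lambda>X\<in>Obj (ucat \<X>). \<beta> (fobj F X) \<cdot>\<^bsub>ucat \<Z>\<^esub> fmor G (\<alpha> X)))"


section \<open>Modules and symmetric operads\<close>

text \<open>
  The library's record of modules also has the multiplication and unit fields of rings, which
  play no role for modules and are fixed to be \<^const>\<open>undefined\<close> here.
\<close>

definition normal_module :: "('r, 'x) ring_scheme \<Rightarrow> ('r, 'a, 'y) module_scheme \<Rightarrow> bool" where
  "normal_module R M \<longleftrightarrow> module R M \<and>
     (\<forall>x y. x \<otimes>\<^bsub>M\<^esub> y = undefined) \<and> \<one>\<^bsub>M\<^esub> = undefined \<and>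
     (\<forall>x y. \<not> (x \<in> carrier M \<and> y \<in> carrier M) \<longrightarrow> x \<oplus>\<^bsub>M\<^esub> y = undefined) \<and>
     (\<forall>r x. \<not> (r \<in> carrier R \<and> x \<in> carrier M) \<longrightarrow> r \<odot>\<^bsub>M\<^esub> x = undefined)"

definition linear_map :: "('r, 'x) ring_scheme \<Rightarrow> ('r, 'a, 'y) module_scheme \<Rightarrow>
    ('r, 'b, 'z) module_scheme \<Rightarrow> ('a \<Rightarrow> 'b) \<Rightarrow> bool" where
  "linear_map R M N f \<longleftrightarrow> f \<in> carrier M \<rightarrow> carrier N \<and>
     (\<forall>x\<in>carrier M. \<forall>y\<in>carrier M. f (x \<oplus>\<^bsub>M\<^esub> y) = f x \<oplus>\<^bsub>N\<^esub> f y) \<and>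
     (\<forall>r\<in>carrier R. \<forall>x\<in>carrier M. f (r \<odot>\<^bsub>M\<^esub> x) = r \<odot>\<^bsub>N\<^esub> f x)"

text \<open>
  \<open>osym P n \<sigma> \<mu>\<close> is the right action \<open>\<mu>\<sigma>\<close> of a permutation \<open>\<sigma>\<close> of \<open>{0, \<dots>, n - 1}\<close>.  For
  \<open>ks = [k\<^sub>1, \<dots>, k\<^sub>n]\<close>, \<open>\<mu> \<in> P(n)\<close> and \<open>\<nu>\<^sub>i \<in> P(k\<^sub>i)\<close>, \<open>ocomp P ks \<mu> [\<nu>\<^sub>1, \<dots>, \<nu>\<^sub>n]\<close> is
  the composite \<open>\<mu>(\<nu>\<^sub>1, \<dots>, \<nu>\<^sub>n)\<close> in \<open>P(k\<^sub>1 + \<dots> + k\<^sub>n)\<close>; the list \<open>ks\<close> is an argument because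
  the carriers of different arities may overlap.
\<close>

record ('r, 'p) operad =
  omod :: "nat \<Rightarrow> ('r, 'p) module"
  ounit :: 'p
  ocomp :: "nat list \<Rightarrow> 'p \<Rightarrow> 'p list \<Rightarrow> 'p"
  osym :: "nat \<Rightarrow> (nat \<Rightarrow> nat) \<Rightarrow> 'p \<Rightarrow> 'p"

definition ops :: "('r, 'p) operad \<Rightarrow> nat \<Rightarrow> 'p set" where
  "ops P n = carrier (omod P n)"

definition ops_list :: "('r, 'p) operad \<Rightarrow> nat list \<Rightarrow> 'p list \<Rightarrow> bool" where
  "ops_list P ks \<nu>s \<longleftrightarrow> list_all2 (\<lambda>k \<nu>. \<nu> \<in> ops P k) ks \<nu>s"

text \<open>\<open>(x\<^sub>0, \<dots>, x\<^sub>n\<^sub>-\<^sub>1)\<close> is sent to the list with \<open>i\<close>-th entry \<open>x\<^bsub>\<sigma>\<^sup>-\<^sup>1(i)\<^esub>\<close>.\<close>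

definition perm_args :: "(nat \<Rightarrow> nat) \<Rightarrow> 'a list \<Rightarrow> 'a list" where
  "perm_args \<sigma> xs = permute_list (inv_into UNIV \<sigma>) xs"

definition block_start :: "nat list \<Rightarrow> nat \<Rightarrow> nat" where
  "block_start ks i = sum_list (take i ks)"

text \<open>
  The permutation \<open>\<sigma>\<^bsub>k\<^sub>1,\<dots>,k\<^sub>n\<^esub>\<close> which moves the \<open>i\<close>-th block, of length \<open>k\<^sub>i\<close>, to
  the position \<open>\<sigma>(i)\<close> without changing the order inside the blocks, so that
  \<open>perm_args (block_perm \<sigma> ks) (concat xss) = concat (perm_args \<sigma> xss)\<close> if the lists in \<open>xss\<close>
  have lengths \<open>ks\<close>.
\<close>

definition block_perm :: "(nat \<Rightarrow> nat) \<Rightarrow> nat list \<Rightarrow> nat \<Rightarrow> nat" where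
  "block_perm \<sigma> ks x = (if x < sum_list ks then
     concat (map (\<lambda>i. map (\<lambda>j. block_start (perm_args \<sigma> ks) (\<sigma> i) + j) [0..<ks ! i])
       [0..<length ks]) ! x else x)"

text \<open>The block sum of permutations: \<open>\<tau>s ! i\<close> acts inside the \<open>i\<close>-th block.\<close>

definition sum_perm :: "(nat \<Rightarrow> nat) list \<Rightarrow> nat list \<Rightarrow> nat \<Rightarrow> nat" where
  "sum_perm \<tau>s ks x = (if x < sum_list ks then
     concat (map (\<lambda>i. map (\<lambda>j. block_start ks i + (\<tau>s ! i) j) [0..<ks ! i])
       [0..<length ks]) ! x else x)"

locale symmetric_operad =
  fixes R :: "('r, 'x) ring_scheme"
    and P :: "('r, 'p) operad"
  assumes module: "normal_module R (omod P n)"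
    and unit: "ounit P \<in> ops P 1"
    and sym_undefined: "\<not> (\<sigma> permutes {..<n} \<and> \<mu> \<in> ops P n) \<Longrightarrow> osym P n \<sigma> \<mu> = undefined"
    and sym_linear: "\<sigma> permutes {..<n} \<Longrightarrow> linear_map R (omod P n) (omod P n) (osym P n \<sigma>)"
    and sym_id: "\<mu> \<in> ops P n \<Longrightarrow> osym P n id \<mu> = \<mu>"
    and sym_comp: "\<lbrakk>\<sigma> permutes {..<n}; \<tau> permutes {..<n}; \<mu> \<in> ops P n\<rbrakk> \<Longrightarrow>
      osym P n (\<sigma> \<circ> \<tau>) \<mu> = osym P n \<tau> (osym P n \<sigma> \<mu>)"
    and comp_undefined: "\<not> (\<mu> \<in> ops P (length ks) \<and> ops_list P ks \<nu>s) \<Longrightarrow>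
      ocomp P ks \<mu> \<nu>s = undefined"
    and comp_linear_outer: "ops_list P ks \<nu>s \<Longrightarrow>
      linear_map R (omod P (length ks)) (omod P (sum_list ks)) (\<lambda>\<mu>. ocomp P ks \<mu> \<nu>s)"
    and comp_linear_inner: "\<lbrakk>\<mu> \<in> ops P (length ks); ops_list P ks \<nu>s; i < length ks\<rbrakk> \<Longrightarrow>
      linear_map R (omod P (ks ! i)) (omod P (sum_list ks)) (\<lambda>\<nu>. ocomp P ks \<mu> (\<nu>s[i := \<nu>]))"
    and comp_unit_left: "\<nu> \<in> ops P n \<Longrightarrow> ocomp P [n] (ounit P) [\<nu>] = \<nu>"
    and comp_unit_right: "\<mu> \<in> ops P n \<Longrightarrow>
      ocomp P (replicate n 1) \<mu> (replicate n (ounit P)) = \<mu>"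
    and comp_assoc: "\<lbrakk>\<mu> \<in> ops P (length kss); ops_list P (map length kss) \<nu>s;
        list_all2 (ops_list P) kss \<xi>ss\<rbrakk> \<Longrightarrow>
      ocomp P (concat kss) (ocomp P (map length kss) \<mu> \<nu>s) (concat \<xi>ss) =
      ocomp P (map sum_list kss) \<mu>
        (map (\<lambda>i. ocomp P (kss ! i) (\<nu>s ! i) (\<xi>ss ! i)) [0..<length kss])"
    and comp_sym_outer: "\<lbrakk>\<mu> \<in> ops P (length ks); ops_list P ks \<nu>s; \<sigma> permutes {..<length ks}\<rbrakk> \<Longrightarrow>
      ocomp P ks (osym P (length ks) \<sigma> \<mu>) \<nu>s =
      osym P (sum_list ks) (block_perm \<sigma> ks) (ocomp P (perm_args \<sigma> ks) \<mu> (perm_args \<sigma> \<nu>s))"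
    and comp_sym_inner: "\<lbrakk>\<mu> \<in> ops P (length ks); ops_list P ks \<nu>s;
        list_all2 (\<lambda>k \<tau>. \<tau> permutes {..<k}) ks \<tau>s\<rbrakk> \<Longrightarrow>
      ocomp P ks \<mu> (map (\<lambda>i. osym P (ks ! i) (\<tau>s ! i) (\<nu>s ! i)) [0..<length ks]) =
      osym P (sum_list ks) (sum_perm \<tau>s ks) (ocomp P ks \<mu> \<nu>s)"

definition operad_hom :: "('r, 'x) ring_scheme \<Rightarrow> ('r, 'p) operad \<Rightarrow> ('r, 'p) operad \<Rightarrow>
    (nat \<Rightarrow> 'p \<Rightarrow> 'p) set" where
  "operad_hom R P Q = {\<phi>.
     (\<forall>n. \<phi> n \<in> extensional (ops P n) \<and> linear_map R (omod P n) (omod Q n) (\<phi> n)) \<and>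
     (\<forall>n \<sigma>. \<forall>\<mu>\<in>ops P n. \<sigma> permutes {..<n} \<longrightarrow> \<phi> n (osym P n \<sigma> \<mu>) = osym Q n \<sigma> (\<phi> n \<mu>)) \<and>
     \<phi> 1 (ounit P) = ounit Q \<and>
     (\<forall>ks \<nu>s. \<forall>\<mu>\<in>ops P (length ks). ops_list P ks \<nu>s \<longrightarrow>
        \<phi> (sum_list ks) (ocomp P ks \<mu> \<nu>s) = ocomp Q ks (\<phi> (length ks) \<mu>) (map2 \<phi> ks \<nu>s))}"

definition Operad_cat :: "('r, 'x) ring_scheme \<Rightarrow>
    (('r, 'p) operad, (('r, 'p) operad, nat \<Rightarrow> 'p \<Rightarrow> 'p) arrow) cat" where
  "Operad_cat R = hom_category {P. symmetric_operad R P} (operad_hom R)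
     (\<lambda>P n. \<lambda>\<mu>\<in>ops P n. \<mu>)
     (\<lambda>P Q S \<psi> \<phi> n. compose (ops P n) (\<psi> n) (\<phi> n))"


section \<open>Algebras over an operad\<close>

text \<open>\<open>act A n \<mu> [a\<^sub>1, \<dots>, a\<^sub>n]\<close> is \<open>\<mu>\<^sub>A(a\<^sub>1, \<dots>, a\<^sub>n)\<close> for \<open>\<mu> \<in> P(n)\<close>.\<close>

record ('r, 'a, 'p) alg = "('r, 'a) module" +
  act :: "nat \<Rightarrow> 'p \<Rightarrow> 'a list \<Rightarrow> 'a"

definition args :: "('r, 'a, 'y) module_scheme \<Rightarrow> nat \<Rightarrow> 'a list set" where
  "args A n = {as. length as = n \<and> set as \<subseteq> carrier A}"

locale operad_algebra =
  fixes R :: "('r, 'x) ring_scheme"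
    and P :: "('r, 'p) operad"
    and A :: "('r, 'a, 'p) alg"
  assumes operad: "symmetric_operad R P"
    and module: "normal_module R A"
    and act_undefined: "\<not> (\<mu> \<in> ops P n \<and> as \<in> args A n) \<Longrightarrow> act A n \<mu> as = undefined"
    and act_linear_op: "as \<in> args A n \<Longrightarrow> linear_map R (omod P n) A (\<lambda>\<mu>. act A n \<mu> as)"
    and act_linear_arg: "\<lbrakk>\<mu> \<in> ops P n; as \<in> args A n; i < n\<rbrakk> \<Longrightarrow>
      linear_map R A A (\<lambda>a. act A n \<mu> (as[i := a]))"
    and act_unit: "a \<in> carrier A \<Longrightarrow> act A 1 (ounit P) [a] = a"
    and act_comp: "\<lbrakk>\<mu> \<in> ops P (length ks); ops_list P ks \<nu>s;
        list_all2 (\<lambda>k as. as \<in> args A k) ks ass\<rbrakk> \<Longrightarrow>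
      act A (sum_list ks) (ocomp P ks \<mu> \<nu>s) (concat ass) =
      act A (length ks) \<mu> (map (\<lambda>i. act A (ks ! i) (\<nu>s ! i) (ass ! i)) [0..<length ks])"
    and act_sym: "\<lbrakk>\<mu> \<in> ops P n; as \<in> args A n; \<sigma> permutes {..<n}\<rbrakk> \<Longrightarrow>
      act A n (osym P n \<sigma> \<mu>) as = act A n \<mu> (perm_args \<sigma> as)"

definition alg_hom :: "('r, 'x) ring_scheme \<Rightarrow> ('r, 'p) operad \<Rightarrow>
    ('r, 'a, 'p) alg \<Rightarrow> ('r, 'a, 'p) alg \<Rightarrow> ('a \<Rightarrow> 'a) set" where
  "alg_hom R P A B = {h \<in> extensional (carrier A). linear_map R A B h \<and>
     (\<forall>n. \<forall>\<mu>\<in>ops P n. \<forall>as\<in>args A n. h (act A n \<mu> as) = act B n \<mu> (map h as))}"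

text \<open>
  HOL has no type of all sets, so the carriers of the algebras are taken among the subsets of one
  type.  Since the tangent functor pairs elements, this type has to contain tuples of its
  elements; over an arbitrary type of atoms the following one does, and it has a subset of every
  cardinality realised in the type of atoms.
\<close>

datatype 'u tuples = Atom 'u | Tuple (entries: "'u tuples list")

type_synonym ('r, 'u, 'p) talg = "('r, 'u tuples, 'p) alg"
type_synonym ('r, 'u, 'p) talg_arrow = "(('r, 'u, 'p) talg, 'u tuples \<Rightarrow> 'u tuples) arrow"

definition Alg_cat :: "('r, 'x) ring_scheme \<Rightarrow> ('r, 'p) operad \<Rightarrow>
    (('r, 'u, 'p) talg, ('r, 'u, 'p) talg_arrow) cat" where
  "Alg_cat R P = hom_category {A. operad_algebra R P A} (alg_hom R P)
     (\<lambda>A. \<lambda>a\<in>carrier A. a) (\<lambda>A B D g f. compose (carrier A) g f)"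


section \<open>The algebraic tangent structure\<close>

text \<open>
  \<open>semidirect R P n A\<close> is \<open>A \<ltimes> (A \<times> \<dots> \<times> A)\<close> with \<open>n\<close> factors in the second component;
  the element \<open>(a; b\<^sub>1, \<dots>, b\<^sub>n)\<close> is \<open>Tuple [a, b\<^sub>1, \<dots>, b\<^sub>n]\<close>.
\<close>

definition entry :: "nat \<Rightarrow> 'u tuples \<Rightarrow> 'u tuples" where
  "entry j x = entries x ! j"

definition semidirect :: "('r, 'x) ring_scheme \<Rightarrow> ('r, 'p) operad \<Rightarrow> nat \<Rightarrow>
    ('r, 'u, 'p) talg \<Rightarrow> ('r, 'u, 'p) talg" where
  "semidirect R P n A = (let K = Tuple ` args A (Suc n) in
     \<lparr>carrier = K,
      monoid.mult = (\<lambda>x y. undefined),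
      one = undefined,
      zero = Tuple (replicate (Suc n) \<zero>\<^bsub>A\<^esub>),
      add = (\<lambda>x y. if x \<in> K \<and> y \<in> K
        then Tuple (map (\<lambda>j. entry j x \<oplus>\<^bsub>A\<^esub> entry j y) [0..<Suc n]) else undefined),
      smult = (\<lambda>r x. if r \<in> carrier R \<and> x \<in> K
        then Tuple (map (\<lambda>j. r \<odot>\<^bsub>A\<^esub> entry j x) [0..<Suc n]) else undefined),
      act = (\<lambda>m \<mu> xs. if \<mu> \<in> ops P m \<and> length xs = m \<and> set xs \<subseteq> K
        then Tuple (act A m \<mu> (map (entry 0) xs) #
          map (\<lambda>j. \<Oplus>\<^bsub>A\<^esub>k\<in>{..<m}. act A m \<mu> ((map (entry 0) xs)[k := entry j (xs ! k)]))
            [1..<Suc n])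
        else undefined)\<rparr>)"

definition tangent_alg :: "('r, 'x) ring_scheme \<Rightarrow> ('r, 'p) operad \<Rightarrow>
    ('r, 'u, 'p) talg \<Rightarrow> ('r, 'u, 'p) talg" where
  "tangent_alg R P A = semidirect R P 1 A"

definition tangent_map_alg :: "('r, 'x) ring_scheme \<Rightarrow> ('r, 'p) operad \<Rightarrow>
    ('r, 'u, 'p) talg_arrow \<Rightarrow> ('r, 'u, 'p) talg_arrow" where
  "tangent_map_alg R P f =
     Arrow (tangent_alg R P (src f))
       (\<lambda>x\<in>carrier (tangent_alg R P (src f)).
          Tuple [arrow_map f (entry 0 x), arrow_map f (entry 1 x)])
       (tangent_alg R P (tgt f))"

definition alg_tangent :: "('r, 'x) ring_scheme \<Rightarrow> ('r, 'p) operad \<Rightarrow>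
    (('r, 'u, 'p) talg, ('r, 'u, 'p) talg_arrow) tangent_cat" where
  "alg_tangent R P =
    (let C = Alg_cat R P; T = tangent_alg R P; S = semidirect R P;
         arr = (\<lambda>A h B. Arrow A (restrict h (carrier A)) B) in
     \<lparr>ucat = C,
      tanT = \<lparr>fobj = (\<lambda>A\<in>Obj C. T A), fmor = (\<lambda>f\<in>Arr C. tangent_map_alg R P f)\<rparr>,
      tanN = (\<lambda>n A. if n \<ge> 1 \<and> A \<in> Obj C then S n A else undefined),
      tanpr = (\<lambda>n A k. if n \<ge> 1 \<and> A \<in> Obj C \<and> k \<in> {1..n}
        then arr (S n A) (\<lambda>x. Tuple [entry 0 x, entry k x]) (T A) else undefined),
      tanp = (\<lambda>A\<in>Obj C. arr (T A) (entry 0) A),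
      tanz = (\<lambda>A\<in>Obj C. arr A (\<lambda>a. Tuple [a, \<zero>\<^bsub>A\<^esub>]) (T A)),
      tans = (\<lambda>A\<in>Obj C. arr (S 2 A)
        (\<lambda>x. Tuple [entry 0 x, entry 1 x \<oplus>\<^bsub>A\<^esub> entry 2 x]) (T A)),
      tanl = (\<lambda>A\<in>Obj C. arr (T A)
        (\<lambda>x. Tuple [Tuple [entry 0 x, \<zero>\<^bsub>A\<^esub>], Tuple [\<zero>\<^bsub>A\<^esub>, entry 1 x]]) (T (T A))),
      tanc = (\<lambda>A\<in>Obj C. arr (T (T A))
        (\<lambda>x. Tuple [Tuple [entry 0 (entry 0 x), entry 0 (entry 1 x)],
                    Tuple [entry 1 (entry 0 x), entry 1 (entry 1 x)]]) (T (T A)))\<rparr>)"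


section \<open>Restriction along a morphism of operads\<close>

definition restrict_alg :: "('r, 'p) operad \<Rightarrow> (nat \<Rightarrow> 'p \<Rightarrow> 'p) \<Rightarrow>
    ('r, 'a, 'p) alg \<Rightarrow> ('r, 'a, 'p) alg" where
  "restrict_alg P \<phi> B = B\<lparr>act := (\<lambda>n \<mu> bs.
     if \<mu> \<in> ops P n \<and> bs \<in> args B n then act B n (\<phi> n \<mu>) bs else undefined)\<rparr>"

definition restriction_functor :: "('r, 'x) ring_scheme \<Rightarrow> ('r, 'p) operad \<Rightarrow>
    (nat \<Rightarrow> 'p \<Rightarrow> 'p) \<Rightarrow> ('r, 'p) operad \<Rightarrow>
    (('r, 'u, 'p) talg, ('r, 'u, 'p) talg_arrow,
     ('r, 'u, 'p) talg, ('r, 'u, 'p) talg_arrow) cfunctor" where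
  "restriction_functor R P \<phi> Q =
     \<lparr>fobj = (\<lambda>B\<in>Obj (Alg_cat R Q). restrict_alg P \<phi> B),
      fmor = (\<lambda>h\<in>Arr (Alg_cat R Q).
        Arrow (restrict_alg P \<phi> (src h)) (arrow_map h) (restrict_alg P \<phi> (tgt h)))\<rparr>"

text \<open>The natural transformation is the identity of \<open>\<phi>\<^sup>* \<circ> T = T \<circ> \<phi>\<^sup>*\<close>.\<close>

definition restriction_tangent_map :: "('r, 'x) ring_scheme \<Rightarrow> ('r, 'p) operad \<Rightarrow>
    (nat \<Rightarrow> 'p \<Rightarrow> 'p) \<Rightarrow> ('r, 'p) operad \<Rightarrow>
    (('r, 'u, 'p) talg, ('r, 'u, 'p) talg_arrow) tangent_map" where
  "restriction_tangent_map R P \<phi> Q =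
     (restriction_functor R P \<phi> Q,
      \<lambda>B\<in>Obj (Alg_cat R Q). Ident (Alg_cat R P) (restrict_alg P \<phi> (tangent_alg R Q B)))"

end

(*
  All pullbacks in question are computed on underlying sets: a cone of algebra morphisms which is
  jointly injective and jointly surjective onto the compatible families is a pullback, and this
  elementwise condition is stable under the tangent functor because elements of TA are pairs.
  After that every tangent axiom is an identity between explicit maps of tuples.  The algebra
  content sits in the derivation D(mu)(a; b) = sum_k mu(a_1, ..., b_k, ..., a_m): a map into
  A |x A is a morphism iff its components are a morphism f and an f-derivation, and the canonical
  flip is a morphism because the second derivative D(D mu) is symmetric.  For a strict tangent
  morphism the natural transformation is determined by the functor, so functoriality in the
  operad only has to be checked on underlying functors.
*)
theory Submission
  imports Defs
begin

section \<open>Categories and functors\<close>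

text \<open>Strictness is an equation of records, so restriction has to commute with the tangent
  construction on the nose, values outside all domains included. It does, because the action on a
  semidirect product consults the operad only at the one operation being evaluated: replacing
  \<open>\<mu>\<close> by its image before or after forming the product gives the same sums. That
  the product is again an algebra is a calculus of the derivation: compatibility with operadic
  composition is the chain rule, equivariance is a reindexing of the sum, and multilinearity holds
  because each summand contains exactly one entry of the direction. The chosen fibre powers of two
  tangent categories need not correspond under a strict morphism. Hence the sum axiom alone keeps a
  comparison map F T_2 X -> T_2 F X, and composing strict morphisms means composing these maps.
  Pairings into fibre powers are definite descriptions and cannot be computed directly; they are
  identified by guessing their values on elements and checking the projections.\<close>

lemma (in category) in_hom_Obj: "in_hom C f X Y \<Longrightarrow> X \<in> Obj C \<and> Y \<in> Obj C"
  using dom_obj cod_obj by (auto simp: in_hom_def)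

lemma (in category) Arr_in_hom: "f \<in> Arr C \<Longrightarrow> in_hom C f (Dom C f) (Cod C f)"
  by (simp add: in_hom_def)

lemma (in category) category_op: "category (op_cat C)"
proof -
  have hom: "in_hom (op_cat C) f X Y \<longleftrightarrow> in_hom C f Y X" for f X Y
    by (auto simp: in_hom_def op_cat_def)
  have comp: "g \<cdot>\<^bsub>op_cat C\<^esub> f = f \<cdot> g" for f g
    by (simp add: op_cat_def)
  have sel: "Obj (op_cat C) = Obj C" "Arr (op_cat C) = Arr C" "Dom (op_cat C) = Cod C"
    "Cod (op_cat C) = Dom C" "Ident (op_cat C) = Ident C"
    by (simp_all add: op_cat_def)
  show ?thesis
  proof
    fix f g h W X Y Z
    assume "in_hom (op_cat C) f W X" "in_hom (op_cat C) g X Y" "in_hom (op_cat C) h Y Z"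
    then show "h \<cdot>\<^bsub>op_cat C\<^esub> g \<cdot>\<^bsub>op_cat C\<^esub> f = h \<cdot>\<^bsub>op_cat C\<^esub> (g \<cdot>\<^bsub>op_cat C\<^esub> f)"
      unfolding hom comp by - (rule comp_assoc[symmetric])
  next
    fix f g assume "\<not> (f \<in> Arr (op_cat C) \<and> g \<in> Arr (op_cat C) \<and> Cod (op_cat C) f = Dom (op_cat C) g)"
    then show "g \<cdot>\<^bsub>op_cat C\<^esub> f = undefined"
      unfolding sel comp by (intro comp_undefined) auto
  qed (unfold hom comp sel, (rule dom_obj cod_obj ident_ext ident_hom ident_left ident_right comp_hom; assumption?)+)
qed

section \<open>Categories presented by hom-sets\<close>

lemma Obj_hom_category [simp]: "Obj (hom_category Ob H i k) = Ob"
  by (simp add: hom_category_def Let_def)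

lemma Arr_hom_category:
  "Arr (hom_category Ob H i k) = {Arrow X f Y | X f Y. X \<in> Ob \<and> Y \<in> Ob \<and> f \<in> H X Y}"
  by (simp add: hom_category_def Let_def)

lemma Arrow_in_Arr [simp]:
  "Arrow X f Y \<in> Arr (hom_category Ob H i k) \<longleftrightarrow> X \<in> Ob \<and> Y \<in> Ob \<and> f \<in> H X Y"
  by (auto simp: Arr_hom_category)

lemma Dom_hom_category [simp]:
  "h \<in> Arr (hom_category Ob H i k) \<Longrightarrow> Dom (hom_category Ob H i k) h = src h"
  by (simp add: hom_category_def Let_def)

lemma Cod_hom_category [simp]:
  "h \<in> Arr (hom_category Ob H i k) \<Longrightarrow> Cod (hom_category Ob H i k) h = tgt h"
  by (simp add: hom_category_def Let_def)

lemma Ident_hom_category [simp]: "X \<in> Ob \<Longrightarrow> Ident (hom_category Ob H i k) X = Arrow X (i X) X"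
  by (simp add: hom_category_def Let_def)

lemma in_hom_hom_category:
  "in_hom (hom_category Ob H i k) h X Y \<longleftrightarrow>
    X \<in> Ob \<and> Y \<in> Ob \<and> (\<exists>f\<in>H X Y. h = Arrow X f Y)"
proof -
  have "in_hom (hom_category Ob H i k) h X Y \<longleftrightarrow>
      h \<in> Arr (hom_category Ob H i k) \<and> src h = X \<and> tgt h = Y"
    by (auto simp: in_hom_def)
  then show ?thesis
    by (cases h) auto
qed

lemma Comp_hom_category:
  "\<lbrakk>X \<in> Ob; Y \<in> Ob; Z \<in> Ob; f \<in> H X Y; g \<in> H Y Z\<rbrakk> \<Longrightarrow>
    Comp (hom_category Ob H i k) (Arrow Y g Z) (Arrow X f Y) = Arrow X (k X Y Z g f) Z"
  by (auto simp: hom_category_def Let_def)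

text \<open>Operads, algebras and tangent categories are all presented by hom-sets, so the axioms
  for each come down to these laws on bare maps; endpoints and undefined composites are settled here
  once for all three.\<close>

lemma category_hom_category:
  assumes id: "\<And>X. X \<in> Ob \<Longrightarrow> i X \<in> H X X"
    and comp: "\<And>X Y Z f g. \<lbrakk>X \<in> Ob; Y \<in> Ob; Z \<in> Ob; f \<in> H X Y; g \<in> H Y Z\<rbrakk> \<Longrightarrow> k X Y Z g f \<in> H X Z"
    and assoc: "\<And>W X Y Z f g h. \<lbrakk>W \<in> Ob; X \<in> Ob; Y \<in> Ob; Z \<in> Ob; f \<in> H W X; g \<in> H X Y; h \<in> H Y Z\<rbrakk>
      \<Longrightarrow> k W X Z (k X Y Z h g) f = k W Y Z h (k W X Y g f)"
    and left: "\<And>X Y f. \<lbrakk>X \<in> Ob; Y \<in> Ob; f \<in> H X Y\<rbrakk> \<Longrightarrow> k X Y Y (i Y) f = f"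
    and right: "\<And>X Y f. \<lbrakk>X \<in> Ob; Y \<in> Ob; f \<in> H X Y\<rbrakk> \<Longrightarrow> k X X Y f (i X) = f"
  shows "category (hom_category Ob H i k)"
proof -
  let ?C = "hom_category Ob H i k"
  note defs = in_hom_hom_category Comp_hom_category
  show ?thesis
  proof
    show "Dom ?C \<in> Arr ?C \<rightarrow>\<^sub>E Obj ?C" "Cod ?C \<in> Arr ?C \<rightarrow>\<^sub>E Obj ?C"
      by (auto simp: Arr_hom_category hom_category_def Let_def)
    show "Ident ?C \<in> extensional (Obj ?C)"
      by (auto simp: hom_category_def Let_def)
  next
    fix f g assume "\<not> (f \<in> Arr ?C \<and> g \<in> Arr ?C \<and> Cod ?C f = Dom ?C g)"
    then show "Comp ?C g f = undefined"
      by (auto simp: hom_category_def Let_def)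
  qed (auto simp: defs id comp assoc left right)
qed

section \<open>Functors and natural transformations\<close>

lemma functor_categories: "is_functor C D F \<Longrightarrow> category C \<and> category D"
  by (simp add: is_functor_def)

lemma functor_Obj: "is_functor C D F \<Longrightarrow> X \<in> Obj C \<Longrightarrow> fobj F X \<in> Obj D"
  by (auto simp: is_functor_def)

lemma functor_Arr: "is_functor C D F \<Longrightarrow> f \<in> Arr C \<Longrightarrow> fmor F f \<in> Arr D"
  by (auto simp: is_functor_def)

lemma functor_hom: "is_functor C D F \<Longrightarrow> in_hom C f X Y \<Longrightarrow> in_hom D (fmor F f) (fobj F X) (fobj F Y)"
  by (auto simp: is_functor_def in_hom_def)

lemma functor_Ident: "is_functor C D F \<Longrightarrow> X \<in> Obj C \<Longrightarrow> fmor F (Ident C X) = Ident D (fobj F X)"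
  by (simp add: is_functor_def)

lemma functor_Comp: "\<lbrakk>is_functor C D F; in_hom C f X Y; in_hom C g Y Z\<rbrakk> \<Longrightarrow>
    fmor F (g \<cdot>\<^bsub>C\<^esub> f) = fmor F g \<cdot>\<^bsub>D\<^esub> fmor F f"
  by (auto simp: is_functor_def in_hom_def)

lemma is_functorI:
  assumes "category C" "category D" "fobj F \<in> extensional (Obj C)" "fmor F \<in> extensional (Arr C)"
    and "\<And>X. X \<in> Obj C \<Longrightarrow> fobj F X \<in> Obj D"
    and "\<And>f X Y. in_hom C f X Y \<Longrightarrow> in_hom D (fmor F f) (fobj F X) (fobj F Y)"
    and "\<And>X. X \<in> Obj C \<Longrightarrow> fmor F (Ident C X) = Ident D (fobj F X)"
    and "\<And>f g X Y Z. in_hom C f X Y \<Longrightarrow> in_hom C g Y Z \<Longrightarrow>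
      fmor F (g \<cdot>\<^bsub>C\<^esub> f) = fmor F g \<cdot>\<^bsub>D\<^esub> fmor F f"
  shows "is_functor C D F"
proof -
  have hom: "in_hom D (fmor F f) (fobj F (Dom C f)) (fobj F (Cod C f))" if "f \<in> Arr C" for f
    using assms(6) that by (simp add: in_hom_def)
  then have "fmor F f \<in> Arr D" if "f \<in> Arr C" for f
    using that by (simp add: in_hom_def)
  with hom show ?thesis
    using assms(1-5,7) assms(8)[unfolded in_hom_def] by (auto simp: is_functor_def PiE_def)
qed

lemma is_functor_id:
  fixes C (structure)
  assumes "category C"
  shows "is_functor C C (id_functor C)"
proof -
  interpret category C by (rule assms)
  have sel: "fmor (id_functor C) f = f" if "in_hom C f X Y" for f X Y
    using that by (simp add: id_functor_def in_hom_def)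
  show ?thesis
  proof (rule is_functorI)
    fix f X Y assume f: "in_hom C f X Y"
    then show "in_hom C (fmor (id_functor C) f) (fobj (id_functor C) X) (fobj (id_functor C) Y)"
      using in_hom_Obj[OF f] by (simp add: sel[OF f]) (simp add: id_functor_def)
  next
    fix f g X Y Z assume f: "in_hom C f X Y" and g: "in_hom C g Y Z"
    then show "fmor (id_functor C) (g \<cdot> f) = fmor (id_functor C) g \<cdot> fmor (id_functor C) f"
      by (simp add: sel[OF f] sel[OF g] sel[OF comp_hom[OF f g]])
  qed (auto simp: assms sel[OF ident_hom], auto simp: id_functor_def)
qed

lemma is_functor_comp:
  assumes F: "is_functor C D F" and G: "is_functor D E G"
  shows "is_functor C E (comp_functor C G F)"
proof -
  interpret C: category C using functor_categories[OF F] by simp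
  have sel: "fobj (comp_functor C G F) X = fobj G (fobj F X)" if "X \<in> Obj C" for X
    using that by (simp add: comp_functor_def)
  have sel': "fmor (comp_functor C G F) f = fmor G (fmor F f)" if "in_hom C f X Y" for f X Y
    using that by (simp add: comp_functor_def in_hom_def)
  show ?thesis
  proof (rule is_functorI)
    fix f g X Y Z assume fg: "in_hom C f X Y" "in_hom C g Y Z"
    then show "fmor (comp_functor C G F) (g \<cdot>\<^bsub>C\<^esub> f) =
        fmor (comp_functor C G F) g \<cdot>\<^bsub>E\<^esub> fmor (comp_functor C G F) f"
      using functor_Comp[OF G functor_hom[OF F fg(1)] functor_hom[OF F fg(2)]]
      by (simp add: sel'[OF fg(1)] sel'[OF fg(2)] sel'[OF C.comp_hom[OF fg]] functor_Comp[OF F fg])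
  next
    fix f X Y assume f: "in_hom C f X Y"
    then show "in_hom E (fmor (comp_functor C G F) f) (fobj (comp_functor C G F) X)
        (fobj (comp_functor C G F) Y)"
      using functor_hom[OF G functor_hom[OF F f]] C.in_hom_Obj[OF f] by (simp add: sel sel'[OF f])
  qed (use functor_categories[OF F] functor_categories[OF G] functor_Obj[OF F] functor_Obj[OF G] in
      \<open>auto simp: sel sel'[OF C.ident_hom] functor_Ident[OF F] functor_Ident[OF G]\<close>,
    auto simp: comp_functor_def)
qed

text \<open>\<open>F\<close> lands in \<open>D\<close>, so the restriction to \<open>D\<close>
  inside \<open>comp_functor D H G\<close> is never felt and the two composites agree as
  records.\<close>

lemma comp_functor_assoc:
  "is_functor C D F \<Longrightarrow>
    comp_functor C (comp_functor D H G) F = comp_functor C H (comp_functor C G F)"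
  by (auto simp: comp_functor_def functor_Obj functor_Arr cong: restrict_cong)

lemma functor_extensional:
  "is_functor C D F \<Longrightarrow> fobj F \<in> extensional (Obj C) \<and> fmor F \<in> extensional (Arr C)"
  by (simp add: is_functor_def PiE_def)

text \<open>Composition restricts its result to \<open>C\<close>; the original \<open>F\<close>
  comes back literally because a functor is extensional on objects and on arrows.\<close>

lemma comp_functor_id_left: "is_functor C D F \<Longrightarrow> comp_functor C (id_functor D) F = F"
  using functor_extensional[of C D F]
  by (auto simp: comp_functor_def id_functor_def functor_Obj functor_Arr extensional_restrict
      cong: restrict_cong)

lemma comp_functor_id_right: "is_functor C D F \<Longrightarrow> comp_functor C F (id_functor C) = F"
  using functor_extensional[of C D F]
  by (auto simp: comp_functor_def id_functor_def extensional_restrict cong: restrict_cong)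

lemma nat_transI:
  assumes "is_functor C D F" "is_functor C D G" "\<alpha> \<in> extensional (Obj C)"
    and "\<And>X. X \<in> Obj C \<Longrightarrow> in_hom D (\<alpha> X) (fobj F X) (fobj G X)"
    and "\<And>f X Y. in_hom C f X Y \<Longrightarrow> \<alpha> Y \<cdot>\<^bsub>D\<^esub> fmor F f = fmor G f \<cdot>\<^bsub>D\<^esub> \<alpha> X"
  shows "nat_trans C D F G \<alpha>"
  using assms by (auto simp: nat_trans_def in_hom_def)

lemma nat_trans_hom: "nat_trans C D F G \<alpha> \<Longrightarrow> X \<in> Obj C \<Longrightarrow> in_hom D (\<alpha> X) (fobj F X) (fobj G X)"
  by (simp add: nat_trans_def)

section \<open>Fibre powers and pairing\<close>

lemma nfold_pullback_proj:
  "nfold_pullback C n q Q \<pi> \<Longrightarrow> k \<in> {1..n} \<Longrightarrow> in_hom C (\<pi> k) Q (Dom C q) \<and> q \<cdot>\<^bsub>C\<^esub> \<pi> k = q \<cdot>\<^bsub>C\<^esub> \<pi> 1"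
  unfolding nfold_pullback_def by blast

lemma ball_1_2: "(\<forall>k\<in>{1..2::nat}. P k) \<longleftrightarrow> P 1 \<and> P 2"
proof -
  have "{1..2::nat} = {1, 2}" by auto
  then show ?thesis by simp
qed

lemma nfold_pullback_ex1:
  "\<lbrakk>nfold_pullback C n q Q \<pi>; \<forall>k\<in>{1..n}. in_hom C (f k) Z (Dom C q) \<and> q \<cdot>\<^bsub>C\<^esub> f k = q \<cdot>\<^bsub>C\<^esub> f 1\<rbrakk> \<Longrightarrow>
    \<exists>!h. in_hom C h Z Q \<and> (\<forall>k\<in>{1..n}. \<pi> k \<cdot>\<^bsub>C\<^esub> h = f k)"
  unfolding nfold_pullback_def
  by (drule conjunct2, drule conjunct2, drule conjunct2, drule spec[of _ Z], drule spec[of _ f], drule mp)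

lemma nfold_pullback_ex1_pair:
  assumes "nfold_pullback C 2 q Q \<pi>" "in_hom C f Z (Dom C q)" "in_hom C g Z (Dom C q)"
    "q \<cdot>\<^bsub>C\<^esub> f = q \<cdot>\<^bsub>C\<^esub> g"
  shows "\<exists>!h. in_hom C h Z Q \<and> \<pi> 1 \<cdot>\<^bsub>C\<^esub> h = f \<and> \<pi> 2 \<cdot>\<^bsub>C\<^esub> h = g"
proof -
  show ?thesis
    using nfold_pullback_ex1[OF assms(1), of "\<lambda>k. if k = 1 then f else g" Z] assms(2-4)
    unfolding ball_1_2 by simp
qed

text \<open>The definite description in \<open>pb_tuple\<close> takes its source from the head of
  the list, here \<open>Z\<close>, so the universal property makes it describe exactly one arrow,
  which then has the described properties.\<close>

lemma pb_pair:
  assumes "nfold_pullback C 2 q Q \<pi>" "in_hom C f Z (Dom C q)" "in_hom C g Z (Dom C q)"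
    "q \<cdot>\<^bsub>C\<^esub> f = q \<cdot>\<^bsub>C\<^esub> g"
  shows "in_hom C (pb_tuple C Q \<pi> [f, g]) Z Q"
    and "\<pi> 1 \<cdot>\<^bsub>C\<^esub> pb_tuple C Q \<pi> [f, g] = f"
    and "\<pi> 2 \<cdot>\<^bsub>C\<^esub> pb_tuple C Q \<pi> [f, g] = g"
proof -
  note ex = nfold_pullback_ex1_pair[OF assms]
  have len: "length [f, g] = 2" by simp
  have "pb_tuple C Q \<pi> [f, g] = (THE h. in_hom C h Z Q \<and> \<pi> 1 \<cdot>\<^bsub>C\<^esub> h = f \<and> \<pi> 2 \<cdot>\<^bsub>C\<^esub> h = g)"
    using assms(2) unfolding pb_tuple_def len ball_1_2 by (simp add: in_hom_def)
  with theI'[OF ex] show "in_hom C (pb_tuple C Q \<pi> [f, g]) Z Q"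
    "\<pi> 1 \<cdot>\<^bsub>C\<^esub> pb_tuple C Q \<pi> [f, g] = f" "\<pi> 2 \<cdot>\<^bsub>C\<^esub> pb_tuple C Q \<pi> [f, g] = g"
    by auto
qed

context category begin

text \<open>Compatibility of \<open>f\<close> and \<open>g\<close> over the base is inherited from
  the projections by precomposing with \<open>h\<close>, so a candidate for the pairing is tested on
  the two projections alone.\<close>

lemma pb_pair_eqI:
  assumes pb: "nfold_pullback C 2 q Q \<pi>" and h: "in_hom C h Z Q"
    and "\<pi> 1 \<cdot> h = f" "\<pi> 2 \<cdot> h = g"
  shows "pb_tuple C Q \<pi> [f, g] = h"
proof -
  have q: "in_hom C q (Dom C q) (Cod C q)"
    using pb unfolding nfold_pullback_def by (intro Arr_in_hom) blast
  have \<pi>: "in_hom C (\<pi> 1) Q (Dom C q)" "in_hom C (\<pi> 2) Q (Dom C q)" "q \<cdot> \<pi> 2 = q \<cdot> \<pi> 1"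
    using nfold_pullback_proj[OF pb, of 1] nfold_pullback_proj[OF pb, of 2] by auto
  have fg: "in_hom C f Z (Dom C q)" "in_hom C g Z (Dom C q)"
    using comp_hom[OF h \<pi>(1)] comp_hom[OF h \<pi>(2)] assms(3,4) by simp_all
  have "q \<cdot> f = q \<cdot> g"
    using comp_assoc[OF h \<pi>(1) q] comp_assoc[OF h \<pi>(2) q] \<pi>(3) assms(3,4) by simp
  note pair = pb_pair[OF pb fg this]
  have "\<exists>!h. in_hom C h Z Q \<and> \<pi> 1 \<cdot> h = f \<and> \<pi> 2 \<cdot> h = g"
    using nfold_pullback_ex1_pair[OF pb fg] \<open>q \<cdot> f = q \<cdot> g\<close> by simp
  then show ?thesis using pair assms by blast
qed

text \<open>Both sides have the same projections. It is used to compose the comparison maps of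
  strict tangent morphisms.\<close>

lemma pb_pair_comp:
  assumes pb: "nfold_pullback C 2 q Q \<pi>" and "in_hom C f Z (Dom C q)" "in_hom C g Z (Dom C q)"
    "q \<cdot> f = q \<cdot> g" and h: "in_hom C h W Z"
  shows "pb_tuple C Q \<pi> [f, g] \<cdot> h = pb_tuple C Q \<pi> [f \<cdot> h, g \<cdot> h]"
proof -
  note pair = pb_pair[OF assms(1-4)]
  have \<pi>: "in_hom C (\<pi> 1) Q (Dom C q)" "in_hom C (\<pi> 2) Q (Dom C q)"
    using nfold_pullback_proj[OF pb, of 1] nfold_pullback_proj[OF pb, of 2] by auto
  show ?thesis
    using comp_assoc[OF h pair(1) \<pi>(1)] comp_assoc[OF h pair(1) \<pi>(2)] pair(2,3)
    by (intro pb_pair_eqI[OF pb comp_hom[OF h pair(1)], symmetric]) simp_all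
qed

text \<open>Preservation enters as the hypothesis \<open>pb'\<close> that the image cone is again a
  pullback: the image of the pairing has the projections that characterise the pairing in
  \<open>D\<close>.\<close>

lemma functor_pb_pair:
  assumes F: "is_functor C D F" and pb: "nfold_pullback C 2 q Q \<pi>"
    and pb': "nfold_pullback D 2 (fmor F q) (fobj F Q) (\<lambda>k. fmor F (\<pi> k))"
    and fg: "in_hom C f Z (Dom C q)" "in_hom C g Z (Dom C q)" "q \<cdot> f = q \<cdot> g"
  shows "fmor F (pb_tuple C Q \<pi> [f, g]) =
    pb_tuple D (fobj F Q) (\<lambda>k. fmor F (\<pi> k)) [fmor F f, fmor F g]"
proof -
  interpret D: category D using functor_categories[OF F] by simp
  note pair = pb_pair[OF pb fg]
  have \<pi>: "in_hom C (\<pi> 1) Q (Dom C q)" "in_hom C (\<pi> 2) Q (Dom C q)"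
    using nfold_pullback_proj[OF pb, of 1] nfold_pullback_proj[OF pb, of 2] by auto
  show ?thesis
    using functor_Comp[OF F pair(1) \<pi>(1)] functor_Comp[OF F pair(1) \<pi>(2)] pair(2,3)
    by (intro D.pb_pair_eqI[OF pb' functor_hom[OF F pair(1)], symmetric]) simp_all
qed

end

text \<open>The bundle axioms are equations between composites, and the only ingredient that a
  functor might fail to respect is the pairing; \<open>pb'\<close> rules this out. It produces the
  additive bundle on \<open>T p\<close> from the one on \<open>p\<close>.\<close>

lemma additive_bundle_map:
  assumes F: "is_functor C D F" and B: "additive_bundle C B"
    and pb': "\<And>n. n \<ge> 1 \<Longrightarrow> nfold_pullback D n (fmor F (bproj B)) (fobj F (bpow B n))
      (\<lambda>k. fmor F (bpr B n k))"
  shows "additive_bundle D (map_bundle F B)"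
proof -
  interpret C: category C using functor_categories[OF F] by simp
  define q E M where "q = bproj B" and "E = Dom C q" and "M = Cod C q"
  define \<zeta> \<sigma> Q \<pi> \<rho> where "\<zeta> = bzero B" and "\<sigma> = bsum B" and "Q = bpow B 2" and "\<pi> = bpr B 2"
    and "\<rho> = bpr B 3"
  note defs = q_def E_def M_def \<zeta>_def \<sigma>_def Q_def \<pi>_def \<rho>_def
  define pair where "pair = (\<lambda>f g. pb_tuple C Q \<pi> [f, g])"
  define pair' where "pair' = (\<lambda>f g. pb_tuple D (fobj F Q) (\<lambda>k. fmor F (\<pi> k)) [f, g])"
  have ab: "q \<in> Arr C" "\<And>n. n \<ge> 1 \<Longrightarrow> nfold_pullback C n q (bpow B n) (bpr B n)"
    "in_hom C \<zeta> M E" "q \<cdot>\<^bsub>C\<^esub> \<zeta> = Ident C M" "in_hom C \<sigma> Q E" "q \<cdot>\<^bsub>C\<^esub> \<sigma> = q \<cdot>\<^bsub>C\<^esub> \<pi> 1"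
    "\<sigma> \<cdot>\<^bsub>C\<^esub> pair (\<zeta> \<cdot>\<^bsub>C\<^esub> q) (Ident C E) = Ident C E"
    "\<sigma> \<cdot>\<^bsub>C\<^esub> pair (Ident C E) (\<zeta> \<cdot>\<^bsub>C\<^esub> q) = Ident C E"
    "\<sigma> \<cdot>\<^bsub>C\<^esub> pair (\<pi> 2) (\<pi> 1) = \<sigma>"
    "\<sigma> \<cdot>\<^bsub>C\<^esub> pair (\<sigma> \<cdot>\<^bsub>C\<^esub> pair (\<rho> 1) (\<rho> 2)) (\<rho> 3) = \<sigma> \<cdot>\<^bsub>C\<^esub> pair (\<rho> 1) (\<sigma> \<cdot>\<^bsub>C\<^esub> pair (\<rho> 2) (\<rho> 3))"
    using B unfolding additive_bundle_def Let_def defs pair_def by auto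
  have q: "in_hom C q E M" using ab(1) by (simp add: in_hom_def E_def M_def)
  have q': "fmor F q \<in> Arr D" "Dom D (fmor F q) = fobj F E" "Cod D (fmor F q) = fobj F M"
    using functor_hom[OF F q] by (auto simp: in_hom_def)
  have obj: "E \<in> Obj C" "M \<in> Obj C" using C.in_hom_Obj q by blast+
  have pb2: "nfold_pullback C 2 q Q \<pi>" using ab(2)[of 2] by (simp add: defs)
  have pb2': "nfold_pullback D 2 (fmor F q) (fobj F Q) (\<lambda>k. fmor F (\<pi> k))"
    using pb'[of 2] by (simp add: defs)
  have \<pi>: "in_hom C (\<pi> 1) Q E" "in_hom C (\<pi> 2) Q E" "q \<cdot>\<^bsub>C\<^esub> \<pi> 2 = q \<cdot>\<^bsub>C\<^esub> \<pi> 1"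
    using nfold_pullback_proj[OF pb2, of 1] nfold_pullback_proj[OF pb2, of 2] by (auto simp: E_def)
  have "nfold_pullback C 3 q (bpow B 3) \<rho>" using ab(2)[of 3] by (simp add: defs)
  note \<rho>' = nfold_pullback_proj[OF this]
  define Q3 where "Q3 = bpow B 3"
  have \<rho>: "in_hom C (\<rho> 1) Q3 E" "in_hom C (\<rho> 2) Q3 E" "in_hom C (\<rho> 3) Q3 E"
    "q \<cdot>\<^bsub>C\<^esub> \<rho> 2 = q \<cdot>\<^bsub>C\<^esub> \<rho> 1" "q \<cdot>\<^bsub>C\<^esub> \<rho> 3 = q \<cdot>\<^bsub>C\<^esub> \<rho> 1"
    using \<rho>'[of 1] \<rho>'[of 2] \<rho>'[of 3] by (auto simp: E_def Q3_def)
  \<comment> \<open>The base part of a sum is recorded next to its image under \<open>F\<close>,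
    because associativity nests a sum inside a pairing, and that outer pairing makes sense only if
    the sum lies over the same base arrow as its partner.\<close>
  have pair: "in_hom C (pair f g) Z Q" "\<pi> 1 \<cdot>\<^bsub>C\<^esub> pair f g = f" "in_hom C (\<sigma> \<cdot>\<^bsub>C\<^esub> pair f g) Z E"
    "q \<cdot>\<^bsub>C\<^esub> (\<sigma> \<cdot>\<^bsub>C\<^esub> pair f g) = q \<cdot>\<^bsub>C\<^esub> f"
    "fmor F (\<sigma> \<cdot>\<^bsub>C\<^esub> pair f g) = fmor F \<sigma> \<cdot>\<^bsub>D\<^esub> pair' (fmor F f) (fmor F g)"
    if "in_hom C f Z E" "in_hom C g Z E" "q \<cdot>\<^bsub>C\<^esub> f = q \<cdot>\<^bsub>C\<^esub> g" for f g Z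
  proof -
    note p = pb_pair[OF pb2 that[unfolded E_def]]
    show hom: "in_hom C (pair f g) Z Q" and p1: "\<pi> 1 \<cdot>\<^bsub>C\<^esub> pair f g = f"
      using p by (simp_all add: pair_def)
    show "in_hom C (\<sigma> \<cdot>\<^bsub>C\<^esub> pair f g) Z E"
      using C.comp_hom[OF hom ab(5)] .
    show "q \<cdot>\<^bsub>C\<^esub> (\<sigma> \<cdot>\<^bsub>C\<^esub> pair f g) = q \<cdot>\<^bsub>C\<^esub> f"
      using C.comp_assoc[OF hom ab(5) q] C.comp_assoc[OF hom \<pi>(1) q] ab(6) p1 by simp
    have "fmor F (pair f g) = pair' (fmor F f) (fmor F g)"
      using C.functor_pb_pair[OF F pb2 pb2' that[unfolded E_def]]
      by (simp add: pair_def pair'_def)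
    then show "fmor F (\<sigma> \<cdot>\<^bsub>C\<^esub> pair f g) = fmor F \<sigma> \<cdot>\<^bsub>D\<^esub> pair' (fmor F f) (fmor F g)"
      using functor_Comp[OF F hom ab(5)] by simp
  qed
  have idE: "in_hom C (Ident C E) E E" by (rule C.ident_hom) (rule obj)
  have \<zeta>q: "in_hom C (\<zeta> \<cdot>\<^bsub>C\<^esub> q) E E" using C.comp_hom q ab(3) by blast
  have "q \<cdot>\<^bsub>C\<^esub> (\<zeta> \<cdot>\<^bsub>C\<^esub> q) = (q \<cdot>\<^bsub>C\<^esub> \<zeta>) \<cdot>\<^bsub>C\<^esub> q" by (rule C.comp_assoc[OF q ab(3) q, symmetric])
  then have q\<zeta>q: "q \<cdot>\<^bsub>C\<^esub> (\<zeta> \<cdot>\<^bsub>C\<^esub> q) = q \<cdot>\<^bsub>C\<^esub> Ident C E"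
    using ab(4) C.ident_left[OF q] C.ident_right[OF q] by simp
  let ?F = "fmor F"
  have 1: "?F \<sigma> \<cdot>\<^bsub>D\<^esub> pair' (?F \<zeta> \<cdot>\<^bsub>D\<^esub> ?F q) (Ident D (fobj F E)) = Ident D (fobj F E)"
    using pair(5)[OF \<zeta>q idE q\<zeta>q] ab(7) functor_Ident[OF F obj(1)] functor_Comp[OF F q ab(3)] by simp
  have 2: "?F \<sigma> \<cdot>\<^bsub>D\<^esub> pair' (Ident D (fobj F E)) (?F \<zeta> \<cdot>\<^bsub>D\<^esub> ?F q) = Ident D (fobj F E)"
    using pair(5)[OF idE \<zeta>q q\<zeta>q[symmetric]] ab(8) functor_Ident[OF F obj(1)]
      functor_Comp[OF F q ab(3)] by simp
  have 3: "?F \<sigma> \<cdot>\<^bsub>D\<^esub> pair' (?F (\<pi> 2)) (?F (\<pi> 1)) = ?F \<sigma>"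
    using pair(5)[OF \<pi>(2,1)] \<pi>(3) ab(9) by simp
  have 4: "?F \<sigma> \<cdot>\<^bsub>D\<^esub> pair' (?F \<sigma> \<cdot>\<^bsub>D\<^esub> pair' (?F (\<rho> 1)) (?F (\<rho> 2))) (?F (\<rho> 3)) =
      ?F \<sigma> \<cdot>\<^bsub>D\<^esub> pair' (?F (\<rho> 1)) (?F \<sigma> \<cdot>\<^bsub>D\<^esub> pair' (?F (\<rho> 2)) (?F (\<rho> 3)))"
  proof -
    have 12: "q \<cdot>\<^bsub>C\<^esub> \<rho> 1 = q \<cdot>\<^bsub>C\<^esub> \<rho> 2" and 23: "q \<cdot>\<^bsub>C\<^esub> \<rho> 2 = q \<cdot>\<^bsub>C\<^esub> \<rho> 3" using \<rho> by auto
    note l = pair[OF \<rho>(1,2) 12] and r = pair[OF \<rho>(2,3) 23]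
    have "q \<cdot>\<^bsub>C\<^esub> (\<sigma> \<cdot>\<^bsub>C\<^esub> pair (\<rho> 1) (\<rho> 2)) = q \<cdot>\<^bsub>C\<^esub> \<rho> 3" using l(4) \<rho> by simp
    note l' = pair(5)[OF l(3) \<rho>(3) this]
    have "q \<cdot>\<^bsub>C\<^esub> \<rho> 1 = q \<cdot>\<^bsub>C\<^esub> (\<sigma> \<cdot>\<^bsub>C\<^esub> pair (\<rho> 2) (\<rho> 3))" using r(4) \<rho> by simp
    note r' = pair(5)[OF \<rho>(1) r(3) this]
    show ?thesis using l' r' unfolding l(5) r(5) ab(10) by (rule trans[OF sym])
  qed
  have sel: "bproj (map_bundle F B) = ?F q" "bpow (map_bundle F B) n = fobj F (bpow B n)"
    "bpr (map_bundle F B) n = (\<lambda>k. ?F (bpr B n k))"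
    "bzero (map_bundle F B) = ?F \<zeta>" "bsum (map_bundle F B) = ?F \<sigma>" for n
    by (simp_all add: map_bundle_def defs)
  note folds = q_def[symmetric] Q_def[symmetric] \<pi>_def[symmetric] \<rho>_def[symmetric] q'(2,3)
  show ?thesis
    unfolding additive_bundle_def Let_def sel folds
  proof (intro conjI allI impI)
    show "nfold_pullback D n (?F q) (fobj F (bpow B n)) (\<lambda>k. ?F (bpr B n k))" if "1 \<le> n" for n
      using pb' that by (simp add: q_def)
    show "in_hom D (?F \<zeta>) (fobj F M) (fobj F E)" "in_hom D (?F \<sigma>) (fobj F Q) (fobj F E)"
      using functor_hom[OF F ab(3)] functor_hom[OF F ab(5)] by auto
    show "?F q \<cdot>\<^bsub>D\<^esub> ?F \<zeta> = Ident D (fobj F M)"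
      using functor_Comp[OF F ab(3) q] ab(4) functor_Ident[OF F obj(2)] by simp
    show "?F q \<cdot>\<^bsub>D\<^esub> ?F \<sigma> = ?F q \<cdot>\<^bsub>D\<^esub> ?F (\<pi> 1)"
      using functor_Comp[OF F ab(5) q] functor_Comp[OF F \<pi>(1) q] ab(6) by simp
  qed (fact q'(1) 1[unfolded pair'_def] 2[unfolded pair'_def] 3[unfolded pair'_def]
      4[unfolded pair'_def])+
qed

section \<open>Strict tangent morphisms\<close>

context tangent_structure begin

lemma category: "category C"
  using functor_categories[OF functor_T] by simp

lemma comp_T_T: "X \<in> Obj C \<Longrightarrow> fobj (comp_functor C T T) X = fobj T (fobj T X)"
  by (simp add: comp_functor_def)

text \<open>The typing of \<open>tans\<close> is read off the additive bundle, since in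
  \<open>nat_s\<close> its source is hidden behind \<open>tanT2\<close>.\<close>

lemma structure_hom:
  assumes "X \<in> Obj C"
  shows "in_hom C (tanp \<X> X) (fobj T X) X" "in_hom C (tanz \<X> X) X (fobj T X)"
    "in_hom C (tans \<X> X) (tanN \<X> 2 X) (fobj T X)"
    "in_hom C (tanl \<X> X) (fobj T X) (fobj T (fobj T X))"
    "in_hom C (tanc \<X> X) (fobj T (fobj T X)) (fobj T (fobj T X))"
  using nat_trans_hom[OF nat_p assms] nat_trans_hom[OF nat_z assms] nat_trans_hom[OF nat_s assms]
    nat_trans_hom[OF nat_l assms] nat_trans_hom[OF nat_c assms] additive_p[OF assms] assms
  by (simp_all add: id_functor_def comp_T_T additive_bundle_def tan_bundle_def in_hom_def Let_def)

lemma pullback2: "X \<in> Obj C \<Longrightarrow> nfold_pullback C 2 (tanp \<X> X) (tanN \<X> 2 X) (tanpr \<X> 2 X)"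
  using powers[of 2 X 0] by simp

lemma projection_hom:
  assumes "X \<in> Obj C"
  shows "in_hom C (tanpr \<X> 2 X 1) (tanN \<X> 2 X) (fobj T X)"
    "in_hom C (tanpr \<X> 2 X 2) (tanN \<X> 2 X) (fobj T X)"
    "tanp \<X> X \<cdot> tanpr \<X> 2 X 1 = tanp \<X> X \<cdot> tanpr \<X> 2 X 2"
  using nfold_pullback_proj[OF pullback2[OF assms], of 1] structure_hom(1)[OF assms]
    nfold_pullback_proj[OF pullback2[OF assms], of 2] by (auto simp: in_hom_def)

end

lemma nat_trans_ident:
  assumes K: "is_functor C D K"
  shows "nat_trans C D K K (\<lambda>X\<in>Obj C. Ident D (fobj K X))"
proof -
  interpret C: category C using functor_categories[OF K] by simp
  interpret D: category D using functor_categories[OF K] by simp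
  show ?thesis
  proof (rule nat_transI[OF K K])
    fix f X Y assume f: "in_hom C f X Y"
    show "(\<lambda>X\<in>Obj C. Ident D (fobj K X)) Y \<cdot>\<^bsub>D\<^esub> fmor K f =
        fmor K f \<cdot>\<^bsub>D\<^esub> (\<lambda>X\<in>Obj C. Ident D (fobj K X)) X"
      using C.in_hom_Obj[OF f] D.ident_left[OF functor_hom[OF K f]]
        D.ident_right[OF functor_hom[OF K f]] by simp
  qed (use D.ident_hom functor_Obj[OF K] in auto)
qed

text \<open>With identities for \<open>\<alpha>\<close> the lax axioms lose all their
  \<open>\<alpha>\<close>-factors. Only the sum axiom keeps a pairing: it is the comparison between
  the image under \<open>F\<close> of the chosen power over \<open>X\<close> and the chosen power
  over \<open>fobj F X\<close>, which may be different objects.\<close>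

lemma strict_tangent_morphism_iff:
  assumes "tangent_category \<X>" and "tangent_category \<X>'"
  shows "strict_tangent_morphism \<X> \<X>' F \<alpha> \<longleftrightarrow>
    is_functor (ucat \<X>) (ucat \<X>') F \<and>
    comp_functor (ucat \<X>) F (tanT \<X>) = comp_functor (ucat \<X>) (tanT \<X>') F \<and>
    \<alpha> = (\<lambda>X\<in>Obj (ucat \<X>). Ident (ucat \<X>') (fobj F (fobj (tanT \<X>) X))) \<and>
    (\<forall>X\<in>Obj (ucat \<X>).
      fmor F (tanp \<X> X) = tanp \<X>' (fobj F X) \<and>
      fmor F (tanz \<X> X) = tanz \<X>' (fobj F X) \<and>
      fmor F (tans \<X> X) = tans \<X>' (fobj F X) \<cdot>\<^bsub>ucat \<X>'\<^esub>
        tan_pair \<X>' (fobj F X) (fmor F (tanpr \<X> 2 X 1)) (fmor F (tanpr \<X> 2 X 2)) \<and>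
      fmor F (tanl \<X> X) = tanl \<X>' (fobj F X) \<and>
      fmor F (tanc \<X> X) = tanc \<X>' (fobj F X))"
    (is "_ \<longleftrightarrow> ?F \<and> ?comm \<and> ?\<alpha> \<and> ?eqs")
proof -
  define C T C' T' where "C = ucat \<X>" and "T = tanT \<X>" and "C' = ucat \<X>'" and "T' = tanT \<X>'"
  note [symmetric, simp] = C_def T_def C'_def T'_def
  interpret X: tangent_structure \<X> C T
    using assms(1) by (simp add: tangent_category_def)
  interpret X': tangent_structure \<X>' C' T'
    using assms(2) by (simp add: tangent_category_def)
  interpret C: category C by (rule X.category)
  interpret C': category C' by (rule X'.category)
  \<comment> \<open>A natural transformation is extensional here, so its components on objects
    determine it as a function.\<close>
  have \<alpha>_iff: "?\<alpha> \<longleftrightarrow> (\<forall>X\<in>Obj C. \<alpha> X = Ident C' (fobj F (fobj T X)))"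
    if "\<alpha> \<in> extensional (Obj C)"
    using that by (auto simp: extensional_def fun_eq_iff)
  have main: "lax_tangent_morphism \<X> \<X>' F \<alpha> \<longleftrightarrow> ?eqs" if F: ?F and comm: ?comm and \<alpha>: ?\<alpha>
  proof -
    have F: "is_functor C C' F" using F by simp
    have comm: "comp_functor C F T = comp_functor C T' F" using comm by simp
    have FT: "fobj F (fobj T X) = fobj T' (fobj F X)" if "X \<in> Obj C" for X
      using that arg_cong[OF comm, of "\<lambda>K. fobj K X"] by (simp add: comp_functor_def)
    \<comment> \<open>In this form \<open>\<alpha>\<close> is the identity transformation of
      \<open>comp_functor C F T\<close>; \<open>comm\<close> accounts for the target functor being
      written the other way round.\<close>
    have "\<alpha> = (\<lambda>X\<in>Obj C. Ident C' (fobj (comp_functor C F T) X))"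
      using \<alpha> by (simp add: comp_functor_def cong: restrict_cong)
    with nat_trans_ident[OF is_functor_comp[OF X.functor_T F]]
    have nat: "nat_trans C C' (comp_functor C F T) (comp_functor C T' F) \<alpha>"
      using comm by simp
    have eqs: "(tanp \<X>' (fobj F X) \<cdot>\<^bsub>C'\<^esub> \<alpha> X = fmor F (tanp \<X> X) \<and>
        \<alpha> X \<cdot>\<^bsub>C'\<^esub> fmor F (tanz \<X> X) = tanz \<X>' (fobj F X) \<and>
        \<alpha> X \<cdot>\<^bsub>C'\<^esub> fmor F (tans \<X> X) = tans \<X>' (fobj F X) \<cdot>\<^bsub>C'\<^esub>
          tan_pair \<X>' (fobj F X) (\<alpha> X \<cdot>\<^bsub>C'\<^esub> fmor F (tanpr \<X> 2 X 1))
            (\<alpha> X \<cdot>\<^bsub>C'\<^esub> fmor F (tanpr \<X> 2 X 2)) \<and>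
        tanl \<X>' (fobj F X) \<cdot>\<^bsub>C'\<^esub> \<alpha> X =
          fmor T' (\<alpha> X) \<cdot>\<^bsub>C'\<^esub> \<alpha> (fobj T X) \<cdot>\<^bsub>C'\<^esub> fmor F (tanl \<X> X) \<and>
        tanc \<X>' (fobj F X) \<cdot>\<^bsub>C'\<^esub> fmor T' (\<alpha> X) \<cdot>\<^bsub>C'\<^esub> \<alpha> (fobj T X) =
          fmor T' (\<alpha> X) \<cdot>\<^bsub>C'\<^esub> \<alpha> (fobj T X) \<cdot>\<^bsub>C'\<^esub> fmor F (tanc \<X> X)) \<longleftrightarrow>
       (fmor F (tanp \<X> X) = tanp \<X>' (fobj F X) \<and>
        fmor F (tanz \<X> X) = tanz \<X>' (fobj F X) \<and>
        fmor F (tans \<X> X) = tans \<X>' (fobj F X) \<cdot>\<^bsub>C'\<^esub>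
          tan_pair \<X>' (fobj F X) (fmor F (tanpr \<X> 2 X 1)) (fmor F (tanpr \<X> 2 X 2)) \<and>
        fmor F (tanl \<X> X) = tanl \<X>' (fobj F X) \<and>
        fmor F (tanc \<X> X) = tanc \<X>' (fobj F X))" if X: "X \<in> Obj C" for X
    proof -
      note obj = functor_Obj[OF X.functor_T X] functor_Obj[OF F X]
      have TTX: "fobj F (fobj T (fobj T X)) = fobj T' (fobj T' (fobj F X))"
        using FT[OF X] FT[OF obj(1)] by simp
      have \<alpha>X: "\<alpha> X = Ident C' (fobj T' (fobj F X))"
        using \<alpha> X FT[OF X] by simp
      have \<alpha>TX: "\<alpha> (fobj T X) = Ident C' (fobj T' (fobj T' (fobj F X)))"
        using \<alpha> obj(1) TTX by simp
      note T'\<alpha>X = functor_Ident[OF X'.functor_T functor_Obj[OF X'.functor_T obj(2)]]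
      note hom = X.structure_hom[OF X, THEN functor_hom[OF F], unfolded FT[OF X] TTX]
      note pr = X.projection_hom(1,2)[OF X, THEN functor_hom[OF F], unfolded FT[OF X]]
      note hom' = X'.structure_hom[OF obj(2)]
      \<comment> \<open>Unit laws for every composite that appears once the components of
        \<open>\<alpha>\<close> and the image of one under \<open>T'\<close> are identities. The
        last rule treats the two adjacent identities in the axioms for lift and flip.\<close>
      note absorb = C'.ident_left[OF hom(2)] C'.ident_left[OF hom(3)] C'.ident_left[OF hom(4)]
        C'.ident_left[OF hom(5)] C'.ident_right[OF hom'(1)] C'.ident_right[OF hom'(4)]
        C'.ident_right[OF hom'(5)] pr[THEN C'.ident_left]
        C'.ident_left[OF C'.ident_hom[OF functor_Obj[OF X'.functor_T functor_Obj[OF X'.functor_T obj(2)]]]]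
      show ?thesis
        unfolding \<alpha>TX \<alpha>X T'\<alpha>X absorb by (auto simp del: One_nat_def)
    qed
    show ?thesis
      using F nat eqs by (simp add: lax_tangent_morphism_def Let_def cong: ball_cong)
  qed
  have "strict_tangent_morphism \<X> \<X>' F \<alpha> \<longleftrightarrow>
    lax_tangent_morphism \<X> \<X>' F \<alpha> \<and> ?F \<and> ?comm \<and> ?\<alpha>"
    using \<alpha>_iff
    by (auto simp: strict_tangent_morphism_def lax_tangent_morphism_def Let_def nat_trans_def)
  with main show ?thesis by blast
qed

lemma strict_tangent_morphism_unique:
  "\<lbrakk>tangent_category \<X>; tangent_category \<X>'; strict_tangent_morphism \<X> \<X>' F \<alpha>;
    strict_tangent_morphism \<X> \<X>' F \<beta>\<rbrakk> \<Longrightarrow> \<alpha> = \<beta>"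
  by (simp add: strict_tangent_morphism_iff)

lemma strict_tangent_morphism_id:
  assumes \<X>: "tangent_category \<X>"
  shows "strict_tangent_morphism \<X> \<X> (id_functor (ucat \<X>))
    (\<lambda>X\<in>Obj (ucat \<X>). Ident (ucat \<X>) (fobj (tanT \<X>) X))"
proof -
  define C T where "C = ucat \<X>" and "T = tanT \<X>"
  note [symmetric, simp] = C_def T_def
  interpret tangent_structure \<X> C T
    using assms(1) by (simp add: tangent_category_def)
  interpret category C by (rule category)
  have sel: "fmor (id_functor C) f = f" if "in_hom C f X Y" for f X Y
    using that by (simp add: id_functor_def in_hom_def)
  have sel': "fobj (id_functor C) X = X" if "X \<in> Obj C" for X
    using that by (simp add: id_functor_def)
  \<comment> \<open>For the identity functor the comparison map of the sum axiom pairs the two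
    projections with each other, which gives an identity.\<close>
  have pair: "tan_pair \<X> X (tanpr \<X> 2 X 1) (tanpr \<X> 2 X 2) = Ident C (tanN \<X> 2 X)"
    if X: "X \<in> Obj C" for X
    unfolding tan_pair_def C_def[symmetric]
    using in_hom_Obj[OF projection_hom(1)[OF X]]
    by (intro pb_pair_eqI[OF pullback2[OF X] ident_hom] ident_right[OF projection_hom(1)[OF X]]
        ident_right[OF projection_hom(2)[OF X]]) simp
  show ?thesis
    unfolding strict_tangent_morphism_iff[OF \<X> \<X>] C_def[symmetric] T_def[symmetric]
  proof (intro conjI ballI)
    fix X assume X: "X \<in> Obj C"
    note hom = structure_hom[OF X] and pr = projection_hom[OF X]
    show "fmor (id_functor C) (tanp \<X> X) = tanp \<X> (fobj (id_functor C) X)"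
      "fmor (id_functor C) (tanz \<X> X) = tanz \<X> (fobj (id_functor C) X)"
      "fmor (id_functor C) (tanl \<X> X) = tanl \<X> (fobj (id_functor C) X)"
      "fmor (id_functor C) (tanc \<X> X) = tanc \<X> (fobj (id_functor C) X)"
      using sel[OF hom(1)] sel[OF hom(2)] sel[OF hom(4)] sel[OF hom(5)] X by (simp_all add: sel')
    show "fmor (id_functor C) (tans \<X> X) = tans \<X> (fobj (id_functor C) X) \<cdot>\<^bsub>C\<^esub>
        tan_pair \<X> (fobj (id_functor C) X)
          (fmor (id_functor C) (tanpr \<X> 2 X 1)) (fmor (id_functor C) (tanpr \<X> 2 X 2))"
      unfolding sel'[OF X] sel[OF pr(1)] sel[OF pr(2)] sel[OF hom(3)] pair[OF X]
      by (rule ident_right[OF hom(3), symmetric])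
  qed (auto simp: is_functor_id[OF category] comp_functor_id_left[OF functor_T] sel'
      functor_Obj[OF functor_T] comp_functor_id_right[OF functor_T] cong: restrict_cong)
qed

text \<open>Only the sum axiom needs work. The comparison map of the composite is that of
  \<open>G\<close> at \<open>fobj F X\<close> after the image under \<open>G\<close> of that of
  \<open>F\<close>: precomposing the outer pairing distributes over its components, and the
  projections of the inner pairing then give the doubly mapped projections.\<close>

lemma strict_tangent_morphism_comp:
  assumes \<X>: "tangent_category \<X>" and \<Y>: "tangent_category \<Y>" and \<Z>: "tangent_category \<Z>"
    and F: "strict_tangent_morphism \<X> \<Y> F \<alpha>" and G: "strict_tangent_morphism \<Y> \<Z> G \<beta>"
  shows "strict_tangent_morphism \<X> \<Z> (comp_functor (ucat \<X>) G F)
    (\<lambda>X\<in>Obj (ucat \<X>). \<beta> (fobj F X) \<cdot>\<^bsub>ucat \<Z>\<^esub> fmor G (\<alpha> X))"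
proof -
  define C D E S T U where "C = ucat \<X>" and "D = ucat \<Y>" and "E = ucat \<Z>"
    and "S = tanT \<X>" and "T = tanT \<Y>" and "U = tanT \<Z>"
  note folds = C_def[symmetric] D_def[symmetric] E_def[symmetric] S_def[symmetric] T_def[symmetric]
    U_def[symmetric]
  interpret X: tangent_structure \<X> C S using \<X> by (simp add: tangent_category_def folds)
  interpret Y: tangent_structure \<Y> D T using \<Y> by (simp add: tangent_category_def folds)
  interpret Z: tangent_structure \<Z> E U using \<Z> by (simp add: tangent_category_def folds)
  interpret C: category C by (rule X.category)
  interpret D: category D by (rule Y.category)
  interpret E: category E by (rule Z.category)
  note F' = F[unfolded strict_tangent_morphism_iff[OF \<X> \<Y>] folds]
  note G' = G[unfolded strict_tangent_morphism_iff[OF \<Y> \<Z>] folds]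
  have func: "is_functor C D F" "is_functor D E G"
    and comm: "comp_functor C F S = comp_functor C T F" "comp_functor D G T = comp_functor D U G"
    using F' G' by auto
  have sel: "fmor (comp_functor C G F) f = fmor G (fmor F f)" if "in_hom C f X Y" for f X Y
    using that by (simp add: comp_functor_def in_hom_def)
  have sel': "fobj (comp_functor C G F) X = fobj G (fobj F X)" if "X \<in> Obj C" for X
    using that by (simp add: comp_functor_def)
  have FS: "fobj F (fobj S X) = fobj T (fobj F X)" if "X \<in> Obj C" for X
    using that arg_cong[OF comm(1), of "\<lambda>K. fobj K X"] by (simp add: comp_functor_def)
  show ?thesis
    unfolding strict_tangent_morphism_iff[OF \<X> \<Z>] folds
  proof (intro conjI ballI)
    show "is_functor C E (comp_functor C G F)" by (rule is_functor_comp[OF func])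
    have "comp_functor C (comp_functor C G F) S = comp_functor C G (comp_functor C T F)"
      by (simp add: comp_functor_assoc[OF X.functor_T] comm)
    also have "\<dots> = comp_functor C (comp_functor D U G) F"
      by (simp add: comp_functor_assoc[OF func(1), symmetric] comm)
    finally show "comp_functor C (comp_functor C G F) S = comp_functor C U (comp_functor C G F)"
      by (simp add: comp_functor_assoc[OF func(1)])
    have "\<beta> (fobj F X) \<cdot>\<^bsub>E\<^esub> fmor G (\<alpha> X) = Ident E (fobj (comp_functor C G F) (fobj S X))"
      if X: "X \<in> Obj C" for X
    proof -
      have obj: "fobj F X \<in> Obj D" "fobj S X \<in> Obj C" "fobj F (fobj S X) \<in> Obj D"
        "fobj G (fobj F (fobj S X)) \<in> Obj E"
        using X func X.functor_T by (auto intro!: functor_Obj[of _ _ F] functor_Obj[of _ _ S] functor_Obj[of _ _ G])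
      show ?thesis
        using F' G' X obj FS[OF X] E.ident_left[OF E.ident_hom[OF obj(4)]]
          functor_Ident[OF func(2) obj(3)] by (simp add: sel')
    qed
    then show "(\<lambda>X\<in>Obj C. \<beta> (fobj F X) \<cdot>\<^bsub>E\<^esub> fmor G (\<alpha> X)) =
        (\<lambda>X\<in>Obj C. Ident E (fobj (comp_functor C G F) (fobj S X)))"
      by (simp cong: restrict_cong)
  next
    fix X assume X: "X \<in> Obj C"
    have FX: "fobj F X \<in> Obj D" and GFX: "fobj G (fobj F X) \<in> Obj E"
      using functor_Obj[OF func(1) X] functor_Obj[OF func(2) functor_Obj[OF func(1) X]] by auto
    note hom = X.structure_hom[OF X] and pr = X.projection_hom[OF X]
    note homY = Y.structure_hom[OF FX] and prY = Y.projection_hom[OF FX]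
    note homZ = Z.structure_hom[OF GFX] and prZ = Z.projection_hom[OF GFX]
    show "fmor (comp_functor C G F) (tanp \<X> X) = tanp \<Z> (fobj (comp_functor C G F) X)"
      "fmor (comp_functor C G F) (tanz \<X> X) = tanz \<Z> (fobj (comp_functor C G F) X)"
      "fmor (comp_functor C G F) (tanl \<X> X) = tanl \<Z> (fobj (comp_functor C G F) X)"
      "fmor (comp_functor C G F) (tanc \<X> X) = tanc \<Z> (fobj (comp_functor C G F) X)"
      using sel[OF hom(1)] sel[OF hom(2)] sel[OF hom(4)] sel[OF hom(5)] F' G' X FX
      by (simp_all add: sel')
    let ?P = "tan_pair \<Y> (fobj F X) (fmor F (tanpr \<X> 2 X 1)) (fmor F (tanpr \<X> 2 X 2))"
    have Fpr: "in_hom D (fmor F (tanpr \<X> 2 X 1)) (fobj F (tanN \<X> 2 X)) (fobj T (fobj F X))"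
      "in_hom D (fmor F (tanpr \<X> 2 X 2)) (fobj F (tanN \<X> 2 X)) (fobj T (fobj F X))"
      using pr(1,2)[THEN functor_hom[OF func(1)]] FS[OF X] by auto
    have domY: "Dom D (tanp \<Y> (fobj F X)) = fobj T (fobj F X)"
      using homY(1) by (simp add: in_hom_def)
    have domZ: "Dom E (tanp \<Z> (fobj G (fobj F X))) = fobj U (fobj G (fobj F X))"
      using homZ(1) by (simp add: in_hom_def)
    \<comment> \<open>Strictness on the projections turns the images of the two fibre projections
      into cones over the projection at the image object, so the pairings \<open>?P\<close> and
      \<open>?Q\<close> exist.\<close>
    have pF: "tanp \<Y> (fobj F X) = fmor F (tanp \<X> X)"
      using F' X by simp
    have pG: "tanp \<Z> (fobj G (fobj F X)) = fmor G (tanp \<Y> (fobj F X))"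
      using G' FX by simp
    have GT: "fobj G (fobj T (fobj F X)) = fobj U (fobj G (fobj F X))"
      using FX arg_cong[OF comm(2), of "\<lambda>K. fobj K (fobj F X)"] by (simp add: comp_functor_def)
    have eqF: "tanp \<Y> (fobj F X) \<cdot>\<^bsub>D\<^esub> fmor F (tanpr \<X> 2 X 1) =
        tanp \<Y> (fobj F X) \<cdot>\<^bsub>D\<^esub> fmor F (tanpr \<X> 2 X 2)"
      using functor_Comp[OF func(1) pr(1) hom(1)] functor_Comp[OF func(1) pr(2) hom(1)] pr(3)
      by (simp add: pF)
    have eqG: "tanp \<Z> (fobj G (fobj F X)) \<cdot>\<^bsub>E\<^esub> fmor G (tanpr \<Y> 2 (fobj F X) 1) =
        tanp \<Z> (fobj G (fobj F X)) \<cdot>\<^bsub>E\<^esub> fmor G (tanpr \<Y> 2 (fobj F X) 2)"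
      using functor_Comp[OF func(2) prY(1) homY(1)] functor_Comp[OF func(2) prY(2) homY(1)] prY(3)
      by (simp add: pG)
    note P = pb_pair[OF Y.pullback2[OF FX] Fpr[folded domY] eqF,
        folded tan_pair_def[where \<X>=\<Y>, unfolded folds]]
    have Gpr: "in_hom E (fmor G (tanpr \<Y> 2 (fobj F X) 1)) (fobj G (tanN \<Y> 2 (fobj F X)))
        (fobj U (fobj G (fobj F X)))"
      "in_hom E (fmor G (tanpr \<Y> 2 (fobj F X) 2)) (fobj G (tanN \<Y> 2 (fobj F X)))
        (fobj U (fobj G (fobj F X)))"
      using prY(1,2)[THEN functor_hom[OF func(2)]] GT by auto
    note GP = functor_hom[OF func(2) P(1)]
    let ?Q = "tan_pair \<Z> (fobj G (fobj F X)) (fmor G (tanpr \<Y> 2 (fobj F X) 1))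
      (fmor G (tanpr \<Y> 2 (fobj F X) 2))"
    note Q = pb_pair[OF Z.pullback2[OF GFX] Gpr[folded domZ] eqG,
        folded tan_pair_def[where \<X>=\<Z>, unfolded folds]]
    have QGP: "?Q \<cdot>\<^bsub>E\<^esub> fmor G ?P = tan_pair \<Z> (fobj G (fobj F X))
        (fmor G (fmor F (tanpr \<X> 2 X 1))) (fmor G (fmor F (tanpr \<X> 2 X 2)))"
      using E.pb_pair_comp[OF Z.pullback2[OF GFX] Gpr[folded domZ] eqG GP] P(2,3)
        functor_Comp[OF func(2) P(1) prY(1)] functor_Comp[OF func(2) P(1) prY(2)]
      by (simp add: tan_pair_def folds)
    have "fmor G (fmor F (tans \<X> X)) = fmor G (tans \<Y> (fobj F X) \<cdot>\<^bsub>D\<^esub> ?P)"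
      using F' X by simp
    also have "\<dots> = fmor G (tans \<Y> (fobj F X)) \<cdot>\<^bsub>E\<^esub> fmor G ?P"
      by (rule functor_Comp[OF func(2) P(1) homY(3)])
    also have "\<dots> = tans \<Z> (fobj G (fobj F X)) \<cdot>\<^bsub>E\<^esub> ?Q \<cdot>\<^bsub>E\<^esub> fmor G ?P"
      using G' FX by simp
    also have "\<dots> = tans \<Z> (fobj G (fobj F X)) \<cdot>\<^bsub>E\<^esub> (?Q \<cdot>\<^bsub>E\<^esub> fmor G ?P)"
      by (rule E.comp_assoc[OF GP Q(1) homZ(3)])
    finally show "fmor (comp_functor C G F) (tans \<X> X) =
        tans \<Z> (fobj (comp_functor C G F) X) \<cdot>\<^bsub>E\<^esub>
        tan_pair \<Z> (fobj (comp_functor C G F) X) (fmor (comp_functor C G F) (tanpr \<X> 2 X 1))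
          (fmor (comp_functor C G F) (tanpr \<X> 2 X 2))"
      unfolding sel'[OF X] sel[OF pr(1)] sel[OF pr(2)] sel[OF hom(3)] QGP .
  qed
qed

lemma category_TngCat_strict: "category TngCat_strict"
  unfolding TngCat_strict_def
proof (rule category_hom_category)
  fix \<X> \<Y> \<Z> \<W> :: "('o, 'm) tangent_cat" and f g h :: "('o, 'm) tangent_map"
  let ?H = "\<lambda>\<X> \<Y> :: ('o, 'm) tangent_cat. {(F, \<alpha>). strict_tangent_morphism (\<X> :: ('o, 'm) tangent_cat) \<Y> F \<alpha>}"
  let ?i = "\<lambda>\<X> :: ('o, 'm) tangent_cat. (id_functor (ucat \<X>), \<lambda>X\<in>Obj (ucat \<X>). Ident (ucat \<X>) (fobj (tanT \<X>) X))"
  let ?k = "\<lambda>\<X> \<Y> \<Z> :: ('o, 'm) tangent_cat. \<lambda>(G :: ('o, 'm, 'o, 'm) cfunctor, \<beta> :: 'o \<Rightarrow> 'm) (F, \<alpha>).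
    (comp_functor (ucat \<X>) G F, \<lambda>X\<in>Obj (ucat \<X>). \<beta> (fobj F X) \<cdot>\<^bsub>ucat \<Z>\<^esub> fmor G (\<alpha> X))"
  have fst_k: "fst (?k \<X> \<Y> \<Z> g f) = comp_functor (ucat \<X>) (fst g) (fst f)" for \<X> \<Y> \<Z> f g
    by (simp add: split_beta)
  have id: "?i \<X> \<in> ?H \<X> \<X>" if "tangent_category \<X>" for \<X>
    using strict_tangent_morphism_id[OF that] by simp
  have comp: "?k \<X> \<Y> \<Z> g f \<in> ?H \<X> \<Z>" if "tangent_category \<X>" "tangent_category \<Y>"
    "tangent_category \<Z>" "f \<in> ?H \<X> \<Y>" "g \<in> ?H \<Y> \<Z>" for \<X> \<Y> \<Z> f g
    using strict_tangent_morphism_comp[OF that(1-3)] that(4,5) by (auto simp: split_beta)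
  have ext: "f = g" if "tangent_category \<X>" "tangent_category \<Y>" "f \<in> ?H \<X> \<Y>" "g \<in> ?H \<X> \<Y>"
    "fst f = fst g" for f g \<X> \<Y>
    using strict_tangent_morphism_unique[OF that(1,2)] that(3-5) by (auto simp: prod_eq_iff)
  have func: "is_functor (ucat \<X>) (ucat \<Y>) (fst f)" if "f \<in> ?H \<X> \<Y>" for f \<X> \<Y>
    using that by (auto simp: strict_tangent_morphism_def lax_tangent_morphism_def Let_def)
  {
    assume \<X>: "\<X> \<in> Collect tangent_category"
    then show "?i \<X> \<in> ?H \<X> \<X>" using id[of \<X>] by simp
    assume \<Y>: "\<Y> \<in> Collect tangent_category" and f: "f \<in> ?H \<X> \<Y>"
    show "?k \<X> \<Y> \<Y> (?i \<Y>) f = f"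
      by (rule ext[OF _ _ comp f]) (use \<X> \<Y> f id[of \<Y>]
          comp_functor_id_left[OF func[OF f]] in \<open>auto simp: split_beta\<close>)
    show "?k \<X> \<X> \<Y> f (?i \<X>) = f"
      by (rule ext[OF _ _ comp f]) (use \<X> \<Y> f id[of \<X>]
          comp_functor_id_right[OF func[OF f]] in \<open>auto simp: split_beta\<close>)
    assume \<Z>: "\<Z> \<in> Collect tangent_category" and g: "g \<in> ?H \<Y> \<Z>"
    from \<X> \<Y> \<Z> f g show "?k \<X> \<Y> \<Z> g f \<in> ?H \<X> \<Z>" by (intro comp) auto
  }
  assume \<W>: "\<W> \<in> Collect tangent_category" and \<X>: "\<X> \<in> Collect tangent_category"
    and \<Y>: "\<Y> \<in> Collect tangent_category" and \<Z>: "\<Z> \<in> Collect tangent_category"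
    and f: "f \<in> ?H \<W> \<X>" and g: "g \<in> ?H \<X> \<Y>" and h: "h \<in> ?H \<Y> \<Z>"
  then have tan: "tangent_category \<W>" "tangent_category \<X>" "tangent_category \<Y>"
    "tangent_category \<Z>"
    by auto
  show "?k \<W> \<X> \<Z> (?k \<X> \<Y> \<Z> h g) f = ?k \<W> \<Y> \<Z> h (?k \<W> \<X> \<Y> g f)"
  proof (rule ext)
    show "?k \<W> \<X> \<Z> (?k \<X> \<Y> \<Z> h g) f \<in> ?H \<W> \<Z>"
      by (rule comp[OF tan(1,2,4) f comp[OF tan(2-4) g h]])
    show "?k \<W> \<Y> \<Z> h (?k \<W> \<X> \<Y> g f) \<in> ?H \<W> \<Z>"
      by (rule comp[OF tan(1,3,4) comp[OF tan(1-3) f g] h])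
    show "fst (?k \<W> \<X> \<Z> (?k \<X> \<Y> \<Z> h g) f) = fst (?k \<W> \<Y> \<Z> h (?k \<W> \<X> \<Y> g f))"
      unfolding fst_k by (rule comp_functor_assoc[OF func[OF f]])
  qed (fact tan)+
qed

section \<open>Sums, linear maps and operads\<close>

lemma (in abelian_monoid) finsum_swap:
  assumes "finite A" "finite B" "\<And>i j. i \<in> A \<Longrightarrow> j \<in> B \<Longrightarrow> f i j \<in> carrier G"
  shows "(\<Oplus>i\<in>A. \<Oplus>j\<in>B. f i j) = (\<Oplus>j\<in>B. \<Oplus>i\<in>A. f i j)"
  using assms(1,3)
proof (induction A)
  case empty
  then show ?case by (simp add: finsum_zero)
next
  case (insert a A)
  have "(\<Oplus>i\<in>insert a A. \<Oplus>j\<in>B. f i j) = (\<Oplus>j\<in>B. f a j) \<oplus> (\<Oplus>j\<in>B. \<Oplus>i\<in>A. f i j)"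
    using insert by (subst finsum_insert) (auto intro!: finsum_closed)
  also have "\<dots> = (\<Oplus>j\<in>B. f a j \<oplus> (\<Oplus>i\<in>A. f i j))"
    using insert by (intro finsum_addf[symmetric]) (auto intro!: finsum_closed)
  also have "\<dots> = (\<Oplus>j\<in>B. \<Oplus>i\<in>insert a A. f i j)"
    using insert by (intro finsum_cong') (auto intro!: finsum_closed)
  finally show ?case .
qed

lemma (in abelian_monoid) finsum_lessThan_add:
  assumes "\<And>k. k < m + n \<Longrightarrow> f k \<in> carrier G"
  shows "(\<Oplus>k\<in>{..<m + n}. f k) = (\<Oplus>k\<in>{..<m}. f k) \<oplus> (\<Oplus>k\<in>{..<n::nat}. f (m + k))"
proof -
  have *: "{..<m + n} = {..<m} \<union> (\<lambda>k. m + k) ` {..<n}"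
  proof (rule Set.set_eqI)
    show "x \<in> {..<m + n} \<longleftrightarrow> x \<in> {..<m} \<union> (\<lambda>k. m + k) ` {..<n}" for x
      by (cases "x < m") (auto intro: image_eqI[of _ _ "x - m"])
  qed
  have "(\<Oplus>k\<in>(\<lambda>k. m + k) ` {..<n}. f k) = (\<Oplus>k\<in>{..<n}. f (m + k))"
    using assms by (intro finsum_reindex) (auto simp: inj_on_def)
  then show ?thesis
    unfolding * using assms by (subst finsum_Un_disjoint) auto
qed

text \<open>Sorts the slots of an operadic composite by inner operation. The induction appends
  blocks on the right, because this leaves the offsets \<open>block_start\<close> of the earlier
  blocks unchanged.\<close>

lemma (in abelian_monoid) finsum_blocks:
  assumes "\<And>k. k < sum_list ks \<Longrightarrow> f k \<in> carrier G"
  shows "(\<Oplus>k\<in>{..<sum_list ks}. f k) =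
    (\<Oplus>i\<in>{..<length ks}. \<Oplus>j\<in>{..<ks ! i}. f (block_start ks i + j))"
  using assms
proof (induction ks rule: rev_induct)
  case Nil
  then show ?case by simp
next
  case (snoc k ks)
  have lt: "block_start ks i + j < sum_list ks" if "i < length ks" "j < ks ! i" for i j
  proof -
    have "sum_list ks = sum_list (take i ks) + (ks ! i + sum_list (drop (Suc i) ks))"
      using that(1) by (metis append_take_drop_id id_take_nth_drop sum_list.append sum_list.Cons)
    then show ?thesis using that(2) by (simp add: block_start_def)
  qed
  let ?g = "\<lambda>i. \<Oplus>j\<in>{..<(ks @ [k]) ! i}. f (block_start (ks @ [k]) i + j)"
  have f: "f m \<in> carrier G" if "m < sum_list ks + k" for m
    using that snoc.prems by simp
  have blocks: "?g i = (\<Oplus>j\<in>{..<ks ! i}. f (block_start ks i + j))" if "i < length ks" for i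
    using that by (simp add: nth_append block_start_def)
  have last: "?g (length ks) = (\<Oplus>j\<in>{..<k}. f (sum_list ks + j))"
    by (simp add: block_start_def)
  have g: "?g i \<in> carrier G" if "i < length ks" for i
    unfolding blocks[OF that] using lt[OF that] by (intro finsum_closed funcsetI f) (simp add: trans_less_add1)
  have last_closed: "?g (length ks) \<in> carrier G"
    unfolding last by (intro finsum_closed funcsetI f) simp
  have "(\<Oplus>i\<in>{..<length (ks @ [k])}. ?g i) = ?g (length ks) \<oplus> (\<Oplus>i\<in>{..<length ks}. ?g i)"
    unfolding length_append_singleton lessThan_Suc
    by (rule finsum_insert) (use g last_closed in auto)
  also have "(\<Oplus>i\<in>{..<length ks}. ?g i) = (\<Oplus>i\<in>{..<length ks}. \<Oplus>j\<in>{..<ks ! i}. f (block_start ks i + j))"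
    by (rule finsum_cong') (use g blocks in auto)
  also have "\<dots> = (\<Oplus>k\<in>{..<sum_list ks}. f k)"
    using snoc.IH f by simp
  also note last
  also have "(\<Oplus>j\<in>{..<k}. f (sum_list ks + j)) \<oplus> (\<Oplus>k\<in>{..<sum_list ks}. f k) =
      (\<Oplus>k\<in>{..<sum_list ks}. f k) \<oplus> (\<Oplus>j\<in>{..<k}. f (sum_list ks + j))"
    using snoc.prems by (intro a_comm finsum_closed) auto
  also have "\<dots> = (\<Oplus>k\<in>{..<sum_list (ks @ [k])}. f k)"
    using finsum_lessThan_add[of "sum_list ks" k f] snoc.prems by simp
  finally show ?case by simp
qed

lemma concat_block_nth:
  "\<lbrakk>i < length xss; j < length (xss ! i)\<rbrakk> \<Longrightarrow>
    block_start (map length xss) i + j < length (concat xss) \<and>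
    concat xss ! (block_start (map length xss) i + j) = xss ! i ! j"
proof (induction xss arbitrary: i)
  case (Cons xs xss)
  then show ?case by (cases i) (auto simp: block_start_def nth_append add.assoc)
qed simp

text \<open>Turns a substitution in one slot of a composite operation into a substitution in the
  argument list of a single inner operation.\<close>

lemma concat_block_update:
  "\<lbrakk>i < length xss; j < length (xss ! i)\<rbrakk> \<Longrightarrow>
    (concat xss)[block_start (map length xss) i + j := x] = concat (xss[i := (xss ! i)[j := x]])"
proof (induction xss arbitrary: i)
  case (Cons xs xss)
  then show ?case by (cases i) (auto simp: block_start_def list_update_append add.assoc)
qed simp

section \<open>Linear maps\<close>

lemma linear_map_closed: "linear_map R M N f \<Longrightarrow> x \<in> carrier M \<Longrightarrow> f x \<in> carrier N"
  by (auto simp: linear_map_def)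

lemma linear_map_add:
  "linear_map R M N f \<Longrightarrow> x \<in> carrier M \<Longrightarrow> y \<in> carrier M \<Longrightarrow> f (x \<oplus>\<^bsub>M\<^esub> y) = f x \<oplus>\<^bsub>N\<^esub> f y"
  by (simp add: linear_map_def)

lemma linear_map_smult:
  "linear_map R M N f \<Longrightarrow> r \<in> carrier R \<Longrightarrow> x \<in> carrier M \<Longrightarrow> f (r \<odot>\<^bsub>M\<^esub> x) = r \<odot>\<^bsub>N\<^esub> f x"
  by (simp add: linear_map_def)

lemma linear_mapI:
  "\<lbrakk>\<And>x. x \<in> carrier M \<Longrightarrow> f x \<in> carrier N;
    \<And>x y. x \<in> carrier M \<Longrightarrow> y \<in> carrier M \<Longrightarrow> f (x \<oplus>\<^bsub>M\<^esub> y) = f x \<oplus>\<^bsub>N\<^esub> f y;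
    \<And>r x. r \<in> carrier R \<Longrightarrow> x \<in> carrier M \<Longrightarrow> f (r \<odot>\<^bsub>M\<^esub> x) = r \<odot>\<^bsub>N\<^esub> f x\<rbrakk> \<Longrightarrow> linear_map R M N f"
  by (simp add: linear_map_def)

text \<open>Sums and scalar multiples stay in the carrier of a module, so values elsewhere are
  irrelevant. Formulas that hold on the carrier only are substituted under \<open>linear_map\<close>
  in this way.\<close>

lemma linear_map_cong:
  assumes "module R M" "\<And>x. x \<in> carrier M \<Longrightarrow> f x = g x"
  shows "linear_map R M N f \<longleftrightarrow> linear_map R M N g"
proof -
  interpret module R M by (rule assms(1))
  show ?thesis
    using assms(2) by (auto simp: linear_map_def Pi_def)
qed

lemma linear_map_id: "module R M \<Longrightarrow> linear_map R M M (\<lambda>x. x)"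
  by (simp add: linear_map_def)

lemma linear_map_compose:
  "\<lbrakk>linear_map R M N f; linear_map R N L g\<rbrakk> \<Longrightarrow> linear_map R M L (\<lambda>x. g (f x))"
  by (intro linear_mapI) (simp_all add: linear_map_closed linear_map_add linear_map_smult)

lemma linear_map_zero:
  assumes "module R M" "module R N" "linear_map R M N f"
  shows "f \<zero>\<^bsub>M\<^esub> = \<zero>\<^bsub>N\<^esub>"
proof -
  interpret M: module R M by (rule assms(1))
  interpret N: module R N by (rule assms(2))
  have "f \<zero>\<^bsub>M\<^esub> \<oplus>\<^bsub>N\<^esub> f \<zero>\<^bsub>M\<^esub> = f \<zero>\<^bsub>M\<^esub>"
    using linear_map_add[OF assms(3), of "\<zero>\<^bsub>M\<^esub>" "\<zero>\<^bsub>M\<^esub>"] by simp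
  then show ?thesis
    using linear_map_closed[OF assms(3), of "\<zero>\<^bsub>M\<^esub>"] by simp
qed

lemma linear_map_const_zero:
  assumes "module R N"
  shows "linear_map R M N (\<lambda>x. \<zero>\<^bsub>N\<^esub>)"
proof -
  interpret N: module R N by (rule assms)
  show ?thesis by (rule linear_mapI) simp_all
qed

lemma linear_map_plus:
  assumes "module R N" "linear_map R M N f" "linear_map R M N g"
  shows "linear_map R M N (\<lambda>x. f x \<oplus>\<^bsub>N\<^esub> g x)"
proof -
  interpret N: module R N by (rule assms(1))
  show ?thesis
    using assms(2,3)
    by (intro linear_mapI) (simp_all add: linear_map_closed linear_map_add linear_map_smult
      N.smult_r_distr N.M.add.m_ac)
qed

lemma linear_map_finsum:
  assumes "module R M" "module R N" "linear_map R M N f" "finite I" "\<And>i. i \<in> I \<Longrightarrow> g i \<in> carrier M"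
  shows "f (\<Oplus>\<^bsub>M\<^esub>i\<in>I. g i) = (\<Oplus>\<^bsub>N\<^esub>i\<in>I. f (g i))"
proof -
  interpret M: module R M by (rule assms(1))
  interpret N: module R N by (rule assms(2))
  show ?thesis
    using assms(4,5)
    by (induction I)
      (auto simp: linear_map_zero[OF assms(1-3)] linear_map_add[OF assms(3)]
        linear_map_closed[OF assms(3)] Pi_def)
qed

text \<open>Meant for \<open>act_deriv\<close>, a finite sum of evaluations of one operation in
  which every summand is linear in what varies.\<close>

lemma linear_map_sum:
  assumes "module R N" "finite I" "\<And>i. i \<in> I \<Longrightarrow> linear_map R M N (f i)"
  shows "linear_map R M N (\<lambda>x. \<Oplus>\<^bsub>N\<^esub>i\<in>I. f i x)"
proof -
  interpret N: module R N by (rule assms(1))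
  show ?thesis
  proof (rule linear_mapI)
    fix x assume x: "x \<in> carrier M"
    have fx: "f i x \<in> carrier N" if "i \<in> I" for i
      using linear_map_closed[OF assms(3)[OF that] x] .
    then show "(\<Oplus>\<^bsub>N\<^esub>i\<in>I. f i x) \<in> carrier N" by auto
    show "(\<Oplus>\<^bsub>N\<^esub>i\<in>I. f i (r \<odot>\<^bsub>M\<^esub> x)) = r \<odot>\<^bsub>N\<^esub> (\<Oplus>\<^bsub>N\<^esub>i\<in>I. f i x)" if r: "r \<in> carrier R" for r
      using fx r x assms(3)
      by (subst N.finsum_smult_ldistr) (auto simp: assms(2) linear_map_smult[OF assms(3)] intro!: N.M.finsum_cong')
    fix y assume y: "y \<in> carrier M"
    have fy: "f i y \<in> carrier N" if "i \<in> I" for i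
      using linear_map_closed[OF assms(3)[OF that] y] .
    show "(\<Oplus>\<^bsub>N\<^esub>i\<in>I. f i (x \<oplus>\<^bsub>M\<^esub> y)) = (\<Oplus>\<^bsub>N\<^esub>i\<in>I. f i x) \<oplus>\<^bsub>N\<^esub> (\<Oplus>\<^bsub>N\<^esub>i\<in>I. f i y)"
    proof -
      have "(\<Oplus>\<^bsub>N\<^esub>i\<in>I. f i (x \<oplus>\<^bsub>M\<^esub> y)) = (\<Oplus>\<^bsub>N\<^esub>i\<in>I. f i x \<oplus>\<^bsub>N\<^esub> f i y)"
        using fx fy x y by (intro N.M.finsum_cong') (auto simp: linear_map_add[OF assms(3)])
      also have "\<dots> = (\<Oplus>\<^bsub>N\<^esub>i\<in>I. f i x) \<oplus>\<^bsub>N\<^esub> (\<Oplus>\<^bsub>N\<^esub>i\<in>I. f i y)"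
        using fx fy by (intro N.M.finsum_addf) auto
      finally show ?thesis .
    qed
  qed
qed

section \<open>Operads and their morphisms\<close>

context symmetric_operad begin

lemma operad_module: "module R (omod P n)"
  using module by (simp add: normal_module_def)

lemma sym_closed: "\<sigma> permutes {..<n} \<Longrightarrow> \<mu> \<in> ops P n \<Longrightarrow> osym P n \<sigma> \<mu> \<in> ops P n"
  using linear_map_closed[OF sym_linear] by (simp add: ops_def)

lemma comp_closed:
  "\<mu> \<in> ops P (length ks) \<Longrightarrow> ops_list P ks \<nu>s \<Longrightarrow> ocomp P ks \<mu> \<nu>s \<in> ops P (sum_list ks)"
  using linear_map_closed[OF comp_linear_outer] by (simp add: ops_def)

end

lemma
  assumes "\<phi> \<in> operad_hom R P Q"
  shows operad_hom_extensional: "\<phi> n \<in> extensional (ops P n)"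
    and operad_hom_linear: "linear_map R (omod P n) (omod Q n) (\<phi> n)"
    and operad_hom_sym:
      "\<mu> \<in> ops P n \<Longrightarrow> \<sigma> permutes {..<n} \<Longrightarrow> \<phi> n (osym P n \<sigma> \<mu>) = osym Q n \<sigma> (\<phi> n \<mu>)"
    and operad_hom_unit: "\<phi> 1 (ounit P) = ounit Q"
    and operad_hom_ocomp: "\<mu> \<in> ops P (length ks) \<Longrightarrow> ops_list P ks \<nu>s \<Longrightarrow>
      \<phi> (sum_list ks) (ocomp P ks \<mu> \<nu>s) = ocomp Q ks (\<phi> (length ks) \<mu>) (map2 \<phi> ks \<nu>s)"
  using assms by (simp_all add: operad_hom_def)

lemma operad_hom_closed: "\<phi> \<in> operad_hom R P Q \<Longrightarrow> \<mu> \<in> ops P n \<Longrightarrow> \<phi> n \<mu> \<in> ops Q n"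
  using linear_map_closed[OF operad_hom_linear] by (simp add: ops_def)

lemma operad_hom_ops_list:
  "\<phi> \<in> operad_hom R P Q \<Longrightarrow> ops_list P ks \<nu>s \<Longrightarrow> ops_list Q ks (map2 \<phi> ks \<nu>s)"
  by (auto simp: ops_list_def list_all2_conv_all_nth operad_hom_closed)

lemma operad_hom_id:
  assumes "symmetric_operad R P"
  shows "(\<lambda>n. \<lambda>\<mu>\<in>ops P n. \<mu>) \<in> operad_hom R P P"
proof -
  interpret symmetric_operad R P by (rule assms)
  let ?id = "\<lambda>n. \<lambda>\<mu>\<in>ops P n. \<mu>"
  have map: "map2 ?id ks \<nu>s = \<nu>s" if "ops_list P ks \<nu>s" for ks \<nu>s
    using that by (auto simp: ops_list_def list_all2_conv_all_nth intro!: nth_equalityI)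
  have lin: "linear_map R (omod P n) (omod P n) (?id n)" for n
    using linear_map_id[OF operad_module]
    by (subst linear_map_cong[OF operad_module]) (auto simp: ops_def)
  have id: "?id n \<mu> = \<mu>" if "\<mu> \<in> ops P n" for n \<mu>
    using that by simp
  show ?thesis
    unfolding operad_hom_def
    by (intro CollectI conjI allI ballI impI)
      (simp_all only: map lin id sym_closed unit comp_closed restrict_extensional)
qed

lemma operad_hom_comp:
  assumes "symmetric_operad R P" "symmetric_operad R Q" "\<phi> \<in> operad_hom R P Q" "\<psi> \<in> operad_hom R Q S"
  shows "(\<lambda>n. compose (ops P n) (\<psi> n) (\<phi> n)) \<in> operad_hom R P S"
proof -
  interpret P: symmetric_operad R P by (rule assms)
  interpret Q: symmetric_operad R Q by (rule assms)
  have comp: "compose (ops P n) (\<psi> n) (\<phi> n) \<mu> = \<psi> n (\<phi> n \<mu>)" if "\<mu> \<in> ops P n" for n \<mu>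
    using that by (simp add: compose_def)
  have map: "map2 (\<lambda>n. compose (ops P n) (\<psi> n) (\<phi> n)) ks \<nu>s = map2 \<psi> ks (map2 \<phi> ks \<nu>s)"
    if "ops_list P ks \<nu>s" for ks \<nu>s
    using that by (auto simp: ops_list_def list_all2_conv_all_nth comp intro!: nth_equalityI)
  have "linear_map R (omod P n) (omod S n) (\<lambda>\<mu>. \<psi> n (\<phi> n \<mu>))" for n
    by (rule linear_map_compose[OF assms(3,4)[THEN operad_hom_linear]])
  then have "linear_map R (omod P n) (omod S n) (compose (ops P n) (\<psi> n) (\<phi> n))" for n
    by (subst linear_map_cong[OF P.operad_module]) (auto simp: ops_def compose_def)
  moreover have "\<psi> n (\<phi> n (osym P n \<sigma> \<mu>)) = osym S n \<sigma> (\<psi> n (\<phi> n \<mu>))"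
    if "\<mu> \<in> ops P n" "\<sigma> permutes {..<n}" for n \<sigma> \<mu>
    using operad_hom_sym[OF assms(3) that]
      operad_hom_sym[OF assms(4) operad_hom_closed[OF assms(3) that(1)] that(2)] by simp
  moreover have "\<psi> (sum_list ks) (\<phi> (sum_list ks) (ocomp P ks \<mu> \<nu>s)) =
      ocomp S ks (\<psi> (length ks) (\<phi> (length ks) \<mu>)) (map2 \<psi> ks (map2 \<phi> ks \<nu>s))"
    if "\<mu> \<in> ops P (length ks)" "ops_list P ks \<nu>s" for ks \<mu> \<nu>s
    unfolding operad_hom_ocomp[OF assms(3) that]
    by (rule operad_hom_ocomp[OF assms(4) operad_hom_closed[OF assms(3) that(1)]
        operad_hom_ops_list[OF assms(3) that(2)]])
  moreover have "\<psi> 1 (\<phi> 1 (ounit P)) = ounit S"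
    unfolding operad_hom_unit[OF assms(3)] by (rule operad_hom_unit[OF assms(4)])
  ultimately show ?thesis
    unfolding operad_hom_def
    by (intro CollectI conjI allI ballI impI)
      (simp_all only: map comp P.sym_closed P.unit P.comp_closed compose_extensional)
qed

lemma category_Operad_cat:
  fixes R :: "('r, 'x) ring_scheme"
  shows "category (Operad_cat R :: (('r, 'p) operad, (('r, 'p) operad, nat \<Rightarrow> 'p \<Rightarrow> 'p) arrow) cat)"
  unfolding Operad_cat_def
proof (rule category_hom_category)
  fix P Q S :: "('r, 'p) operad" and \<phi> \<psi>
  assume P: "P \<in> {P. symmetric_operad R P}"
  then show "(\<lambda>n. \<lambda>\<mu>\<in>ops P n. \<mu>) \<in> operad_hom R P P" by (simp add: operad_hom_id)
  assume Q: "Q \<in> {P. symmetric_operad R P}" and \<phi>: "\<phi> \<in> operad_hom R P Q"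
  have "\<phi> n \<in> extensional (ops P n)" for n by (rule operad_hom_extensional[OF \<phi>])
  then show "(\<lambda>n. compose (ops P n) ((\<lambda>n. \<lambda>\<mu>\<in>ops Q n. \<mu>) n) (\<phi> n)) = \<phi>"
    "(\<lambda>n. compose (ops P n) (\<phi> n) ((\<lambda>n. \<lambda>\<mu>\<in>ops P n. \<mu>) n)) = \<phi>"
    by (auto simp: fun_eq_iff compose_def extensional_def operad_hom_closed[OF \<phi>])
  assume "S \<in> {P. symmetric_operad R P}" and \<psi>: "\<psi> \<in> operad_hom R Q S"
  show "(\<lambda>n. compose (ops P n) (\<psi> n) (\<phi> n)) \<in> operad_hom R P S"
    using P Q \<phi> \<psi> by (simp add: operad_hom_comp)
next
  fix P Q S U :: "('r, 'p) operad" and \<phi> \<psi> \<xi>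
  assume \<phi>: "\<phi> \<in> operad_hom R P Q"
  show "(\<lambda>n. compose (ops P n) ((\<lambda>n. compose (ops Q n) (\<xi> n) (\<psi> n)) n) (\<phi> n)) =
    (\<lambda>n. compose (ops P n) (\<xi> n) ((\<lambda>n. compose (ops P n) (\<psi> n) (\<phi> n)) n))"
    by (auto simp: fun_eq_iff compose_def operad_hom_closed[OF \<phi>])
qed

section \<open>Argument lists and morphisms of algebras\<close>

lemma args_nth: "as \<in> args A n \<Longrightarrow> i < n \<Longrightarrow> as ! i \<in> carrier A"
  by (auto simp: args_def)

lemma args_update: "as \<in> args A n \<Longrightarrow> a \<in> carrier A \<Longrightarrow> as[i := a] \<in> args A n"
  using set_update_subset_insert[of as i a] by (auto simp: args_def)

lemma args_length: "as \<in> args A n \<Longrightarrow> length as = n"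
  by (simp add: args_def)

lemma args_map: "as \<in> args A n \<Longrightarrow> (\<And>a. a \<in> carrier A \<Longrightarrow> h a \<in> carrier B) \<Longrightarrow> map h as \<in> args B n"
  by (auto simp: args_def)

lemma args_iff_nth: "as \<in> args A n \<longleftrightarrow> length as = n \<and> (\<forall>i<n. as ! i \<in> carrier A)"
  by (auto simp: args_def set_conv_nth)

lemma args_concat:
  "list_all2 (\<lambda>k as. as \<in> args A k) ks ass \<Longrightarrow> concat ass \<in> args A (sum_list ks) \<and> map length ass = ks"
  by (induction rule: list_all2_induct) (auto simp: args_def)

context operad_algebra begin

sublocale P: symmetric_operad R P by (rule operad)

sublocale A: module R A using module by (simp add: normal_module_def)

lemma act_closed: "\<mu> \<in> ops P n \<Longrightarrow> as \<in> args A n \<Longrightarrow> act A n \<mu> as \<in> carrier A"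
  using linear_map_closed[OF act_linear_op] by (simp add: ops_def)

end

lemma alg_hom_closed: "h \<in> alg_hom R P A B \<Longrightarrow> a \<in> carrier A \<Longrightarrow> h a \<in> carrier B"
  by (auto simp: alg_hom_def linear_map_def)

lemma alg_hom_linear: "h \<in> alg_hom R P A B \<Longrightarrow> linear_map R A B h"
  by (simp add: alg_hom_def)

lemma alg_hom_act:
  "h \<in> alg_hom R P A B \<Longrightarrow> \<mu> \<in> ops P n \<Longrightarrow> as \<in> args A n \<Longrightarrow> h (act A n \<mu> as) = act B n \<mu> (map h as)"
  by (simp add: alg_hom_def)

text \<open>Elements of \<open>alg_hom\<close> are undefined off the carrier. Restricting a plain
  function does not disturb the equations, because all entries of an argument list and the value of
  the operation lie in the carrier.\<close>

lemma restrict_alg_hom: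
  assumes "operad_algebra R P A" "linear_map R A B h"
    and "\<And>n \<mu> as. \<mu> \<in> ops P n \<Longrightarrow> as \<in> args A n \<Longrightarrow> h (act A n \<mu> as) = act B n \<mu> (map h as)"
  shows "restrict h (carrier A) \<in> alg_hom R P A B"
proof -
  interpret operad_algebra R P A by (rule assms)
  have "linear_map R A B (restrict h (carrier A))"
    using assms(2) by (subst linear_map_cong[OF A.module_axioms]) auto
  moreover have "restrict h (carrier A) (act A n \<mu> as) = act B n \<mu> (map (restrict h (carrier A)) as)"
    if "\<mu> \<in> ops P n" "as \<in> args A n" for n \<mu> as
  proof -
    have map: "map (restrict h (carrier A)) as = map h as"
      using that(2) by (auto simp: args_def)
    show ?thesis
      unfolding map using assms(3)[OF that] act_closed[OF that] by simp
  qed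
  ultimately show ?thesis
    unfolding alg_hom_def by blast
qed

lemma alg_hom_id: "operad_algebra R P A \<Longrightarrow> (\<lambda>a\<in>carrier A. a) \<in> alg_hom R P A A"
  by (rule restrict_alg_hom)
    (auto intro!: linear_map_id simp: operad_algebra_def normal_module_def)

lemma alg_hom_comp:
  assumes "operad_algebra R P A" "f \<in> alg_hom R P A B" "g \<in> alg_hom R P B D"
  shows "compose (carrier A) g f \<in> alg_hom R P A D"
  unfolding compose_def
proof (rule restrict_alg_hom[OF assms(1)])
  show "linear_map R A D (\<lambda>x. g (f x))"
    using assms(2,3)[THEN alg_hom_linear] by (rule linear_map_compose)
  show "g (f (act A n \<mu> as)) = act D n \<mu> (map (\<lambda>x. g (f x)) as)"
    if "\<mu> \<in> ops P n" "as \<in> args A n" for n \<mu> as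
    using that alg_hom_act[OF assms(2) that]
      alg_hom_act[OF assms(3) that(1) args_map[OF that(2) alg_hom_closed[OF assms(2)]]]
    by (simp add: comp_def)
qed

lemma category_Alg_cat:
  fixes R :: "('r, 'x) ring_scheme"
  shows "category (Alg_cat R P :: (('r, 'u, 'p) talg, ('r, 'u, 'p) talg_arrow) cat)"
  unfolding Alg_cat_def
proof (rule category_hom_category)
  fix A B D :: "('r, 'u, 'p) talg" and f g
  assume A: "A \<in> {A. operad_algebra R P A}"
  then show "(\<lambda>a\<in>carrier A. a) \<in> alg_hom R P A A" by (simp add: alg_hom_id)
  assume B: "B \<in> {A. operad_algebra R P A}" and f: "f \<in> alg_hom R P A B"
  have "f \<in> extensional (carrier A)" using f by (simp add: alg_hom_def)
  then show "compose (carrier A) (\<lambda>a\<in>carrier B. a) f = f" "compose (carrier A) f (\<lambda>a\<in>carrier A. a) = f"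
    by (auto simp: fun_eq_iff compose_def extensional_def alg_hom_closed[OF f])
  assume "D \<in> {A. operad_algebra R P A}" and g: "g \<in> alg_hom R P B D"
  show "compose (carrier A) g f \<in> alg_hom R P A D"
    using A f g by (simp add: alg_hom_comp)
next
  fix A B D E :: "('r, 'u, 'p) talg" and f g h
  assume f: "f \<in> alg_hom R P A B"
  show "compose (carrier A) (compose (carrier B) h g) f = compose (carrier A) h (compose (carrier A) g f)"
    by (auto simp: fun_eq_iff compose_def alg_hom_closed[OF f])
qed

section \<open>The derivation of an operation\<close>

text \<open>The differential of the multilinear map given by \<open>\<mu>\<close>, at the point
  \<open>as\<close> in the direction \<open>bs\<close>. Every entry of positive index of the action
  on a semidirect product has this form.\<close>

definition act_deriv :: "('r, 'a, 'p) alg \<Rightarrow> nat \<Rightarrow> 'p \<Rightarrow> 'a list \<Rightarrow> 'a list \<Rightarrow> 'a" where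
  "act_deriv A n \<mu> as bs = (\<Oplus>\<^bsub>A\<^esub>k\<in>{..<n}. act A n \<mu> (as[k := bs ! k]))"

lemma perm_args_nth:
  "\<sigma> permutes {..<length xs} \<Longrightarrow> i < length xs \<Longrightarrow> perm_args \<sigma> xs ! i = xs ! inv_into UNIV \<sigma> i"
  by (simp add: perm_args_def permute_list_nth permutes_inv)

lemma length_perm_args [simp]: "length (perm_args \<sigma> xs) = length xs"
  by (simp add: perm_args_def)

lemma perm_args_map:
  "\<sigma> permutes {..<length xs} \<Longrightarrow> perm_args \<sigma> (map f xs) = map f (perm_args \<sigma> xs)"
  by (simp add: perm_args_def permute_list_map permutes_inv)

lemma args_perm_args: "\<sigma> permutes {..<n} \<Longrightarrow> as \<in> args A n \<Longrightarrow> perm_args \<sigma> as \<in> args A n"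
  by (auto simp: args_def perm_args_def permutes_inv)

text \<open>Entry \<open>i\<close> of the permuted list is read from the position that
  \<open>\<sigma>\<close> sends to \<open>i\<close>; hence what is put into slot \<open>k\<close>
  reappears in slot \<open>\<sigma> k\<close>.\<close>

lemma perm_args_update:
  assumes \<sigma>: "\<sigma> permutes {..<length xs}" and k: "k < length xs"
  shows "perm_args \<sigma> (xs[k := x]) = (perm_args \<sigma> xs)[\<sigma> k := x]"
proof (rule nth_equalityI)
  fix i assume "i < length (perm_args \<sigma> (xs[k := x]))"
  then have i: "i < length xs" by simp
  have lt: "inv_into UNIV \<sigma> i < length xs"
    using permutes_in_image[OF permutes_inv[OF \<sigma>], of i] i by simp
  have "inv_into UNIV \<sigma> i = k \<longleftrightarrow> i = \<sigma> k"
    using permutes_inv_eq[OF \<sigma>, of i k] by auto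
  then show "perm_args \<sigma> (xs[k := x]) ! i = (perm_args \<sigma> xs)[\<sigma> k := x] ! i"
    using \<sigma> i lt by (auto simp: perm_args_nth nth_list_update)
qed simp

context operad_algebra begin

lemma act_update_closed:
  "\<lbrakk>\<mu> \<in> ops P n; as \<in> args A n; a \<in> carrier A\<rbrakk> \<Longrightarrow> act A n \<mu> (as[k := a]) \<in> carrier A"
  by (simp add: act_closed args_update)

text \<open>Linearity in slot \<open>i\<close>, once \<open>as\<close> is written as its own update
  at \<open>i\<close> by the zero found there.\<close>

lemma act_zero: "\<lbrakk>\<mu> \<in> ops P n; as \<in> args A n; i < n; as ! i = \<zero>\<^bsub>A\<^esub>\<rbrakk> \<Longrightarrow> act A n \<mu> as = \<zero>\<^bsub>A\<^esub>"
  using linear_map_zero[OF A.module_axioms A.module_axioms act_linear_arg, of \<mu> n as i]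
  by (metis list_update_id)

lemma act_deriv_closed:
  "\<lbrakk>\<mu> \<in> ops P n; as \<in> args A n; bs \<in> args A n\<rbrakk> \<Longrightarrow> act_deriv A n \<mu> as bs \<in> carrier A"
  unfolding act_deriv_def by (intro A.M.finsum_closed funcsetI act_update_closed) (auto simp: args_nth)

lemma act_deriv_linear_op:
  "\<lbrakk>as \<in> args A n; bs \<in> args A n\<rbrakk> \<Longrightarrow> linear_map R (omod P n) A (\<lambda>\<mu>. act_deriv A n \<mu> as bs)"
  unfolding act_deriv_def
  by (intro linear_map_sum[OF A.module_axioms] act_linear_op args_update) (auto simp: args_nth)

text \<open>Point and direction vary together in slot \<open>i\<close>, yet no summand is quadratic:
  the summand \<open>k = i\<close> overwrites \<open>f x\<close> and contains only
  \<open>g x\<close>, every other one contains only \<open>f x\<close>. For the action on a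
  semidirect product, \<open>f\<close> and \<open>g\<close> are two entries of the same
  tuple.\<close>

lemma act_deriv_linear_arg:
  assumes \<mu>: "\<mu> \<in> ops P n" and as: "as \<in> args A n" and bs: "bs \<in> args A n" and i: "i < n"
    and f: "linear_map R M A f" and g: "linear_map R M A g"
  shows "linear_map R M A (\<lambda>x. act_deriv A n \<mu> (as[i := f x]) (bs[i := g x]))"
  unfolding act_deriv_def
proof (rule linear_map_sum[OF A.module_axioms])
  fix k assume k: "k \<in> {..<n}"
  show "linear_map R M A (\<lambda>x. act A n \<mu> (as[i := f x, k := bs[i := g x] ! k]))"
  proof (cases "k = i")
    case True
    then show ?thesis
      using linear_map_compose[OF g act_linear_arg[OF \<mu> as i]] i args_length[OF bs] by simp
  next
    case False
    have "as[k := bs ! k] \<in> args A n" using as bs k by (simp add: args_update args_nth)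
    from linear_map_compose[OF f act_linear_arg[OF \<mu> this i]] show ?thesis
      using False by (simp add: list_update_swap[of k i])
  qed
qed simp

lemma act_deriv_unit:
  assumes "a \<in> carrier A" "b \<in> carrier A"
  shows "act_deriv A 1 (ounit P) [a] [b] = b"
  using assms(2) act_unit[OF assms(2)] by (simp add: act_deriv_def lessThan_Suc)

text \<open>Each summand contains exactly one entry of the direction, so the differential is
  additive in the whole direction at once.\<close>

lemma act_deriv_map_add:
  assumes \<mu>: "\<mu> \<in> ops P n" and as: "as \<in> args A n"
    and fs: "map f xs \<in> args A n" and gs: "map g xs \<in> args A n"
  shows "act_deriv A n \<mu> as (map (\<lambda>x. f x \<oplus>\<^bsub>A\<^esub> g x) xs) =
    act_deriv A n \<mu> as (map f xs) \<oplus>\<^bsub>A\<^esub> act_deriv A n \<mu> as (map g xs)"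
proof -
  have fg: "f (xs ! k) \<in> carrier A" "g (xs ! k) \<in> carrier A" "length xs = n" if "k < n" for k
    using fs gs that by (auto simp: args_def)
  have "act A n \<mu> (as[k := map (\<lambda>x. f x \<oplus>\<^bsub>A\<^esub> g x) xs ! k]) =
      act A n \<mu> (as[k := map f xs ! k]) \<oplus>\<^bsub>A\<^esub> act A n \<mu> (as[k := map g xs ! k])" if "k < n" for k
    using linear_map_add[OF act_linear_arg[OF \<mu> as that] fg(1,2)[OF that]] fg(3)[OF that] that by simp
  then have "act_deriv A n \<mu> as (map (\<lambda>x. f x \<oplus>\<^bsub>A\<^esub> g x) xs) = (\<Oplus>\<^bsub>A\<^esub>k\<in>{..<n}.
      act A n \<mu> (as[k := map f xs ! k]) \<oplus>\<^bsub>A\<^esub> act A n \<mu> (as[k := map g xs ! k]))"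
    unfolding act_deriv_def using fg act_update_closed[OF \<mu> as] by (intro A.M.finsum_cong') auto
  also have "\<dots> = act_deriv A n \<mu> as (map f xs) \<oplus>\<^bsub>A\<^esub> act_deriv A n \<mu> as (map g xs)"
    unfolding act_deriv_def using fg act_update_closed[OF \<mu> as] by (intro A.M.finsum_addf) auto
  finally show ?thesis .
qed

lemma act_deriv_zero:
  assumes "\<mu> \<in> ops P n" "as \<in> args A n" "length xs = n"
  shows "act_deriv A n \<mu> as (map (\<lambda>x. \<zero>\<^bsub>A\<^esub>) xs) = \<zero>\<^bsub>A\<^esub>"
  unfolding act_deriv_def
proof (rule A.M.add.finprod_one_eqI)
  fix k assume "k \<in> {..<n}"
  then show "act A n \<mu> (as[k := map (\<lambda>x. \<zero>\<^bsub>A\<^esub>) xs ! k]) = \<zero>\<^bsub>A\<^esub>"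
    using assms by (intro act_zero[of _ _ _ k] args_update) (auto simp: args_length)
qed

text \<open>Replacing slot \<open>k\<close> for the permuted operation is replacing slot
  \<open>\<sigma> k\<close> for \<open>\<mu>\<close>, so the two sums differ by the reindexing along
  \<open>\<sigma>\<close>.\<close>

lemma act_deriv_sym:
  assumes \<mu>: "\<mu> \<in> ops P n" and as: "as \<in> args A n" and bs: "bs \<in> args A n" and \<sigma>: "\<sigma> permutes {..<n}"
  shows "act_deriv A n (osym P n \<sigma> \<mu>) as bs = act_deriv A n \<mu> (perm_args \<sigma> as) (perm_args \<sigma> bs)"
proof -
  have len: "length as = n" "length bs = n"
    using as bs by (auto simp: args_length)
  let ?f = "\<lambda>k. act A n \<mu> ((perm_args \<sigma> as)[k := perm_args \<sigma> bs ! k])"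
  have f: "?f k \<in> carrier A" if "k < n" for k
    using that as bs \<sigma> by (intro act_update_closed[OF \<mu>]) (auto simp: args_perm_args intro!: args_nth)
  have lt: "\<sigma> k < n" if "k < n" for k
    using permutes_in_image[OF \<sigma>, of k] that by simp
  have "act A n (osym P n \<sigma> \<mu>) (as[k := bs ! k]) = ?f (\<sigma> k)" if "k < n" for k
    using that act_sym[OF \<mu> args_update[OF as args_nth[OF bs that]] \<sigma>] \<sigma> len lt[OF that]
    by (simp add: perm_args_update perm_args_nth permutes_inverses(2)[OF \<sigma>])
  then have "act_deriv A n (osym P n \<sigma> \<mu>) as bs = (\<Oplus>\<^bsub>A\<^esub>k\<in>{..<n}. ?f (\<sigma> k))"
    unfolding act_deriv_def using f lt by (intro A.M.finsum_cong') auto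
  also have "\<dots> = (\<Oplus>\<^bsub>A\<^esub>k\<in>\<sigma> ` {..<n}. ?f k)"
    using f lt permutes_inj_on[OF \<sigma>] by (intro A.M.finsum_reindex[symmetric]) auto
  finally show ?thesis
    by (simp add: permutes_image[OF \<sigma>] act_deriv_def)
qed

text \<open>This is the chain rule: grouping the slots of the composite by blocks leaves an outer
  sum over the arguments of \<open>\<mu>\<close> and, for each of them, an inner sum over the
  arguments of the operation plugged in there.\<close>

lemma act_deriv_comp:
  assumes \<mu>: "\<mu> \<in> ops P (length ks)" and \<nu>s: "ops_list P ks \<nu>s"
    and ass: "list_all2 (\<lambda>k as. as \<in> args A k) ks ass"
    and bss: "list_all2 (\<lambda>k bs. bs \<in> args A k) ks bss"
  shows "act_deriv A (sum_list ks) (ocomp P ks \<mu> \<nu>s) (concat ass) (concat bss) =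
    act_deriv A (length ks) \<mu> (map (\<lambda>i. act A (ks ! i) (\<nu>s ! i) (ass ! i)) [0..<length ks])
      (map (\<lambda>i. act_deriv A (ks ! i) (\<nu>s ! i) (ass ! i) (bss ! i)) [0..<length ks])"
proof -
  let ?n = "length ks"
  let ?V = "map (\<lambda>i. act A (ks ! i) (\<nu>s ! i) (ass ! i)) [0..<?n]"
  let ?D = "map (\<lambda>i. act_deriv A (ks ! i) (\<nu>s ! i) (ass ! i) (bss ! i)) [0..<?n]"
  let ?F = "\<lambda>k. act A (sum_list ks) (ocomp P ks \<mu> \<nu>s) ((concat ass)[k := concat bss ! k])"
  note all = \<nu>s[unfolded ops_list_def list_all2_conv_all_nth] ass[unfolded list_all2_conv_all_nth]
    bss[unfolded list_all2_conv_all_nth]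
  have len: "length ass = ?n" "length bss = ?n" "map length ass = ks" "map length bss = ks"
    using all args_concat[OF ass] args_concat[OF bss] by auto
  have V: "?V \<in> args A ?n"
    using all by (auto simp: args_iff_nth act_closed)
  have D: "?D ! i \<in> carrier A" if "i < ?n" for i
    using that all by (simp add: act_deriv_closed)
  have cassk: "concat ass \<in> args A (sum_list ks)" and cbssk: "concat bss \<in> args A (sum_list ks)"
    using args_concat[OF ass] args_concat[OF bss] by auto
  have F: "?F k \<in> carrier A" if "k < sum_list ks" for k
    using that by (intro act_update_closed P.comp_closed \<mu> \<nu>s cassk args_nth[OF cbssk])
  \<comment> \<open>A substitution in slot \<open>j\<close> of block \<open>i\<close> concerns the
    \<open>i\<close>-th argument list alone, so by \<open>act_comp\<close> only the
    \<open>i\<close>-th inner value changes.\<close>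
  have block: "?F (block_start ks i + j) =
      act A ?n \<mu> (?V[i := act A (ks ! i) (\<nu>s ! i) ((ass ! i)[j := bss ! i ! j])])"
    if i: "i < ?n" and j: "j < ks ! i" for i j
  proof -
    have leni: "length (ass ! i) = ks ! i" "length (bss ! i) = ks ! i"
      using all i by (auto simp: args_length)
    let ?ass = "ass[i := (ass ! i)[j := bss ! i ! j]]"
    have "(concat ass)[block_start ks i + j := concat bss ! (block_start ks i + j)] = concat ?ass"
      using concat_block_update[of i ass j] concat_block_nth[of i bss j] i j leni len by simp
    moreover have "list_all2 (\<lambda>k as. as \<in> args A k) ks ?ass"
      using all i j by (auto simp: list_all2_conv_all_nth nth_list_update args_update args_nth)
    moreover have "map (\<lambda>i. act A (ks ! i) (\<nu>s ! i) (?ass ! i)) [0..<?n] =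
        ?V[i := act A (ks ! i) (\<nu>s ! i) ((ass ! i)[j := bss ! i ! j])]"
      using i len by (intro nth_equalityI) (auto simp: nth_list_update)
    ultimately show ?thesis
      using act_comp[OF \<mu> \<nu>s] by simp
  qed
  \<comment> \<open>Linearity of \<open>\<mu>\<close> in slot \<open>i\<close> moves the sum over
    the block inside, where it is the differential of the \<open>i\<close>-th inner
    operation.\<close>
  have inner: "(\<Oplus>\<^bsub>A\<^esub>j\<in>{..<ks ! i}. ?F (block_start ks i + j)) = act A ?n \<mu> (?V[i := ?D ! i])"
    if i: "i < ?n" for i
  proof -
    have cl: "act A (ks ! i) (\<nu>s ! i) ((ass ! i)[j := bss ! i ! j]) \<in> carrier A" if "j < ks ! i" for j
      using all i that by (intro act_update_closed) (auto simp: args_nth)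
    have "(\<Oplus>\<^bsub>A\<^esub>j\<in>{..<ks ! i}. ?F (block_start ks i + j)) = (\<Oplus>\<^bsub>A\<^esub>j\<in>{..<ks ! i}.
        act A ?n \<mu> (?V[i := act A (ks ! i) (\<nu>s ! i) ((ass ! i)[j := bss ! i ! j])]))"
      using block[OF i] cl by (intro A.M.finsum_cong') (auto intro!: act_update_closed[OF \<mu> V])
    also have "\<dots> = act A ?n \<mu> (?V[i := \<Oplus>\<^bsub>A\<^esub>j\<in>{..<ks ! i}.
        act A (ks ! i) (\<nu>s ! i) ((ass ! i)[j := bss ! i ! j])])"
      using cl by (intro linear_map_finsum[OF A.module_axioms A.module_axioms act_linear_arg[OF \<mu> V i],
            symmetric]) auto
    finally show ?thesis
      using i by (simp add: act_deriv_def)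
  qed
  have "act_deriv A (sum_list ks) (ocomp P ks \<mu> \<nu>s) (concat ass) (concat bss) =
      (\<Oplus>\<^bsub>A\<^esub>i\<in>{..<?n}. \<Oplus>\<^bsub>A\<^esub>j\<in>{..<ks ! i}. ?F (block_start ks i + j))"
    unfolding act_deriv_def by (rule A.M.finsum_blocks) (rule F)
  also have "\<dots> = act_deriv A ?n \<mu> ?V ?D"
    unfolding act_deriv_def[of _ ?n] using D
    by (intro A.M.finsum_cong') (auto simp: inner simp del: nth_map intro!: act_update_closed[OF \<mu> V])
  finally show ?thesis .
qed

text \<open>Both sides are double sums over two slots \<open>k\<close> and \<open>j\<close>. On the
  diagonal the slot receives \<open>ds ! k\<close> either way; off the diagonal the two slots
  receive one entry of \<open>bs\<close> and one of \<open>cs\<close>, and updates at different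
  slots commute. Exchanging the order of summation matches the terms.\<close>

lemma act_deriv_swap:
  assumes \<mu>: "\<mu> \<in> ops P n" and as: "as \<in> args A n" and bs: "bs \<in> args A n"
    and cs: "cs \<in> args A n" and ds: "ds \<in> args A n"
  shows "(\<Oplus>\<^bsub>A\<^esub>k\<in>{..<n}. act_deriv A n \<mu> (as[k := cs ! k]) (bs[k := ds ! k])) =
    (\<Oplus>\<^bsub>A\<^esub>k\<in>{..<n}. act_deriv A n \<mu> (as[k := bs ! k]) (cs[k := ds ! k]))"
proof -
  let ?F = "\<lambda>bs cs k j. act A n \<mu> (as[k := cs ! k, j := bs[k := ds ! k] ! j])"
  have F: "?F bs cs k j \<in> carrier A" if "k < n" "j < n" "bs \<in> args A n" "cs \<in> args A n" for k j bs cs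
    using that as ds by (intro act_update_closed[OF \<mu>] args_update args_nth[of _ A n]) auto
  have sym: "?F bs cs k j = ?F cs bs j k" if "k < n" "j < n" for k j
    using that args_length[OF bs] args_length[OF cs]
    by (cases "j = k") (auto simp: list_update_swap)
  have "(\<Oplus>\<^bsub>A\<^esub>k\<in>{..<n}. \<Oplus>\<^bsub>A\<^esub>j\<in>{..<n}. ?F bs cs k j) = (\<Oplus>\<^bsub>A\<^esub>j\<in>{..<n}. \<Oplus>\<^bsub>A\<^esub>k\<in>{..<n}. ?F bs cs k j)"
    using F bs cs by (intro A.M.finsum_swap) auto
  also have "\<dots> = (\<Oplus>\<^bsub>A\<^esub>j\<in>{..<n}. \<Oplus>\<^bsub>A\<^esub>k\<in>{..<n}. ?F cs bs j k)"
    using F bs cs sym by (intro A.M.finsum_cong') (auto intro!: A.M.finsum_closed)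
  finally show ?thesis by (simp add: act_deriv_def)
qed

text \<open>For \<open>j\<close> different from \<open>k\<close> the direction puts a zero into slot
  \<open>j\<close>, which kills the summand; for \<open>j = k\<close> it overwrites the zero of the
  point. The vertical lift leads to exactly this double sum.\<close>

lemma act_deriv_diagonal:
  assumes \<mu>: "\<mu> \<in> ops P n" and as: "as \<in> args A n" and bs: "bs \<in> args A n"
  shows "(\<Oplus>\<^bsub>A\<^esub>k\<in>{..<n}. act_deriv A n \<mu> (as[k := replicate n \<zero>\<^bsub>A\<^esub> ! k]) ((replicate n \<zero>\<^bsub>A\<^esub>)[k := bs ! k])) =
    act_deriv A n \<mu> as bs"
  unfolding act_deriv_def[of _ _ _ as]
proof (rule A.M.finsum_cong')
  fix k assume k: "k \<in> {..<n}"
  have bk: "bs ! k \<in> carrier A" using args_nth[OF bs] k by simp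
  let ?F = "\<lambda>j. act A n \<mu> (as[k := \<zero>\<^bsub>A\<^esub>, j := (replicate n \<zero>\<^bsub>A\<^esub>)[k := bs ! k] ! j])"
  have "?F j = (if k = j then act A n \<mu> (as[k := bs ! k]) else \<zero>\<^bsub>A\<^esub>)" if j: "j < n" for j
  proof (cases "k = j")
    case False
    have "as[k := \<zero>\<^bsub>A\<^esub>, j := \<zero>\<^bsub>A\<^esub>] \<in> args A n" by (intro args_update as) auto
    from act_zero[OF \<mu> this j] show ?thesis
      using False j args_length[OF as] by simp
  qed (use j in simp)
  then have "act_deriv A n \<mu> (as[k := replicate n \<zero>\<^bsub>A\<^esub> ! k]) ((replicate n \<zero>\<^bsub>A\<^esub>)[k := bs ! k]) =
      (\<Oplus>\<^bsub>A\<^esub>j\<in>{..<n}. if k = j then act A n \<mu> (as[k := bs ! k]) else \<zero>\<^bsub>A\<^esub>)"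
    unfolding act_deriv_def using act_update_closed[OF \<mu> as bk] k
    by (intro A.M.finsum_cong') auto
  also have "\<dots> = act A n \<mu> (as[k := bs ! k])"
    using k act_update_closed[OF \<mu> as bk] by (intro A.M.finsum_singleton) auto
  finally show "act_deriv A n \<mu> (as[k := replicate n \<zero>\<^bsub>A\<^esub> ! k]) ((replicate n \<zero>\<^bsub>A\<^esub>)[k := bs ! k]) =
    act A n \<mu> (as[k := bs ! k])" .
qed (use act_update_closed[OF \<mu> as args_nth[OF bs]] in auto)

end

section \<open>Semidirect products\<close>

lemma entry_Tuple [simp]: "entry j (Tuple as) = as ! j"
  by (simp add: entry_def)

lemma carrier_semidirect: "carrier (semidirect R P n A) = Tuple ` args A (Suc n)"
  by (simp add: semidirect_def Let_def)

lemma Tuple_in_semidirect [simp]: "Tuple as \<in> carrier (semidirect R P n A) \<longleftrightarrow> as \<in> args A (Suc n)"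
  by (auto simp: carrier_semidirect)

lemma entry_closed: "x \<in> carrier (semidirect R P n A) \<Longrightarrow> j \<le> n \<Longrightarrow> entry j x \<in> carrier A"
  by (auto simp: carrier_semidirect args_iff_nth)

lemma semidirect_eqI:
  assumes "x \<in> carrier (semidirect R P n A)" "y \<in> carrier (semidirect R P n A)"
    and "\<And>j. j \<le> n \<Longrightarrow> entry j x = entry j y"
  shows "x = y"
  using assms by (auto simp: carrier_semidirect args_def intro!: nth_equalityI)

lemma tuple_of_entries:
  "(\<And>j. j \<le> n \<Longrightarrow> f j \<in> carrier A) \<Longrightarrow> Tuple (map f [0..<Suc n]) \<in> carrier (semidirect R P n A)"
  by (simp add: args_iff_nth del: upt_Suc)

lemma entry_map_upt: "j \<le> n \<Longrightarrow> entry j (Tuple (map f [0..<Suc n])) = f j"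
  by (simp del: upt_Suc)

lemma entry_zero: "j \<le> n \<Longrightarrow> entry j \<zero>\<^bsub>semidirect R P n A\<^esub> = \<zero>\<^bsub>A\<^esub>"
  by (simp add: semidirect_def Let_def del: replicate_Suc)

lemma args_entry: "xs \<in> args (semidirect R P n A) m \<Longrightarrow> j \<le> n \<Longrightarrow> map (entry j) xs \<in> args A m"
  by (erule args_map) (rule entry_closed)

lemma semidirect_args: "length xs = m \<and> set xs \<subseteq> carrier (semidirect R P n A) \<longleftrightarrow>
    xs \<in> args (semidirect R P n A) m"
  by (simp add: args_def)

locale tuples_algebra = operad_algebra R P A
  for R :: "('r, 'x) ring_scheme" and P :: "('r, 'p) operad" and A :: "('r, 'u, 'p) talg" +
  fixes n :: nat
begin

abbreviation S where "S \<equiv> semidirect R P n A"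

lemma add_closed: "x \<in> carrier S \<Longrightarrow> y \<in> carrier S \<Longrightarrow> x \<oplus>\<^bsub>S\<^esub> y \<in> carrier S"
  and entry_add: "x \<in> carrier S \<Longrightarrow> y \<in> carrier S \<Longrightarrow> j \<le> n \<Longrightarrow>
    entry j (x \<oplus>\<^bsub>S\<^esub> y) = entry j x \<oplus>\<^bsub>A\<^esub> entry j y"
proof -
  assume xy: "x \<in> carrier S" "y \<in> carrier S"
  have eq: "x \<oplus>\<^bsub>S\<^esub> y = Tuple (map (\<lambda>j. entry j x \<oplus>\<^bsub>A\<^esub> entry j y) [0..<Suc n])"
    using xy by (simp add: carrier_semidirect) (simp add: semidirect_def Let_def)
  show "x \<oplus>\<^bsub>S\<^esub> y \<in> carrier S"
    unfolding eq using xy by (intro tuple_of_entries) (auto intro: entry_closed)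
  show "j \<le> n \<Longrightarrow> entry j (x \<oplus>\<^bsub>S\<^esub> y) = entry j x \<oplus>\<^bsub>A\<^esub> entry j y"
    unfolding eq by (rule entry_map_upt)
qed

lemma smult_closed: "r \<in> carrier R \<Longrightarrow> x \<in> carrier S \<Longrightarrow> r \<odot>\<^bsub>S\<^esub> x \<in> carrier S"
  and entry_smult: "r \<in> carrier R \<Longrightarrow> x \<in> carrier S \<Longrightarrow> j \<le> n \<Longrightarrow>
    entry j (r \<odot>\<^bsub>S\<^esub> x) = r \<odot>\<^bsub>A\<^esub> entry j x"
proof -
  assume rx: "r \<in> carrier R" "x \<in> carrier S"
  have eq: "r \<odot>\<^bsub>S\<^esub> x = Tuple (map (\<lambda>j. r \<odot>\<^bsub>A\<^esub> entry j x) [0..<Suc n])"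
    using rx by (simp add: carrier_semidirect) (simp add: semidirect_def Let_def)
  show "r \<odot>\<^bsub>S\<^esub> x \<in> carrier S"
    unfolding eq using rx by (intro tuple_of_entries) (auto intro: entry_closed)
  show "j \<le> n \<Longrightarrow> entry j (r \<odot>\<^bsub>S\<^esub> x) = r \<odot>\<^bsub>A\<^esub> entry j x"
    unfolding eq by (rule entry_map_upt)
qed

lemma
  assumes "\<mu> \<in> ops P m" "xs \<in> args S m"
  shows act_semidirect_closed: "act S m \<mu> xs \<in> carrier S"
    and entry_0_act: "entry 0 (act S m \<mu> xs) = act A m \<mu> (map (entry 0) xs)"
    and entry_act: "\<lbrakk>1 \<le> j; j \<le> n\<rbrakk> \<Longrightarrow>
      entry j (act S m \<mu> xs) = act_deriv A m \<mu> (map (entry 0) xs) (map (entry j) xs)"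
proof -
  have len: "length xs = m" using assms(2) by (rule args_length)
  \<comment> \<open>The semidirect product takes the entry of \<open>xs ! k\<close>, while
    \<open>act_deriv\<close> indexes the mapped list. Beyond the length both updates are void, so
    the equation holds for all \<open>k\<close>.\<close>
  have upd: "(map (entry 0) xs)[k := entry j (xs ! k)] = (map (entry 0) xs)[k := map (entry j) xs ! k]"
    for k j
    by (cases "k < length xs") (simp_all add: list_update_beyond)
  let ?f = "\<lambda>j. if j = 0 then act A m \<mu> (map (entry 0) xs)
    else act_deriv A m \<mu> (map (entry 0) xs) (map (entry j) xs)"
  have "act S m \<mu> xs = Tuple (act A m \<mu> (map (entry 0) xs) #
      map (\<lambda>j. act_deriv A m \<mu> (map (entry 0) xs) (map (entry j) xs)) [1..<Suc n])"
    using assms unfolding semidirect_args[of xs m R P n A, symmetric] carrier_semidirect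
    by (simp add: semidirect_def Let_def act_deriv_def upd del: upt_Suc)
  \<comment> \<open>Head and tail become one map over all indices, so that
    \<open>entry_map_upt\<close> reads off any entry.\<close>
  also have "\<dots> = Tuple (map ?f [0..<Suc n])"
    unfolding upt_conv_Cons[of 0 "Suc n", OF zero_less_Suc] by (simp del: upt_Suc)
  finally have eq: "act S m \<mu> xs = Tuple (map ?f [0..<Suc n])" .
  show "act S m \<mu> xs \<in> carrier S"
    unfolding eq using assms
    by (intro tuple_of_entries) (auto intro!: act_closed act_deriv_closed args_entry[of _ R P n])
  show "entry 0 (act S m \<mu> xs) = act A m \<mu> (map (entry 0) xs)"
    unfolding eq by (subst entry_map_upt) simp_all
  show "\<lbrakk>1 \<le> j; j \<le> n\<rbrakk> \<Longrightarrow>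
      entry j (act S m \<mu> xs) = act_deriv A m \<mu> (map (entry 0) xs) (map (entry j) xs)"
    unfolding eq by (subst entry_map_upt) simp_all
qed

lemma semidirect_abelian_group: "abelian_group S"
proof (rule abelian_groupI)
  have zero: "\<zero>\<^bsub>S\<^esub> \<in> carrier S"
  proof -
    have "\<zero>\<^bsub>S\<^esub> = Tuple (replicate (Suc n) \<zero>\<^bsub>A\<^esub>)"
      by (simp add: semidirect_def Let_def)
    then show ?thesis by (simp only: Tuple_in_semidirect) (auto simp: args_def)
  qed
  then show "\<zero>\<^bsub>S\<^esub> \<in> carrier S" .
  fix x y z assume x: "x \<in> carrier S"
  obtain w where w: "w \<in> carrier S" "\<And>j. j \<le> n \<Longrightarrow> entry j w = \<ominus>\<^bsub>A\<^esub> entry j x"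
  proof
    show "Tuple (map (\<lambda>j. \<ominus>\<^bsub>A\<^esub> entry j x) [0..<Suc n]) \<in> carrier S"
      using x by (intro tuple_of_entries) (auto intro: entry_closed)
  qed (rule entry_map_upt)
  have "w \<oplus>\<^bsub>S\<^esub> x = \<zero>\<^bsub>S\<^esub>"
  proof (rule semidirect_eqI[OF add_closed[OF w(1) x] zero])
    fix j assume j: "j \<le> n"
    show "entry j (w \<oplus>\<^bsub>S\<^esub> x) = entry j \<zero>\<^bsub>S\<^esub>"
      unfolding entry_add[OF w(1) x j] entry_zero[OF j] w(2)[OF j]
      by (rule A.M.l_neg[OF entry_closed[OF x j]])
  qed
  with w(1) show "\<exists>y\<in>carrier S. y \<oplus>\<^bsub>S\<^esub> x = \<zero>\<^bsub>S\<^esub>" by blast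
  show "\<zero>\<^bsub>S\<^esub> \<oplus>\<^bsub>S\<^esub> x = x"
    using x zero
    by - (rule semidirect_eqI[of _ R P n A],
      auto simp: add_closed smult_closed entry_add entry_zero entry_closed)
  assume y: "y \<in> carrier S"
  then show "x \<oplus>\<^bsub>S\<^esub> y \<in> carrier S" using x by (simp add: add_closed)
  show "x \<oplus>\<^bsub>S\<^esub> y = y \<oplus>\<^bsub>S\<^esub> x"
    using x y
    by - (rule semidirect_eqI[of _ R P n A],
      auto simp: add_closed smult_closed entry_add entry_closed A.M.a_comm)
  assume z: "z \<in> carrier S"
  show "x \<oplus>\<^bsub>S\<^esub> y \<oplus>\<^bsub>S\<^esub> z = x \<oplus>\<^bsub>S\<^esub> (y \<oplus>\<^bsub>S\<^esub> z)"
    using x y z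
    by - (rule semidirect_eqI[of _ R P n A],
      auto simp: add_closed smult_closed entry_add entry_closed A.M.a_assoc)
qed

lemma semidirect_module: "module R S"
proof (rule moduleI[OF A.R.is_cring semidirect_abelian_group])
  fix r s x y assume r: "r \<in> carrier R" and x: "x \<in> carrier S"
  show "r \<odot>\<^bsub>S\<^esub> x \<in> carrier S" using r x by (rule smult_closed)
  show "r \<odot>\<^bsub>S\<^esub> (x \<oplus>\<^bsub>S\<^esub> y) = r \<odot>\<^bsub>S\<^esub> x \<oplus>\<^bsub>S\<^esub> r \<odot>\<^bsub>S\<^esub> y" if "y \<in> carrier S"
    using r x that
    by - (rule semidirect_eqI[of _ R P n A],
      auto simp: add_closed smult_closed entry_add entry_smult entry_closed A.smult_r_distr)
  assume s: "s \<in> carrier R"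
  show "(r \<oplus>\<^bsub>R\<^esub> s) \<odot>\<^bsub>S\<^esub> x = r \<odot>\<^bsub>S\<^esub> x \<oplus>\<^bsub>S\<^esub> s \<odot>\<^bsub>S\<^esub> x"
    using r s x
    by - (rule semidirect_eqI[of _ R P n A],
      auto simp: add_closed smult_closed entry_add entry_smult entry_closed A.smult_l_distr)
  show "(r \<otimes>\<^bsub>R\<^esub> s) \<odot>\<^bsub>S\<^esub> x = r \<odot>\<^bsub>S\<^esub> (s \<odot>\<^bsub>S\<^esub> x)"
    using r s x
    by - (rule semidirect_eqI[of _ R P n A],
      auto simp: add_closed smult_closed entry_smult entry_closed A.smult_assoc1)
next
  fix x assume x: "x \<in> carrier S"
  then show "\<one>\<^bsub>R\<^esub> \<odot>\<^bsub>S\<^esub> x = x"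

    by - (rule semidirect_eqI[of _ R P n A],
      auto simp: add_closed smult_closed entry_smult entry_closed)
qed

lemma semidirect_normal_module: "normal_module R S"
  unfolding normal_module_def using semidirect_module
  by (simp add: carrier_semidirect) (simp add: semidirect_def Let_def)

lemma linear_map_entry: "j \<le> n \<Longrightarrow> linear_map R S A (entry j)"
  by (intro linear_mapI) (simp_all add: entry_add entry_smult entry_closed)

lemma linear_map_semidirectI:
  assumes M: "module R M" and f: "\<And>x. x \<in> carrier M \<Longrightarrow> f x \<in> carrier S"
    and lin: "\<And>j. j \<le> n \<Longrightarrow> linear_map R M A (\<lambda>x. entry j (f x))"
  shows "linear_map R M S f"
proof -
  interpret M: module R M by (rule M)
  show ?thesis
  proof (rule linear_mapI[OF f])
    fix x y assume x: "x \<in> carrier M"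
    show "f (x \<oplus>\<^bsub>M\<^esub> y) = f x \<oplus>\<^bsub>S\<^esub> f y" if y: "y \<in> carrier M"
      using x y linear_map_add[OF lin x y] f

    by - (rule semidirect_eqI[of _ R P n A],
      auto simp: add_closed smult_closed entry_add)
    show "f (r \<odot>\<^bsub>M\<^esub> x) = r \<odot>\<^bsub>S\<^esub> f x" if r: "r \<in> carrier R" for r
      using x r linear_map_smult[OF lin r x] f

    by - (rule semidirect_eqI[of _ R P n A],
      auto simp: add_closed smult_closed entry_smult)
  qed
qed

lemma list_all2_args_entry:
  "j \<le> n \<Longrightarrow> list_all2 (\<lambda>k xs. xs \<in> args S k) ks xss \<Longrightarrow>
    list_all2 (\<lambda>k as. as \<in> args A k) ks (map (map (entry j)) xss)"
  by (auto simp: list_all2_conv_all_nth intro: args_entry)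

text \<open>Every axiom splits along the entries. Entry 0 is the same axiom for \<open>A\<close>; a
  later entry is the matching rule for \<open>act_deriv\<close>, with the chain rule for composition
  and the reindexing rule for permutations.\<close>

theorem semidirect_algebra: "operad_algebra R P S"
proof
  show "normal_module R S" by (rule semidirect_normal_module)
next
  fix \<mu> m xs assume "\<not> (\<mu> \<in> ops P m \<and> xs \<in> args S m)"
  then show "act S m \<mu> xs = undefined"
    unfolding semidirect_args[symmetric] carrier_semidirect by (auto simp: semidirect_def Let_def)
next
  fix xs m assume xs: "xs \<in> args S m"
  show "linear_map R (omod P m) S (\<lambda>\<mu>. act S m \<mu> xs)"
  proof (rule linear_map_semidirectI[OF P.operad_module])
    show "act S m \<mu> xs \<in> carrier S" if "\<mu> \<in> carrier (omod P m)" for \<mu>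
      using that xs by (simp add: act_semidirect_closed ops_def)
    fix j assume j: "j \<le> n"
    show "linear_map R (omod P m) A (\<lambda>\<mu>. entry j (act S m \<mu> xs))"
    proof (cases "j = 0")
      case True
      with act_linear_op[OF args_entry[OF xs j]] show ?thesis
        by (subst linear_map_cong[OF P.operad_module]) (auto simp: entry_0_act xs ops_def)
    next
      case False
      with act_deriv_linear_op[OF args_entry[OF xs le0] args_entry[OF xs j]] j show ?thesis
        by (subst linear_map_cong[OF P.operad_module]) (auto simp: entry_act xs ops_def)
    qed
  qed
next
  fix \<mu> m xs i assume \<mu>: "\<mu> \<in> ops P m" and xs: "xs \<in> args S m" and i: "i < m"
  show "linear_map R S S (\<lambda>x. act S m \<mu> (xs[i := x]))"
  proof (rule linear_map_semidirectI[OF semidirect_module])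
    show "act S m \<mu> (xs[i := x]) \<in> carrier S" if "x \<in> carrier S" for x
      using that \<mu> xs by (simp add: act_semidirect_closed args_update)
    fix j assume j: "j \<le> n"
    show "linear_map R S A (\<lambda>x. entry j (act S m \<mu> (xs[i := x])))"
    proof (cases "j = 0")
      case True
      with linear_map_compose[OF linear_map_entry[OF j] act_linear_arg[OF \<mu> args_entry[OF xs j] i]]
      show ?thesis
        by (subst linear_map_cong[OF semidirect_module]) (auto simp: entry_0_act \<mu> xs args_update map_update)
    next
      case False
      with act_deriv_linear_arg[OF \<mu> args_entry[OF xs le0] args_entry[OF xs j] i
          linear_map_entry[OF le0] linear_map_entry[OF j]] j
      show ?thesis
        by (subst linear_map_cong[OF semidirect_module]) (auto simp: entry_act \<mu> xs args_update map_update)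
    qed
  qed
next
  fix x assume x: "x \<in> carrier S"
  then have xs: "[x] \<in> args S 1" by (simp add: args_def)
  show "act S 1 (ounit P) [x] = x"
  proof (rule semidirect_eqI[OF act_semidirect_closed[OF P.unit xs] x])
    fix j assume j: "j \<le> n"
    show "entry j (act S 1 (ounit P) [x]) = entry j x"
      using entry_0_act[OF P.unit xs] entry_act[OF P.unit xs _ j] act_unit[OF entry_closed[OF x j]]
        act_deriv_unit[OF entry_closed[OF x le0] entry_closed[OF x j]]
      by (cases "j = 0") (simp_all del: One_nat_def)
  qed
next
  fix \<mu> ks \<nu>s xss
  assume \<mu>: "\<mu> \<in> ops P (length ks)" and \<nu>s: "ops_list P ks \<nu>s"
    and xss: "list_all2 (\<lambda>k xs. xs \<in> args S k) ks xss"
  let ?V = "map (\<lambda>i. act S (ks ! i) (\<nu>s ! i) (xss ! i)) [0..<length ks]"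
  note comp = P.comp_closed[OF \<mu> \<nu>s] and concat = args_concat[OF xss, THEN conjunct1]
  have len: "length xss = length ks" using xss by (rule list_all2_lengthD[symmetric])
  have V: "?V \<in> args S (length ks)"
    using \<nu>s xss by (auto simp: args_iff_nth[of _ S] ops_list_def list_all2_conv_all_nth
        intro!: act_semidirect_closed)
  have nth: "\<nu>s ! i \<in> ops P (ks ! i)" "xss ! i \<in> args S (ks ! i)" if "i < length ks" for i
    using \<nu>s xss that by (auto simp: ops_list_def list_all2_conv_all_nth)
  have V0: "map (entry 0) ?V =
      map (\<lambda>i. act A (ks ! i) (\<nu>s ! i) (map (map (entry 0)) xss ! i)) [0..<length ks]"
    using nth len by (auto simp: entry_0_act)
  have Vj: "map (entry j) ?V = map (\<lambda>i. act_deriv A (ks ! i) (\<nu>s ! i) (map (map (entry 0)) xss ! i)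
      (map (map (entry j)) xss ! i)) [0..<length ks]" if "1 \<le> j" "j \<le> n" for j
    using nth len that by (auto simp: entry_act)
  show "act S (sum_list ks) (ocomp P ks \<mu> \<nu>s) (concat xss) = act S (length ks) \<mu> ?V"
  proof (rule semidirect_eqI[OF act_semidirect_closed[OF comp concat] act_semidirect_closed[OF \<mu> V]])
    fix j assume j: "j \<le> n"
    show "entry j (act S (sum_list ks) (ocomp P ks \<mu> \<nu>s) (concat xss)) = entry j (act S (length ks) \<mu> ?V)"
    proof (cases "j = 0")
      case True
      then show ?thesis
        unfolding True entry_0_act[OF comp concat] entry_0_act[OF \<mu> V] V0 map_concat
        by (intro act_comp \<mu> \<nu>s list_all2_args_entry[OF le0 xss])
    next
      case False
      then have j1: "1 \<le> j" by simp
      show ?thesis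
        unfolding entry_act[OF comp concat j1 j] entry_act[OF \<mu> V j1 j] V0 Vj[OF j1 j] map_concat
        by (intro act_deriv_comp \<mu> \<nu>s list_all2_args_entry[OF le0 xss] list_all2_args_entry[OF j xss])
    qed
  qed
next
  fix \<mu> m xs \<sigma> assume \<mu>: "\<mu> \<in> ops P m" and xs: "xs \<in> args S m" and \<sigma>: "\<sigma> permutes {..<m}"
  note sym = P.sym_closed[OF \<sigma> \<mu>] and pxs = args_perm_args[OF \<sigma> xs]
  have perm: "map f (perm_args \<sigma> xs) = perm_args \<sigma> (map f xs)" for f :: "'u tuples \<Rightarrow> 'u tuples"
    using \<sigma> args_length[OF xs] by (simp add: perm_args_map)
  show "act S m (osym P m \<sigma> \<mu>) xs = act S m \<mu> (perm_args \<sigma> xs)"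
  proof (rule semidirect_eqI[OF act_semidirect_closed[OF sym xs] act_semidirect_closed[OF \<mu> pxs]])
    fix j assume j: "j \<le> n"
    show "entry j (act S m (osym P m \<sigma> \<mu>) xs) = entry j (act S m \<mu> (perm_args \<sigma> xs))"
    proof (cases "j = 0")
      case True
      show ?thesis
        unfolding True entry_0_act[OF sym xs] entry_0_act[OF \<mu> pxs] perm
        by (rule act_sym[OF \<mu> args_entry[OF xs le0] \<sigma>])
    next
      case False
      then have j1: "1 \<le> j" by simp
      show ?thesis
        unfolding entry_act[OF sym xs j1 j] entry_act[OF \<mu> pxs j1 j] perm
        by (rule act_deriv_sym[OF \<mu> args_entry[OF xs le0] args_entry[OF xs j] \<sigma>])
    qed
  qed
qed

end

section \<open>Morphisms and derivations of algebras\<close>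

lemma semidirect_operad_algebra:
  "operad_algebra R P A \<Longrightarrow> operad_algebra R P (semidirect R P n A)"
  by (rule tuples_algebra.semidirect_algebra) (rule tuples_algebra.intro)

lemma tangent_operad_algebra: "operad_algebra R P A \<Longrightarrow> operad_algebra R P (tangent_alg R P A)"
  unfolding tangent_alg_def by (rule semidirect_operad_algebra)

text \<open>Unlike \<open>alg_hom\<close>, no extensionality is asked for, so bare lambda terms can
  be composed; they are restricted to the carrier only when an arrow is formed.\<close>

definition alg_map :: "('r, 'x) ring_scheme \<Rightarrow> ('r, 'p) operad \<Rightarrow>
    ('r, 'a, 'p) alg \<Rightarrow> ('r, 'b, 'p) alg \<Rightarrow> ('a \<Rightarrow> 'b) \<Rightarrow> bool" where
  "alg_map R P A B h \<longleftrightarrow> linear_map R A B h \<and>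
     (\<forall>n. \<forall>\<mu>\<in>ops P n. \<forall>as\<in>args A n. h (act A n \<mu> as) = act B n \<mu> (map h as))"

text \<open>The Leibniz rule along \<open>f\<close>, which supplies the points at which operations
  are differentiated. That \<open>f\<close> is a morphism is a separate condition, as in
  \<open>alg_map_tangentI\<close>.\<close>

definition alg_derivation :: "('r, 'x) ring_scheme \<Rightarrow> ('r, 'p) operad \<Rightarrow>
    ('r, 'a, 'p) alg \<Rightarrow> ('r, 'b, 'p) alg \<Rightarrow> ('a \<Rightarrow> 'b) \<Rightarrow> ('a \<Rightarrow> 'b) \<Rightarrow> bool" where
  "alg_derivation R P A B f g \<longleftrightarrow> linear_map R A B g \<and>
     (\<forall>n. \<forall>\<mu>\<in>ops P n. \<forall>as\<in>args A n.
        g (act A n \<mu> as) = act_deriv B n \<mu> (map f as) (map g as))"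

lemma alg_hom_iff: "h \<in> alg_hom R P A B \<longleftrightarrow> h \<in> extensional (carrier A) \<and> alg_map R P A B h"
  by (simp add: alg_hom_def alg_map_def)

lemma alg_map_restrict:
  "operad_algebra R P A \<Longrightarrow> alg_map R P A B h \<Longrightarrow> restrict h (carrier A) \<in> alg_hom R P A B"
  unfolding alg_map_def by (rule restrict_alg_hom) auto

lemma alg_map_linear: "alg_map R P A B h \<Longrightarrow> linear_map R A B h"
  by (simp add: alg_map_def)

lemma alg_map_closed: "alg_map R P A B h \<Longrightarrow> a \<in> carrier A \<Longrightarrow> h a \<in> carrier B"
  by (rule linear_map_closed[OF alg_map_linear])

lemma alg_map_args: "alg_map R P A B h \<Longrightarrow> as \<in> args A n \<Longrightarrow> map h as \<in> args B n"
  by (rule args_map[of as A]) (auto intro: alg_map_closed)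

lemma alg_map_act:
  "\<lbrakk>alg_map R P A B h; \<mu> \<in> ops P n; as \<in> args A n\<rbrakk> \<Longrightarrow> h (act A n \<mu> as) = act B n \<mu> (map h as)"
  by (simp add: alg_map_def)

lemma alg_derivation_act:
  "\<lbrakk>alg_derivation R P A B f g; \<mu> \<in> ops P n; as \<in> args A n\<rbrakk> \<Longrightarrow>
    g (act A n \<mu> as) = act_deriv B n \<mu> (map f as) (map g as)"
  by (simp add: alg_derivation_def)

lemma alg_derivation_linear: "alg_derivation R P A B f g \<Longrightarrow> linear_map R A B g"
  by (simp add: alg_derivation_def)

lemma alg_derivation_args: "alg_derivation R P A B f g \<Longrightarrow> as \<in> args A n \<Longrightarrow> map g as \<in> args B n"
  by (rule args_map[of as A]) (auto intro: linear_map_closed[OF alg_derivation_linear])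

lemma alg_map_id: "operad_algebra R P A \<Longrightarrow> alg_map R P A A (\<lambda>a. a)"
  by (auto simp: alg_map_def operad_algebra_def normal_module_def intro: linear_map_id)

lemma alg_map_comp:
  "\<lbrakk>alg_map R P A B f; alg_map R P B D g\<rbrakk> \<Longrightarrow> alg_map R P A D (\<lambda>a. g (f a))"
  using linear_map_compose[OF alg_map_linear alg_map_linear]
  by (auto simp: alg_map_def[of R P A D] alg_map_act alg_map_args comp_def)

text \<open>A morphism is linear, so it passes through the finite sum, and it commutes with the
  operation in each summand.\<close>

lemma alg_map_act_deriv:
  assumes "operad_algebra R P A" "operad_algebra R P B" and h: "alg_map R P A B h"
    and \<mu>: "\<mu> \<in> ops P n" and as: "as \<in> args A n" and bs: "bs \<in> args A n"
  shows "h (act_deriv A n \<mu> as bs) = act_deriv B n \<mu> (map h as) (map h bs)"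
proof -
  interpret A: operad_algebra R P A by (rule assms)
  interpret B: operad_algebra R P B by (rule assms)
  have args: "as[k := bs ! k] \<in> args A n" if "k < n" for k
    using that as bs by (simp add: args_update args_nth)
  have "h (act_deriv A n \<mu> as bs) = (\<Oplus>\<^bsub>B\<^esub>k\<in>{..<n}. h (act A n \<mu> (as[k := bs ! k])))"
    unfolding act_deriv_def using args A.act_closed[OF \<mu>]
    by (intro linear_map_finsum[OF A.A.module_axioms B.A.module_axioms alg_map_linear[OF h]]) auto
  also have "\<dots> = act_deriv B n \<mu> (map h as) (map h bs)"
    unfolding act_deriv_def
    using alg_map_act[OF h \<mu> args] args_length[OF bs] B.act_closed[OF \<mu> alg_map_args[OF h args]]
    by (intro B.A.M.finsum_cong') (auto simp: map_update)
  finally show ?thesis .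
qed

lemma alg_derivation_comp_left:
  assumes "operad_algebra R P B" "operad_algebra R P D" "alg_map R P A B f"
    "alg_derivation R P A B f g" "alg_map R P B D h"
  shows "alg_derivation R P A D (\<lambda>a. h (f a)) (\<lambda>a. h (g a))"
  unfolding alg_derivation_def
  using linear_map_compose[OF alg_derivation_linear[OF assms(4)] alg_map_linear[OF assms(5)]]
    alg_map_act_deriv[OF assms(1,2,5)] alg_map_args[OF assms(3)] alg_derivation_args[OF assms(4)]
  by (auto simp: alg_derivation_act[OF assms(4)] comp_def)

lemma alg_derivation_zero:
  assumes "operad_algebra R P B" "alg_map R P A B f"
  shows "alg_derivation R P A B f (\<lambda>a. \<zero>\<^bsub>B\<^esub>)"
proof -
  interpret operad_algebra R P B by (rule assms)
  show ?thesis
    unfolding alg_derivation_def using linear_map_const_zero[OF A.module_axioms]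
    by (auto simp: act_deriv_zero alg_map_args[OF assms(2)] args_length)
qed

text \<open>The differential is additive in its direction, so derivations over one fixed
  \<open>f\<close> can be added. This makes the fibrewise sum of the tangent structure a
  morphism.\<close>

lemma alg_derivation_add:
  assumes "operad_algebra R P B" "alg_map R P A B f" "alg_derivation R P A B f g"
    "alg_derivation R P A B f h"
  shows "alg_derivation R P A B f (\<lambda>a. g a \<oplus>\<^bsub>B\<^esub> h a)"
proof -
  interpret operad_algebra R P B by (rule assms)
  show ?thesis
    unfolding alg_derivation_def
  proof (intro conjI allI ballI)
    fix n \<mu> as assume "\<mu> \<in> ops P n" "as \<in> args A n"
    then show "g (act A n \<mu> as) \<oplus>\<^bsub>B\<^esub> h (act A n \<mu> as) =
        act_deriv B n \<mu> (map f as) (map (\<lambda>a. g a \<oplus>\<^bsub>B\<^esub> h a) as)"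
      using assms(2-4) by (subst act_deriv_map_add)
        (auto simp: alg_map_args alg_derivation_args alg_derivation_act)
  qed (rule linear_map_plus[OF A.module_axioms assms(3,4)[THEN alg_derivation_linear]])
qed

text \<open>These are the components of the identity on a semidirect product; projections, sum, lift
  and flip are assembled from them.\<close>

lemma entry_maps:
  assumes "operad_algebra R P A"
  shows alg_map_entry_0: "alg_map R P (semidirect R P n A) A (entry 0)"
    and alg_derivation_entry: "1 \<le> j \<Longrightarrow> j \<le> n \<Longrightarrow>
      alg_derivation R P (semidirect R P n A) A (entry 0) (entry j)"
proof -
  interpret tuples_algebra R P A n using assms by (rule tuples_algebra.intro)
  show "alg_map R P S A (entry 0)"
    by (simp add: alg_map_def linear_map_entry entry_0_act)
  show "1 \<le> j \<Longrightarrow> j \<le> n \<Longrightarrow> alg_derivation R P S A (entry 0) (entry j)"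
    by (simp add: alg_derivation_def linear_map_entry entry_act)
qed

lemma alg_map_semidirectI:
  assumes "operad_algebra R P Z" and A: "operad_algebra R P A"
    and closed: "\<And>z. z \<in> carrier Z \<Longrightarrow> h z \<in> carrier (semidirect R P n A)"
    and map: "alg_map R P Z A (\<lambda>z. entry 0 (h z))"
    and der: "\<And>j. 1 \<le> j \<Longrightarrow> j \<le> n \<Longrightarrow> alg_derivation R P Z A (\<lambda>z. entry 0 (h z)) (\<lambda>z. entry j (h z))"
  shows "alg_map R P Z (semidirect R P n A) h"
proof -
  interpret tuples_algebra R P A n using A by (rule tuples_algebra.intro)
  interpret Z: operad_algebra R P Z by (rule assms)
  have cases: "j = 0 \<or> 1 \<le> j" for j :: nat by auto
  have "linear_map R Z S h"
  proof (rule linear_map_semidirectI[OF Z.A.module_axioms closed])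
    fix j assume "j \<le> n"
    then show "linear_map R Z A (\<lambda>z. entry j (h z))"
      using cases[of j] alg_map_linear[OF map] alg_derivation_linear[OF der[of j]] by blast
  qed
  moreover have "h (act Z m \<mu> zs) = act S m \<mu> (map h zs)" if \<mu>: "\<mu> \<in> ops P m" and zs: "zs \<in> args Z m"
    for m \<mu> zs
  proof -
    have hs: "map h zs \<in> args S m" using zs by (rule args_map) (rule closed)
    show ?thesis
    proof (rule semidirect_eqI[OF closed[OF Z.act_closed[OF \<mu> zs]] act_semidirect_closed[OF \<mu> hs]])
      fix j assume j: "j \<le> n"
      show "entry j (h (act Z m \<mu> zs)) = entry j (act S m \<mu> (map h zs))"
      proof (cases "j = 0")
        case True
        then show ?thesis
          using alg_map_act[OF map \<mu> zs] by (simp add: entry_0_act[OF \<mu> hs] comp_def)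
      next
        case False
        then have j1: "1 \<le> j" by simp
        show ?thesis
          using alg_derivation_act[OF der[OF j1 j] \<mu> zs] by (simp add: entry_act[OF \<mu> hs j1 j] comp_def)
      qed
    qed
  qed
  ultimately show ?thesis by (simp add: alg_map_def)
qed

section \<open>The structure maps of the tangent structure are morphisms of algebras\<close>

lemma Tuple_in_tangent_alg [simp]:
  "Tuple [a, b] \<in> carrier (tangent_alg R P A) \<longleftrightarrow> a \<in> carrier A \<and> b \<in> carrier A"
  by (auto simp: tangent_alg_def args_def)

lemma in_tangent_alg_iff:
  "x \<in> carrier (tangent_alg R P A) \<longleftrightarrow> (\<exists>a\<in>carrier A. \<exists>b\<in>carrier A. x = Tuple [a, b])"
  by (auto simp: tangent_alg_def carrier_semidirect args_def length_Suc_conv)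

lemma alg_map_tangentI:
  assumes "operad_algebra R P Z" "operad_algebra R P A" "alg_map R P Z A f" "alg_derivation R P Z A f g"
  shows "alg_map R P Z (tangent_alg R P A) (\<lambda>z. Tuple [f z, g z])"
  unfolding tangent_alg_def
proof (rule alg_map_semidirectI)
  fix j :: nat assume "1 \<le> j" "j \<le> 1"
  then have "j = 1" by simp
  then show "alg_derivation R P Z A (\<lambda>z. entry 0 (Tuple [f z, g z])) (\<lambda>z. entry j (Tuple [f z, g z]))"
    using assms(4) by simp
qed (use assms alg_map_closed[OF assms(3)] linear_map_closed[OF alg_derivation_linear[OF assms(4)]]
    in \<open>simp_all add: args_def\<close>)

lemma tangent_entry_maps:
  assumes "operad_algebra R P A"
  shows "alg_map R P (tangent_alg R P A) A (entry 0)"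
    "alg_derivation R P (tangent_alg R P A) A (entry 0) (entry 1)"
  unfolding tangent_alg_def using entry_maps[OF assms] by simp_all

lemma alg_map_zero_section:
  "operad_algebra R P A \<Longrightarrow> alg_map R P A (tangent_alg R P A) (\<lambda>a. Tuple [a, \<zero>\<^bsub>A\<^esub>])"
  by (rule alg_map_tangentI alg_map_id alg_derivation_zero | assumption)+

lemma alg_map_sum:
  assumes "operad_algebra R P A"
  shows "alg_map R P (semidirect R P 2 A) (tangent_alg R P A)
    (\<lambda>x. Tuple [entry 0 x, entry 1 x \<oplus>\<^bsub>A\<^esub> entry 2 x])"
  using assms
  by (intro alg_map_tangentI alg_derivation_add semidirect_operad_algebra entry_maps) auto

lemma alg_map_projection:
  assumes "operad_algebra R P A" "1 \<le> k" "k \<le> n"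
  shows "alg_map R P (semidirect R P n A) (tangent_alg R P A) (\<lambda>x. Tuple [entry 0 x, entry k x])"
  using assms by (intro alg_map_tangentI semidirect_operad_algebra entry_maps) auto

text \<open>Composing the derivation \<open>entry j\<close> with \<open>f\<close> gives a derivation
  over the composite of \<open>f\<close> with \<open>entry 0\<close>. With a single fibre factor
  this is the tangent functor on maps.\<close>

lemma alg_map_semidirect_map:
  assumes A: "operad_algebra R P A" and B: "operad_algebra R P B" and f: "alg_map R P A B f"
  shows "alg_map R P (semidirect R P n A) (semidirect R P n B) (\<lambda>x. Tuple (map (\<lambda>j. f (entry j x)) [0..<Suc n]))"
proof (rule alg_map_semidirectI[OF semidirect_operad_algebra[OF A] B])
  show "Tuple (map (\<lambda>j. f (entry j x)) [0..<Suc n]) \<in> carrier (semidirect R P n B)"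
    if "x \<in> carrier (semidirect R P n A)" for x
    using alg_map_closed[OF f entry_closed[OF that]] by (rule tuple_of_entries)
  have e: "entry j (Tuple (map (\<lambda>j. f (entry j x)) [0..<Suc n])) = f (entry j x)" if "j \<le> n" for j x
    using that by (rule entry_map_upt)
  show "alg_map R P (semidirect R P n A) B (\<lambda>x. entry 0 (Tuple (map (\<lambda>j. f (entry j x)) [0..<Suc n])))"
    unfolding e[OF le0] by (rule alg_map_comp[OF alg_map_entry_0[OF A] f])
  show "alg_derivation R P (semidirect R P n A) B (\<lambda>x. entry 0 (Tuple (map (\<lambda>j. f (entry j x)) [0..<Suc n])))
      (\<lambda>x. entry j (Tuple (map (\<lambda>j. f (entry j x)) [0..<Suc n])))" if "1 \<le> j" "j \<le> n" for j
    unfolding e[OF le0] e[OF that(2)]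
    by (rule alg_derivation_comp_left[OF A B alg_map_entry_0[OF A] alg_derivation_entry[OF A that] f])
qed

lemma alg_map_tangent_map:
  assumes "operad_algebra R P A" "operad_algebra R P B" "alg_map R P A B f"
  shows "alg_map R P (tangent_alg R P A) (tangent_alg R P B) (\<lambda>x. Tuple [f (entry 0 x), f (entry 1 x)])"
  using alg_map_semidirect_map[OF assms, of 1] by (simp add: tangent_alg_def)

text \<open>Entry 0 is a morphism and so commutes with the differential. Entry 1 is a derivation and
  turns each summand into a differential in \<open>A\<close>; the result is the second order sum
  treated by \<open>act_deriv_swap\<close> and \<open>act_deriv_diagonal\<close>.\<close>

lemma entry_act_deriv_tangent:
  assumes A: "operad_algebra R P A" and \<mu>: "\<mu> \<in> ops P m"
    and xs: "xs \<in> args (tangent_alg R P A) m" and ys: "ys \<in> args (tangent_alg R P A) m"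
  shows "entry 0 (act_deriv (tangent_alg R P A) m \<mu> xs ys) =
      act_deriv A m \<mu> (map (entry 0) xs) (map (entry 0) ys)"
    and "entry 1 (act_deriv (tangent_alg R P A) m \<mu> xs ys) = (\<Oplus>\<^bsub>A\<^esub>k\<in>{..<m}.
      act_deriv A m \<mu> ((map (entry 0) xs)[k := map (entry 0) ys ! k])
        ((map (entry 1) xs)[k := map (entry 1) ys ! k]))"
proof -
  interpret A: operad_algebra R P A by (rule A)
  interpret T: operad_algebra R P "tangent_alg R P A" using A by (rule tangent_operad_algebra)
  note maps = tangent_entry_maps[OF A]
  show "entry 0 (act_deriv (tangent_alg R P A) m \<mu> xs ys) =
      act_deriv A m \<mu> (map (entry 0) xs) (map (entry 0) ys)"
    by (rule alg_map_act_deriv[OF tangent_operad_algebra[OF A] A maps(1) \<mu> xs ys])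
  have args: "xs[k := ys ! k] \<in> args (tangent_alg R P A) m" if "k < m" for k
    using that xs ys by (simp add: args_update args_nth)
  have "entry 1 (act_deriv (tangent_alg R P A) m \<mu> xs ys) =
      (\<Oplus>\<^bsub>A\<^esub>k\<in>{..<m}. entry 1 (act (tangent_alg R P A) m \<mu> (xs[k := ys ! k])))"
    unfolding act_deriv_def using args T.act_closed[OF \<mu>]
    by (intro linear_map_finsum[OF T.A.module_axioms A.A.module_axioms alg_derivation_linear[OF maps(2)]]) auto
  also have "\<dots> = (\<Oplus>\<^bsub>A\<^esub>k\<in>{..<m}. act_deriv A m \<mu> ((map (entry 0) xs)[k := map (entry 0) ys ! k])
        ((map (entry 1) xs)[k := map (entry 1) ys ! k]))"
    using alg_derivation_act[OF maps(2) \<mu> args] args_length[OF ys]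
      A.act_deriv_closed[OF \<mu> alg_map_args[OF maps(1) args] alg_derivation_args[OF maps(2) args]]
    by (intro A.A.M.finsum_cong') (auto simp: map_update)
  finally show "entry 1 (act_deriv (tangent_alg R P A) m \<mu> xs ys) = (\<Oplus>\<^bsub>A\<^esub>k\<in>{..<m}.
      act_deriv A m \<mu> ((map (entry 0) xs)[k := map (entry 0) ys ! k])
        ((map (entry 1) xs)[k := map (entry 1) ys ! k]))" .
qed

lemma tangent_eqI:
  "\<lbrakk>x \<in> carrier (tangent_alg R P A); y \<in> carrier (tangent_alg R P A); entry 0 x = entry 0 y;
    entry 1 x = entry 1 y\<rbrakk> \<Longrightarrow> x = y"
  by (auto simp: in_tangent_alg_iff)

lemma linear_map_tangentI:
  assumes "operad_algebra R P A" "module R M" "linear_map R M A f" "linear_map R M A g"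
  shows "linear_map R M (tangent_alg R P A) (\<lambda>x. Tuple [f x, g x])"
  unfolding tangent_alg_def
proof (rule tuples_algebra.linear_map_semidirectI[OF tuples_algebra.intro[OF assms(1)] assms(2)])
  fix j :: nat assume "j \<le> 1"
  then have "j = 0 \<or> j = 1" by auto
  then show "linear_map R M A (\<lambda>x. entry j (Tuple [f x, g x]))" using assms(3,4) by auto
qed (use assms(3,4)[THEN linear_map_closed] in \<open>simp add: args_def\<close>)

text \<open>The first component is the zero section after the projection, hence a morphism. The
  second is a derivation over it: in entry 0 the direction is zero, so the differential vanishes,
  and in entry 1 the second order sum collapses to its diagonal.\<close>

lemma alg_map_lift:
  assumes A: "operad_algebra R P A"
  shows "alg_map R P (tangent_alg R P A) (tangent_alg R P (tangent_alg R P A))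
    (\<lambda>x. Tuple [Tuple [entry 0 x, \<zero>\<^bsub>A\<^esub>], Tuple [\<zero>\<^bsub>A\<^esub>, entry 1 x]])"
proof -
  interpret A: operad_algebra R P A by (rule A)
  let ?T = "tangent_alg R P A"
  note T = tangent_operad_algebra[OF A] and maps = tangent_entry_maps[OF A]
  interpret T: operad_algebra R P ?T by (rule T)
  let ?f = "\<lambda>x. Tuple [entry 0 x, \<zero>\<^bsub>A\<^esub>]" and ?g = "\<lambda>x. Tuple [\<zero>\<^bsub>A\<^esub>, entry 1 x]"
  have f: "alg_map R P ?T ?T ?f"
    by (rule alg_map_comp[OF maps(1) alg_map_zero_section[OF A]])
  have lin: "linear_map R ?T ?T ?g"
    by (rule linear_map_tangentI[OF A T.A.module_axioms linear_map_const_zero[OF A.A.module_axioms]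
          alg_derivation_linear[OF maps(2)]])
  have "?g (act ?T m \<mu> xs) = act_deriv ?T m \<mu> (map ?f xs) (map ?g xs)"
    if \<mu>: "\<mu> \<in> ops P m" and xs: "xs \<in> args ?T m" for m \<mu> xs
  proof -
    have fs: "map ?f xs \<in> args ?T m" and gs: "map ?g xs \<in> args ?T m"
      using alg_map_args[OF f xs] args_map[OF xs linear_map_closed[OF lin]] by auto
    have e: "map (entry 0) (map ?f xs) = map (entry 0) xs" "map (entry 1) (map ?g xs) = map (entry 1) xs"
      "map (entry 1) (map ?f xs) = replicate m \<zero>\<^bsub>A\<^esub>" "map (entry 0) (map ?g xs) = replicate m \<zero>\<^bsub>A\<^esub>"
      "replicate m \<zero>\<^bsub>A\<^esub> = map (\<lambda>x. \<zero>\<^bsub>A\<^esub>) xs"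
      using args_length[OF xs] by (auto intro!: nth_equalityI)
    note e0 = alg_map_args[OF maps(1) xs] and e1 = alg_derivation_args[OF maps(2) xs]
    show ?thesis
    proof (rule tangent_eqI[of _ R P A])
      show "?g (act ?T m \<mu> xs) \<in> carrier ?T"
        by (rule linear_map_closed[OF lin T.act_closed[OF \<mu> xs]])
      show "act_deriv ?T m \<mu> (map ?f xs) (map ?g xs) \<in> carrier ?T"
        by (rule T.act_deriv_closed[OF \<mu> fs gs])
      show "entry 0 (?g (act ?T m \<mu> xs)) = entry 0 (act_deriv ?T m \<mu> (map ?f xs) (map ?g xs))"
        unfolding entry_act_deriv_tangent(1)[OF A \<mu> fs gs] e(1,4)
        using A.act_deriv_zero[OF \<mu> e0 args_length[OF xs]] by (simp add: e(5))
      show "entry 1 (?g (act ?T m \<mu> xs)) = entry 1 (act_deriv ?T m \<mu> (map ?f xs) (map ?g xs))"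
        unfolding entry_act_deriv_tangent(2)[OF A \<mu> fs gs] e(1-4) A.act_deriv_diagonal[OF \<mu> e0 e1]
        using alg_derivation_act[OF maps(2) \<mu> xs] by simp
    qed
  qed
  then have "alg_derivation R P ?T ?T ?f ?g"
    using lin by (simp add: alg_derivation_def)
  then show ?thesis
    by (rule alg_map_tangentI[OF T T f])
qed

text \<open>The first component is the tangent map of the projection, hence a morphism. The second
  satisfies the Leibniz rule over it: entry 0 is the Leibniz rule of the inner
  \<open>entry 1\<close>, and entry 1 is the symmetry of the second differential.\<close>

lemma alg_map_flip:
  assumes A: "operad_algebra R P A"
  shows "alg_map R P (tangent_alg R P (tangent_alg R P A)) (tangent_alg R P (tangent_alg R P A))
    (\<lambda>x. Tuple [Tuple [entry 0 (entry 0 x), entry 0 (entry 1 x)],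
      Tuple [entry 1 (entry 0 x), entry 1 (entry 1 x)]])"
proof -
  interpret A: operad_algebra R P A by (rule A)
  let ?T = "tangent_alg R P A"
  let ?TT = "tangent_alg R P ?T"
  note T = tangent_operad_algebra[OF A] and maps = tangent_entry_maps[OF A]
  note TT = tangent_operad_algebra[OF T] and mapsT = tangent_entry_maps[OF T]
  interpret T: operad_algebra R P ?T by (rule T)
  interpret TT: operad_algebra R P ?TT by (rule TT)
  let ?f = "\<lambda>x. Tuple [entry 0 (entry 0 x), entry 0 (entry 1 x)]"
    and ?g = "\<lambda>x. Tuple [entry 1 (entry 0 x), entry 1 (entry 1 x)]"
  have f: "alg_map R P ?TT ?T ?f"
    by (rule alg_map_tangent_map[OF T A maps(1)])
  note lin01 = alg_map_linear[OF mapsT(1)] alg_derivation_linear[OF mapsT(2)]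
  have lin: "linear_map R ?TT ?T ?g"
    by (rule linear_map_tangentI[OF A TT.A.module_axioms
          lin01[THEN linear_map_compose[OF _ alg_derivation_linear[OF maps(2)]]]])
  have "?g (act ?TT m \<mu> xs) = act_deriv ?T m \<mu> (map ?f xs) (map ?g xs)"
    if \<mu>: "\<mu> \<in> ops P m" and xs: "xs \<in> args ?TT m" for m \<mu> xs
  proof -
    have fs: "map ?f xs \<in> args ?T m" and gs: "map ?g xs \<in> args ?T m"
      using alg_map_args[OF f xs] args_map[OF xs linear_map_closed[OF lin]] by auto
    note x0 = alg_map_args[OF mapsT(1) xs] and x1 = alg_derivation_args[OF mapsT(2) xs]
    note x00 = alg_map_args[OF maps(1) x0] and x01 = alg_map_args[OF maps(1) x1]
      and x10 = alg_derivation_args[OF maps(2) x0] and x11 = alg_derivation_args[OF maps(2) x1]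
    have e: "map (entry 0) (map ?f xs) = map (entry 0) (map (entry 0) xs)"
      "map (entry 1) (map ?f xs) = map (entry 0) (map (entry 1) xs)"
      "map (entry 0) (map ?g xs) = map (entry 1) (map (entry 0) xs)"
      "map (entry 1) (map ?g xs) = map (entry 1) (map (entry 1) xs)"
      by simp_all
    show ?thesis
    proof (rule tangent_eqI[of _ R P A])
      show "?g (act ?TT m \<mu> xs) \<in> carrier ?T"
        by (rule linear_map_closed[OF lin TT.act_closed[OF \<mu> xs]])
      show "act_deriv ?T m \<mu> (map ?f xs) (map ?g xs) \<in> carrier ?T"
        by (rule T.act_deriv_closed[OF \<mu> fs gs])
      have "entry 0 (?g (act ?TT m \<mu> xs)) = entry 1 (entry 0 (act ?TT m \<mu> xs))"
        by simp
      then show "entry 0 (?g (act ?TT m \<mu> xs)) = entry 0 (act_deriv ?T m \<mu> (map ?f xs) (map ?g xs))"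
        unfolding entry_act_deriv_tangent(1)[OF A \<mu> fs gs] e alg_map_act[OF mapsT(1) \<mu> xs]
          alg_derivation_act[OF maps(2) \<mu> x0] .
      have "entry 1 (?g (act ?TT m \<mu> xs)) = entry 1 (entry 1 (act ?TT m \<mu> xs))"
        by simp
      then show "entry 1 (?g (act ?TT m \<mu> xs)) = entry 1 (act_deriv ?T m \<mu> (map ?f xs) (map ?g xs))"
        unfolding entry_act_deriv_tangent(2)[OF A \<mu> fs gs] e alg_derivation_act[OF mapsT(2) \<mu> xs]
          entry_act_deriv_tangent(2)[OF A \<mu> x0 x1] A.act_deriv_swap[OF \<mu> x00 x10 x01 x11] .
    qed
  qed
  then have "alg_derivation R P ?TT ?T ?f ?g"
    using lin by (simp add: alg_derivation_def)
  then show ?thesis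
    by (rule alg_map_tangentI[OF TT T f])
qed

section \<open>Concrete pullbacks of algebras\<close>

lemma Obj_Alg_cat [simp]: "A \<in> Obj (Alg_cat R P) \<longleftrightarrow> operad_algebra R P A"
  by (simp add: Alg_cat_def)

lemma Arr_Alg_cat: "f \<in> Arr (Alg_cat R P) \<longleftrightarrow>
    operad_algebra R P (src f) \<and> operad_algebra R P (tgt f) \<and>
    arrow_map f \<in> alg_hom R P (src f) (tgt f)"
  by (cases f) (simp add: Alg_cat_def)

lemma Dom_Alg_cat [simp]: "f \<in> Arr (Alg_cat R P) \<Longrightarrow> Dom (Alg_cat R P) f = src f"
  by (simp add: Alg_cat_def)

lemma Cod_Alg_cat [simp]: "f \<in> Arr (Alg_cat R P) \<Longrightarrow> Cod (Alg_cat R P) f = tgt f"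
  by (simp add: Alg_cat_def)

lemma in_hom_Alg_cat:
  "in_hom (Alg_cat R P) f A B \<longleftrightarrow> f \<in> Arr (Alg_cat R P) \<and> src f = A \<and> tgt f = B"
  by (auto simp: in_hom_def)

lemma src_algebra: "f \<in> Arr (Alg_cat R P) \<Longrightarrow> operad_algebra R P (src f)"
  and tgt_algebra: "f \<in> Arr (Alg_cat R P) \<Longrightarrow> operad_algebra R P (tgt f)"
  by (simp_all add: Arr_Alg_cat)

lemma arrow_map_closed:
  "f \<in> Arr (Alg_cat R P) \<Longrightarrow> x \<in> carrier (src f) \<Longrightarrow> arrow_map f x \<in> carrier (tgt f)"
  using alg_hom_closed by (auto simp: Arr_Alg_cat)

lemma arrow_alg_map: "f \<in> Arr (Alg_cat R P) \<Longrightarrow> alg_map R P (src f) (tgt f) (arrow_map f)"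
  by (simp add: Arr_Alg_cat alg_hom_iff)

text \<open>Arrows store extensional maps, so agreement on the carrier of the source is equality of
  arrows.\<close>

lemma arrow_eqI:
  assumes "f \<in> Arr (Alg_cat R P)" "g \<in> Arr (Alg_cat R P)" "src f = src g" "tgt f = tgt g"
    and "\<And>x. x \<in> carrier (src f) \<Longrightarrow> arrow_map f x = arrow_map g x"
  shows "f = g"
proof -
  have "arrow_map f \<in> extensional (carrier (src f))" "arrow_map g \<in> extensional (carrier (src f))"
    using assms by (auto simp: Arr_Alg_cat alg_hom_def)
  then have "arrow_map f = arrow_map g"
    by (rule extensionalityI) (rule assms(5))
  then show ?thesis
    using assms(3,4) by (cases f; cases g) simp
qed

lemma restrict_arrow:
  "operad_algebra R P A \<Longrightarrow> operad_algebra R P B \<Longrightarrow> alg_map R P A B h \<Longrightarrow>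
    Arrow A (restrict h (carrier A)) B \<in> Arr (Alg_cat R P)"
  by (simp add: Arr_Alg_cat alg_map_restrict)

lemma Comp_arrow:
  assumes "f \<in> Arr (Alg_cat R P)" "g \<in> Arr (Alg_cat R P)" "tgt f = src g"
  shows "g \<cdot>\<^bsub>Alg_cat R P\<^esub> f \<in> Arr (Alg_cat R P)" "src (g \<cdot>\<^bsub>Alg_cat R P\<^esub> f) = src f"
    "tgt (g \<cdot>\<^bsub>Alg_cat R P\<^esub> f) = tgt g"
    "x \<in> carrier (src f) \<Longrightarrow> arrow_map (g \<cdot>\<^bsub>Alg_cat R P\<^esub> f) x = arrow_map g (arrow_map f x)"
proof -
  have "g \<cdot>\<^bsub>Alg_cat R P\<^esub> f = Arrow (src f) (compose (carrier (src f)) (arrow_map g) (arrow_map f)) (tgt g)"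
    using assms unfolding Alg_cat_def
    by (cases f; cases g) (simp add: Comp_hom_category)
  then show "g \<cdot>\<^bsub>Alg_cat R P\<^esub> f \<in> Arr (Alg_cat R P)" "src (g \<cdot>\<^bsub>Alg_cat R P\<^esub> f) = src f"
    "tgt (g \<cdot>\<^bsub>Alg_cat R P\<^esub> f) = tgt g"
    "x \<in> carrier (src f) \<Longrightarrow> arrow_map (g \<cdot>\<^bsub>Alg_cat R P\<^esub> f) x = arrow_map g (arrow_map f x)"
    using assms alg_hom_comp[of R P "src f" "arrow_map f" "src g" "arrow_map g" "tgt g"]
    by (auto simp: Arr_Alg_cat) (simp add: compose_def)
qed

lemma Ident_arrow:
  assumes "operad_algebra R P A"
  shows "Ident (Alg_cat R P) A \<in> Arr (Alg_cat R P)" "src (Ident (Alg_cat R P) A) = A"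
    "tgt (Ident (Alg_cat R P) A) = A"
    "x \<in> carrier A \<Longrightarrow> arrow_map (Ident (Alg_cat R P) A) x = x"
proof -
  have "Ident (Alg_cat R P) A = Arrow A (\<lambda>a\<in>carrier A. a) A"
    using assms by (simp add: Alg_cat_def)
  then show "Ident (Alg_cat R P) A \<in> Arr (Alg_cat R P)" "src (Ident (Alg_cat R P) A) = A"
    "tgt (Ident (Alg_cat R P) A) = A"
    "x \<in> carrier A \<Longrightarrow> arrow_map (Ident (Alg_cat R P) A) x = x"
    using assms by (simp_all add: Arr_Alg_cat alg_hom_id)
qed

text \<open>A map chosen pointwise is automatically a morphism: after any \<open>\<pi> i\<close>,
  the two sides of each law agree because \<open>f i\<close> is a morphism, and the
  \<open>\<pi> i\<close> are jointly injective. The same injectivity gives uniqueness.\<close>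

lemma unique_lift:
  assumes Q: "operad_algebra R P Q" and Z: "operad_algebra R P Z"
    and \<pi>: "\<And>i. i \<in> I \<Longrightarrow> \<pi> i \<in> Arr (Alg_cat R P) \<and> src (\<pi> i) = Q"
    and f: "\<And>i. i \<in> I \<Longrightarrow> f i \<in> Arr (Alg_cat R P) \<and> src (f i) = Z \<and> tgt (f i) = tgt (\<pi> i)"
    and inj: "\<And>x y. \<lbrakk>x \<in> carrier Q; y \<in> carrier Q; \<And>i. i \<in> I \<Longrightarrow> arrow_map (\<pi> i) x = arrow_map (\<pi> i) y\<rbrakk>
      \<Longrightarrow> x = y"
    and ex: "\<And>z. z \<in> carrier Z \<Longrightarrow> \<exists>x\<in>carrier Q. \<forall>i\<in>I. arrow_map (\<pi> i) x = arrow_map (f i) z"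
  shows "\<exists>!h. in_hom (Alg_cat R P) h Z Q \<and> (\<forall>i\<in>I. \<pi> i \<cdot>\<^bsub>Alg_cat R P\<^esub> h = f i)"
proof -
  interpret Q: operad_algebra R P Q by (rule Q)
  interpret Z: operad_algebra R P Z by (rule Z)
  \<comment> \<open>A choice of preimages, about which nothing more is known than its
    projections.\<close>
  obtain h where h: "h z \<in> carrier Q" and \<pi>h: "i \<in> I \<Longrightarrow> arrow_map (\<pi> i) (h z) = arrow_map (f i) z"
    if "z \<in> carrier Z" for z i
    using ex by metis
  have maps: "alg_map R P Q (tgt (\<pi> i)) (arrow_map (\<pi> i))" "alg_map R P Z (tgt (\<pi> i)) (arrow_map (f i))"
    if "i \<in> I" for i
    using \<pi>[OF that] f[OF that] arrow_alg_map[of "\<pi> i" R P] arrow_alg_map[of "f i" R P] by auto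
  have "linear_map R Z Q h"
  proof (rule linear_mapI[OF h])
    fix x y assume x: "x \<in> carrier Z"
    show "h (x \<oplus>\<^bsub>Z\<^esub> y) = h x \<oplus>\<^bsub>Q\<^esub> h y" if y: "y \<in> carrier Z"
    proof (rule inj)
      fix i assume i: "i \<in> I"
      note lin = maps[OF i, THEN alg_map_linear]
      show "arrow_map (\<pi> i) (h (x \<oplus>\<^bsub>Z\<^esub> y)) = arrow_map (\<pi> i) (h x \<oplus>\<^bsub>Q\<^esub> h y)"
        unfolding linear_map_add[OF lin(1) h[OF x] h[OF y]] \<pi>h[OF x i] \<pi>h[OF y i]
          \<pi>h[OF Z.A.M.a_closed[OF x y] i] by (rule linear_map_add[OF lin(2) x y])
    qed (use h x y in auto)
    show "h (r \<odot>\<^bsub>Z\<^esub> x) = r \<odot>\<^bsub>Q\<^esub> h x" if r: "r \<in> carrier R" for r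
    proof (rule inj)
      fix i assume i: "i \<in> I"
      note lin = maps[OF i, THEN alg_map_linear]
      show "arrow_map (\<pi> i) (h (r \<odot>\<^bsub>Z\<^esub> x)) = arrow_map (\<pi> i) (r \<odot>\<^bsub>Q\<^esub> h x)"
        unfolding linear_map_smult[OF lin(1) r h[OF x]] \<pi>h[OF x i] \<pi>h[OF Z.A.smult_closed[OF r x] i]
        by (rule linear_map_smult[OF lin(2) r x])
    qed (use h x r in auto)
  qed
  moreover have "h (act Z n \<mu> zs) = act Q n \<mu> (map h zs)" if \<mu>: "\<mu> \<in> ops P n" and zs: "zs \<in> args Z n"
    for n \<mu> zs
  proof (rule inj)
    have hs: "map h zs \<in> args Q n" using args_map[OF zs] h by blast
    show "act Q n \<mu> (map h zs) \<in> carrier Q" by (rule Q.act_closed[OF \<mu> hs])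
    fix i assume i: "i \<in> I"
    have map: "map (arrow_map (\<pi> i)) (map h zs) = map (arrow_map (f i)) zs"
      using zs \<pi>h i by (auto simp: args_def)
    show "arrow_map (\<pi> i) (h (act Z n \<mu> zs)) = arrow_map (\<pi> i) (act Q n \<mu> (map h zs))"
      unfolding alg_map_act[OF maps(1)[OF i] \<mu> hs] \<pi>h[OF Z.act_closed[OF \<mu> zs] i]
        alg_map_act[OF maps(2)[OF i] \<mu> zs] map ..
  qed (rule h[OF Z.act_closed[OF \<mu> zs]])
  ultimately have h_map: "alg_map R P Z Q h" by (simp add: alg_map_def)
  let ?h = "Arrow Z (restrict h (carrier Z)) Q"
  have "?h \<in> Arr (Alg_cat R P)" by (rule restrict_arrow[OF Z Q h_map])
  show ?thesis
  proof (rule ex1I[of _ ?h])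
    show "in_hom (Alg_cat R P) ?h Z Q \<and> (\<forall>i\<in>I. \<pi> i \<cdot>\<^bsub>Alg_cat R P\<^esub> ?h = f i)"
    proof (intro conjI ballI)
      show "in_hom (Alg_cat R P) ?h Z Q"
        using \<open>?h \<in> Arr (Alg_cat R P)\<close> by (simp add: in_hom_Alg_cat)
      fix i assume i: "i \<in> I"
      show "\<pi> i \<cdot>\<^bsub>Alg_cat R P\<^esub> ?h = f i"
        using \<pi>[OF i] f[OF i] \<pi>h[OF _ i] Comp_arrow[OF \<open>?h \<in> Arr (Alg_cat R P)\<close>, of "\<pi> i"]
        by (intro arrow_eqI[of _ R P]) auto
    qed
  next
    fix g assume g: "in_hom (Alg_cat R P) g Z Q \<and> (\<forall>i\<in>I. \<pi> i \<cdot>\<^bsub>Alg_cat R P\<^esub> g = f i)"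
    then have g': "g \<in> Arr (Alg_cat R P)" "src g = Z" "tgt g = Q" by (auto simp: in_hom_Alg_cat)
    show "g = ?h"
    proof (rule arrow_eqI[OF g'(1) \<open>?h \<in> Arr (Alg_cat R P)\<close>])
      fix z assume z: "z \<in> carrier (src g)"
      then have z': "z \<in> carrier Z" by (simp add: g')
      have "arrow_map g z = h z"
      proof (rule inj)
        show "arrow_map g z \<in> carrier Q" using arrow_map_closed[OF g'(1) z] by (simp add: g')
        fix i assume i: "i \<in> I"
        have "arrow_map (\<pi> i) (arrow_map g z) = arrow_map (\<pi> i \<cdot>\<^bsub>Alg_cat R P\<^esub> g) z"
          using \<pi>[OF i] g' z by (intro Comp_arrow(4)[symmetric]) auto
        then show "arrow_map (\<pi> i) (arrow_map g z) = arrow_map (\<pi> i) (h z)"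
          using g i \<pi>h[OF z' i] by simp
      qed (rule h[OF z'])
      then show "arrow_map g z = arrow_map ?h z" using z' by simp
    qed (simp_all add: g')
  qed
qed

definition alg_powers ::
  "('r, 'x) ring_scheme \<Rightarrow> ('r, 'p) operad \<Rightarrow> nat \<Rightarrow> ('r, 'u, 'p) talg_arrow \<Rightarrow> ('r, 'u, 'p) talg \<Rightarrow>
    (nat \<Rightarrow> ('r, 'u, 'p) talg_arrow) \<Rightarrow> bool" where
  "alg_powers R P n q Q \<pi> \<longleftrightarrow> q \<in> Arr (Alg_cat R P) \<and> operad_algebra R P Q \<and>
     (\<forall>k\<in>{1..n}. \<pi> k \<in> Arr (Alg_cat R P) \<and> src (\<pi> k) = Q \<and> tgt (\<pi> k) = src q \<and>
        (\<forall>x\<in>carrier Q. arrow_map q (arrow_map (\<pi> k) x) = arrow_map q (arrow_map (\<pi> 1) x))) \<and>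
     (\<forall>x\<in>carrier Q. \<forall>y\<in>carrier Q.
        (\<forall>k\<in>{1..n}. arrow_map (\<pi> k) x = arrow_map (\<pi> k) y) \<longrightarrow> x = y) \<and>
     (\<forall>e. (\<forall>k\<in>{1..n}. e k \<in> carrier (src q) \<and> arrow_map q (e k) = arrow_map q (e 1)) \<longrightarrow>
        (\<exists>x\<in>carrier Q. \<forall>k\<in>{1..n}. arrow_map (\<pi> k) x = e k))"

lemma alg_powersD:
  assumes "alg_powers R P n q Q \<pi>"
  shows "q \<in> Arr (Alg_cat R P)" "operad_algebra R P Q"
    "k \<in> {1..n} \<Longrightarrow> \<pi> k \<in> Arr (Alg_cat R P) \<and> src (\<pi> k) = Q \<and> tgt (\<pi> k) = src q"
    "k \<in> {1..n} \<Longrightarrow> x \<in> carrier Q \<Longrightarrow> arrow_map q (arrow_map (\<pi> k) x) = arrow_map q (arrow_map (\<pi> 1) x)"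
    "\<lbrakk>x \<in> carrier Q; y \<in> carrier Q; \<And>k. k \<in> {1..n} \<Longrightarrow> arrow_map (\<pi> k) x = arrow_map (\<pi> k) y\<rbrakk> \<Longrightarrow> x = y"
    "\<lbrakk>\<And>k. k \<in> {1..n} \<Longrightarrow> e k \<in> carrier (src q); \<And>k. k \<in> {1..n} \<Longrightarrow> arrow_map q (e k) = arrow_map q (e 1)\<rbrakk>
      \<Longrightarrow> \<exists>x\<in>carrier Q. \<forall>k\<in>{1..n}. arrow_map (\<pi> k) x = e k"
  using assms unfolding alg_powers_def by blast+

lemma alg_powersI:
  assumes "q \<in> Arr (Alg_cat R P)" "operad_algebra R P Q"
    "\<And>k. k \<in> {1..n} \<Longrightarrow> \<pi> k \<in> Arr (Alg_cat R P) \<and> src (\<pi> k) = Q \<and> tgt (\<pi> k) = src q"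
    "\<And>k x. k \<in> {1..n} \<Longrightarrow> x \<in> carrier Q \<Longrightarrow>
      arrow_map q (arrow_map (\<pi> k) x) = arrow_map q (arrow_map (\<pi> 1) x)"
    "\<And>x y. \<lbrakk>x \<in> carrier Q; y \<in> carrier Q; \<And>k. k \<in> {1..n} \<Longrightarrow> arrow_map (\<pi> k) x = arrow_map (\<pi> k) y\<rbrakk>
      \<Longrightarrow> x = y"
    "\<And>e. \<lbrakk>\<And>k. k \<in> {1..n} \<Longrightarrow> e k \<in> carrier (src q);
      \<And>k. k \<in> {1..n} \<Longrightarrow> arrow_map q (e k) = arrow_map q (e 1)\<rbrakk>
      \<Longrightarrow> \<exists>x\<in>carrier Q. \<forall>k\<in>{1..n}. arrow_map (\<pi> k) x = e k"
  shows "alg_powers R P n q Q \<pi>"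
  unfolding alg_powers_def using assms by blast

lemma nfold_pullbackI:
  assumes "q \<in> Arr C" "Q \<in> Obj C"
    and "\<And>k. k \<in> {1..n} \<Longrightarrow> in_hom C (\<pi> k) Q (Dom C q)"
    and "\<And>k. k \<in> {1..n} \<Longrightarrow> q \<cdot>\<^bsub>C\<^esub> \<pi> k = q \<cdot>\<^bsub>C\<^esub> \<pi> 1"
    and "\<And>Z f. \<lbrakk>\<And>k. k \<in> {1..n} \<Longrightarrow> in_hom C (f k) Z (Dom C q);
      \<And>k. k \<in> {1..n} \<Longrightarrow> q \<cdot>\<^bsub>C\<^esub> f k = q \<cdot>\<^bsub>C\<^esub> f 1\<rbrakk> \<Longrightarrow>
      \<exists>!h. in_hom C h Z Q \<and> (\<forall>k\<in>{1..n}. \<pi> k \<cdot>\<^bsub>C\<^esub> h = f k)"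
  shows "nfold_pullback C n q Q \<pi>"
  unfolding nfold_pullback_def
proof (intro conjI ballI allI impI)
  fix Z f assume "\<forall>k\<in>{1..n}. in_hom C (f k) Z (Dom C q) \<and> q \<cdot>\<^bsub>C\<^esub> f k = q \<cdot>\<^bsub>C\<^esub> f 1"
  then show "\<exists>!h. in_hom C h Z Q \<and> (\<forall>k\<in>{1..n}. \<pi> k \<cdot>\<^bsub>C\<^esub> h = f k)"
    by (intro assms(5)) blast+
qed (fact assms(1-4))+

lemma alg_powers_nfold_pullback:
  assumes pow: "alg_powers R P n q Q \<pi>" and n: "1 \<le> n"
  shows "nfold_pullback (Alg_cat R P) n q Q \<pi>"
proof -
  note D = alg_powersD[OF pow]
  have 1: "1 \<in> {1..n}" using n by simp
  show ?thesis
  proof (rule nfold_pullbackI)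
    fix k assume k: "k \<in> {1..n}"
    show "in_hom (Alg_cat R P) (\<pi> k) Q (Dom (Alg_cat R P) q)"
      using D(1) D(3)[OF k] by (simp add: in_hom_Alg_cat)
    show "q \<cdot>\<^bsub>Alg_cat R P\<^esub> \<pi> k = q \<cdot>\<^bsub>Alg_cat R P\<^esub> \<pi> 1"
      using D(1) D(3)[OF k] D(3)[OF 1] D(4)[OF k]
      by (intro arrow_eqI[of _ R P]) (simp_all add: Comp_arrow del: One_nat_def)
  next
    fix Z f
    assume f: "in_hom (Alg_cat R P) (f k) Z (Dom (Alg_cat R P) q)"
      "q \<cdot>\<^bsub>Alg_cat R P\<^esub> f k = q \<cdot>\<^bsub>Alg_cat R P\<^esub> f 1" if "k \<in> {1..n}" for k
    have f': "f k \<in> Arr (Alg_cat R P)" "src (f k) = Z" "tgt (f k) = src q" if "k \<in> {1..n}" for k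
      using f(1)[OF that] D(1) by (simp_all add: in_hom_Alg_cat)
    have eq: "arrow_map q (arrow_map (f k) z) = arrow_map q (arrow_map (f 1) z)"
      if "k \<in> {1..n}" "z \<in> carrier Z" for k z
      using arg_cong[OF f(2)[OF that(1)], of "\<lambda>h. arrow_map h z"] f'[OF that(1)] f'[OF 1] D(1) that(2)
      by (simp add: Comp_arrow del: One_nat_def)
    show "\<exists>!h. in_hom (Alg_cat R P) h Z Q \<and> (\<forall>k\<in>{1..n}. \<pi> k \<cdot>\<^bsub>Alg_cat R P\<^esub> h = f k)"
    proof (rule unique_lift[OF D(2)])
      \<comment> \<open>Index 1 exists since \<open>1 \<le> n\<close>: it is the arrow
        \<open>f 1\<close> that certifies its source \<open>Z\<close> to be an algebra.\<close>
      show "operad_algebra R P Z" using src_algebra[OF f'(1)[OF 1]] unfolding f'(2)[OF 1] .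
      show "\<exists>x\<in>carrier Q. \<forall>k\<in>{1..n}. arrow_map (\<pi> k) x = arrow_map (f k) z" if "z \<in> carrier Z" for z
      proof (rule D(6))
        show "arrow_map (f k) z \<in> carrier (src q)" if k: "k \<in> {1..n}" for k
          using arrow_map_closed[OF f'(1)[OF k], of z] f'(2,3)[OF k] \<open>z \<in> carrier Z\<close> by simp
        show "arrow_map q (arrow_map (f k) z) = arrow_map q (arrow_map (f 1) z)" if "k \<in> {1..n}" for k
          by (rule eq[OF that \<open>z \<in> carrier Z\<close>])
      qed
      show "\<pi> k \<in> Arr (Alg_cat R P) \<and> src (\<pi> k) = Q" if "k \<in> {1..n}" for k
        using D(3)[OF that] by simp
      show "f k \<in> Arr (Alg_cat R P) \<and> src (f k) = Z \<and> tgt (f k) = tgt (\<pi> k)" if "k \<in> {1..n}" for k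
        using D(3)[OF that] f'[OF that] by simp
    qed (rule D(5))
  qed (use D(1,2) in simp_all)
qed

definition alg_pullback ::
  "('r, 'x) ring_scheme \<Rightarrow> ('r, 'p) operad \<Rightarrow> ('r, 'u, 'p) talg_arrow \<Rightarrow> ('r, 'u, 'p) talg_arrow \<Rightarrow>
    ('r, 'u, 'p) talg_arrow \<Rightarrow> ('r, 'u, 'p) talg_arrow \<Rightarrow> bool" where
  "alg_pullback R P f g a b \<longleftrightarrow> {f, g, a, b} \<subseteq> Arr (Alg_cat R P) \<and>
     tgt f = tgt g \<and> src a = src b \<and> tgt a = src f \<and> tgt b = src g \<and>
     (\<forall>w\<in>carrier (src a). arrow_map f (arrow_map a w) = arrow_map g (arrow_map b w)) \<and>
     (\<forall>x\<in>carrier (src f). \<forall>y\<in>carrier (src g). arrow_map f x = arrow_map g y \<longrightarrow>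
        (\<exists>!w. w \<in> carrier (src a) \<and> arrow_map a w = x \<and> arrow_map b w = y))"

lemma alg_pullbackD:
  assumes "alg_pullback R P f g a b"
  shows "f \<in> Arr (Alg_cat R P)" "g \<in> Arr (Alg_cat R P)" "a \<in> Arr (Alg_cat R P)"
    "b \<in> Arr (Alg_cat R P)" "tgt f = tgt g" "src b = src a" "tgt a = src f" "tgt b = src g"
    "w \<in> carrier (src a) \<Longrightarrow> arrow_map f (arrow_map a w) = arrow_map g (arrow_map b w)"
    "\<lbrakk>x \<in> carrier (src f); y \<in> carrier (src g); arrow_map f x = arrow_map g y\<rbrakk> \<Longrightarrow>
      \<exists>!w. w \<in> carrier (src a) \<and> arrow_map a w = x \<and> arrow_map b w = y"
  using assms unfolding alg_pullback_def
  by (blast, blast, blast, blast, metis, metis, metis, metis, blast, blast)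

lemma alg_pullback_is_pullback:
  assumes "alg_pullback R P f g a b"
  shows "is_pullback (Alg_cat R P) f g a b"
proof -
  note arr = alg_pullbackD(1-8)[OF assms] and comm = alg_pullbackD(9)[OF assms]
    and ex1 = alg_pullbackD(10)[OF assms]
  have "\<exists>!h. in_hom (Alg_cat R P) h Z (src a) \<and> a \<cdot>\<^bsub>Alg_cat R P\<^esub> h = u \<and> b \<cdot>\<^bsub>Alg_cat R P\<^esub> h = v"
    if "in_hom (Alg_cat R P) u Z (src f)" "in_hom (Alg_cat R P) v Z (src g)"
      "f \<cdot>\<^bsub>Alg_cat R P\<^esub> u = g \<cdot>\<^bsub>Alg_cat R P\<^esub> v" for Z u v
  proof -
    have uv: "u \<in> Arr (Alg_cat R P)" "src u = Z" "tgt u = src f" "v \<in> Arr (Alg_cat R P)" "src v = Z"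
      "tgt v = src g"
      using that(1,2) by (auto simp: in_hom_Alg_cat)
    have eq: "arrow_map f (arrow_map u z) = arrow_map g (arrow_map v z)" if "z \<in> carrier Z" for z
      using arg_cong[OF \<open>f \<cdot>\<^bsub>Alg_cat R P\<^esub> u = g \<cdot>\<^bsub>Alg_cat R P\<^esub> v\<close>, of "\<lambda>h. arrow_map h z"] uv arr that
      by (simp add: Comp_arrow)
    have ball_bool: "(\<forall>i\<in>UNIV. p i) \<longleftrightarrow> p True \<and> p False" for p
      by (metis (full_types) UNIV_I)
    \<comment> \<open>The two legs are indexed by the booleans, so that the square becomes an
      instance of \<open>unique_lift\<close>.\<close>
    have "\<exists>!h. in_hom (Alg_cat R P) h Z (src a) \<and>
        (\<forall>i\<in>UNIV. (if i then a else b) \<cdot>\<^bsub>Alg_cat R P\<^esub> h = (if i then u else v))"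
    proof (rule unique_lift)
      show "operad_algebra R P (src a)" "operad_algebra R P Z"
        using src_algebra[OF arr(3)] src_algebra[OF uv(1)] uv by auto
      show "(if i then a else b) \<in> Arr (Alg_cat R P) \<and> src (if i then a else b) = src a" for i
        using arr by simp
      show "(if i then u else v) \<in> Arr (Alg_cat R P) \<and> src (if i then u else v) = Z \<and>
          tgt (if i then u else v) = tgt (if i then a else b)" for i
        using uv arr by simp
      show "x = y" if "x \<in> carrier (src a)" "y \<in> carrier (src a)"
        "\<And>i. i \<in> UNIV \<Longrightarrow> arrow_map (if i then a else b) x = arrow_map (if i then a else b) y" for x y
      proof -
        have "arrow_map a x = arrow_map a y" "arrow_map b x = arrow_map b y"
          using that(3)[of True] that(3)[of False] by auto
        then show ?thesis
          using ex1[of "arrow_map a y" "arrow_map b y"] comm[OF that(2)] that(1,2)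
            arrow_map_closed[OF arr(3) that(2)] arrow_map_closed[OF arr(4), of y] arr(6-8) by auto
      qed
      show "\<exists>x\<in>carrier (src a). \<forall>i\<in>UNIV. arrow_map (if i then a else b) x = arrow_map (if i then u else v) z"
        if z: "z \<in> carrier Z" for z
      proof -
        have "\<exists>w. w \<in> carrier (src a) \<and> arrow_map a w = arrow_map u z \<and> arrow_map b w = arrow_map v z"
          using ex1[OF _ _ eq[OF z]] arrow_map_closed[OF uv(1), of z] arrow_map_closed[OF uv(4), of z] uv z
          by (auto dest: ex1_implies_ex)
        then show ?thesis by auto
      qed
    qed
    then show ?thesis unfolding ball_bool by simp
  qed
  moreover have "f \<cdot>\<^bsub>Alg_cat R P\<^esub> a = g \<cdot>\<^bsub>Alg_cat R P\<^esub> b"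
    using arr comm by (intro arrow_eqI[of _ R P]) (simp_all add: Comp_arrow)
  ultimately show ?thesis
    unfolding is_pullback_def using arr by (auto simp: in_hom_Alg_cat intro!: exI[of _ "src a"])
qed

section \<open>The algebraic tangent structure\<close>

locale operad_algebras =
  fixes R :: "('r, 'x) ring_scheme" and P :: "('r, 'p) operad"
begin

abbreviation "C \<equiv> Alg_cat R P"
abbreviation "is_alg \<equiv> operad_algebra R P"
abbreviation "T \<equiv> tangent_alg R P"
abbreviation "\<X> \<equiv> alg_tangent R P"
abbreviation "TF \<equiv> tanT (alg_tangent R P)"
abbreviation "S \<equiv> semidirect R P"
abbreviation "pair A \<equiv> pb_tuple C (tanN \<X> 2 A) (tanpr \<X> 2 A)"
abbreviation "tpair A \<equiv> pb_tuple C (fobj TF (tanN \<X> 2 A)) (\<lambda>k. fmor TF (tanpr \<X> 2 A k))"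

section \<open>The structure arrows and their values on elements\<close>

lemma fobj_TF: "is_alg A \<Longrightarrow> fobj TF A = T A"
  by (simp add: alg_tangent_def Let_def)

lemma TF_arrow:
  assumes "f \<in> Arr C"
  shows "fmor TF f \<in> Arr C" "src (fmor TF f) = T (src f)" "tgt (fmor TF f) = T (tgt f)"
    "x \<in> carrier (T (src f)) \<Longrightarrow>
      arrow_map (fmor TF f) x = Tuple [arrow_map f (entry 0 x), arrow_map f (entry 1 x)]"
proof -
  have eq: "fmor TF f = Arrow (T (src f))
      (\<lambda>x\<in>carrier (T (src f)). Tuple [arrow_map f (entry 0 x), arrow_map f (entry 1 x)]) (T (tgt f))"
    using assms by (simp add: alg_tangent_def Let_def tangent_map_alg_def)
  show "fmor TF f \<in> Arr C"
    unfolding eq using src_algebra[OF assms] tgt_algebra[OF assms] arrow_alg_map[OF assms]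
    by (intro restrict_arrow tangent_operad_algebra alg_map_tangent_map)
  show "src (fmor TF f) = T (src f)" "tgt (fmor TF f) = T (tgt f)"
    "x \<in> carrier (T (src f)) \<Longrightarrow>
      arrow_map (fmor TF f) x = Tuple [arrow_map f (entry 0 x), arrow_map f (entry 1 x)]"
    by (simp_all add: eq)
qed

lemma tanN_alg: "is_alg A \<Longrightarrow> 1 \<le> n \<Longrightarrow> tanN \<X> n A = S n A"
  by (simp add: alg_tangent_def Let_def)

lemma tanp_arrow:
  assumes "is_alg A"
  shows "tanp \<X> A \<in> Arr C" "src (tanp \<X> A) = T A" "tgt (tanp \<X> A) = A"
    "x \<in> carrier (T A) \<Longrightarrow> arrow_map (tanp \<X> A) x = entry 0 x"
proof -
  have eq: "tanp \<X> A = Arrow (T A) (restrict (entry 0) (carrier (T A))) A"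
    using assms by (simp add: alg_tangent_def Let_def)
  show "tanp \<X> A \<in> Arr C"
    unfolding eq by (intro restrict_arrow tangent_operad_algebra tangent_entry_maps assms)
qed (use assms in \<open>simp_all add: alg_tangent_def Let_def\<close>)

lemma tanz_arrow:
  assumes "is_alg A"
  shows "tanz \<X> A \<in> Arr C" "src (tanz \<X> A) = A" "tgt (tanz \<X> A) = T A"
    "a \<in> carrier A \<Longrightarrow> arrow_map (tanz \<X> A) a = Tuple [a, \<zero>\<^bsub>A\<^esub>]"
proof -
  have eq: "tanz \<X> A = Arrow A (restrict (\<lambda>a. Tuple [a, \<zero>\<^bsub>A\<^esub>]) (carrier A)) (T A)"
    using assms by (simp add: alg_tangent_def Let_def)
  show "tanz \<X> A \<in> Arr C"
    unfolding eq by (intro restrict_arrow tangent_operad_algebra alg_map_zero_section assms)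
qed (use assms in \<open>simp_all add: alg_tangent_def Let_def\<close>)

lemma tans_arrow:
  assumes "is_alg A"
  shows "tans \<X> A \<in> Arr C" "src (tans \<X> A) = S 2 A" "tgt (tans \<X> A) = T A"
    "x \<in> carrier (S 2 A) \<Longrightarrow>
      arrow_map (tans \<X> A) x = Tuple [entry 0 x, entry 1 x \<oplus>\<^bsub>A\<^esub> entry 2 x]"
proof -
  have eq: "tans \<X> A = Arrow (S 2 A)
      (restrict (\<lambda>x. Tuple [entry 0 x, entry 1 x \<oplus>\<^bsub>A\<^esub> entry 2 x]) (carrier (S 2 A))) (T A)"
    using assms by (simp add: alg_tangent_def Let_def)
  show "tans \<X> A \<in> Arr C"
    unfolding eq
    by (intro restrict_arrow tangent_operad_algebra semidirect_operad_algebra alg_map_sum assms)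
qed (use assms in \<open>simp_all add: alg_tangent_def Let_def\<close>)

lemma tanpr_arrow:
  assumes "is_alg A" "1 \<le> k" "k \<le> n"
  shows "tanpr \<X> n A k \<in> Arr C" "src (tanpr \<X> n A k) = S n A" "tgt (tanpr \<X> n A k) = T A"
    "x \<in> carrier (S n A) \<Longrightarrow> arrow_map (tanpr \<X> n A k) x = Tuple [entry 0 x, entry k x]"
proof -
  have eq: "tanpr \<X> n A k = Arrow (S n A)
      (restrict (\<lambda>x. Tuple [entry 0 x, entry k x]) (carrier (S n A))) (T A)"
    using assms by (simp add: alg_tangent_def Let_def)
  show "tanpr \<X> n A k \<in> Arr C"
    unfolding eq
    by (intro restrict_arrow tangent_operad_algebra semidirect_operad_algebra alg_map_projection assms)
qed (use assms in \<open>simp_all add: alg_tangent_def Let_def\<close>)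

lemma tanl_arrow:
  assumes "is_alg A"
  shows "tanl \<X> A \<in> Arr C" "src (tanl \<X> A) = T A" "tgt (tanl \<X> A) = T (T A)"
    "x \<in> carrier (T A) \<Longrightarrow>
      arrow_map (tanl \<X> A) x = Tuple [Tuple [entry 0 x, \<zero>\<^bsub>A\<^esub>], Tuple [\<zero>\<^bsub>A\<^esub>, entry 1 x]]"
proof -
  have eq: "tanl \<X> A = Arrow (T A)
      (restrict (\<lambda>x. Tuple [Tuple [entry 0 x, \<zero>\<^bsub>A\<^esub>], Tuple [\<zero>\<^bsub>A\<^esub>, entry 1 x]]) (carrier (T A))) (T (T A))"
    using assms by (simp add: alg_tangent_def Let_def)
  show "tanl \<X> A \<in> Arr C"
    unfolding eq by (intro restrict_arrow tangent_operad_algebra alg_map_lift assms)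
qed (use assms in \<open>simp_all add: alg_tangent_def Let_def\<close>)

lemma tanc_arrow:
  assumes "is_alg A"
  shows "tanc \<X> A \<in> Arr C" "src (tanc \<X> A) = T (T A)" "tgt (tanc \<X> A) = T (T A)"
    "x \<in> carrier (T (T A)) \<Longrightarrow> arrow_map (tanc \<X> A) x =
      Tuple [Tuple [entry 0 (entry 0 x), entry 0 (entry 1 x)],
        Tuple [entry 1 (entry 0 x), entry 1 (entry 1 x)]]"
proof -
  have eq: "tanc \<X> A = Arrow (T (T A)) (restrict (\<lambda>x. Tuple [Tuple [entry 0 (entry 0 x), entry 0 (entry 1 x)],
        Tuple [entry 1 (entry 0 x), entry 1 (entry 1 x)]]) (carrier (T (T A)))) (T (T A))"
    using assms by (simp add: alg_tangent_def Let_def)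
  show "tanc \<X> A \<in> Arr C"
    unfolding eq by (intro restrict_arrow tangent_operad_algebra alg_map_flip assms)
qed (use assms in \<open>simp_all add: alg_tangent_def Let_def\<close>)

text \<open>Once \<open>arrow_eqI\<close> has reduced an equation of arrows to elements, these rules
  evaluate both sides, and an identity between explicit tuples remains.\<close>

lemmas arrow_simps = Comp_arrow Ident_arrow TF_arrow tanp_arrow tanz_arrow tans_arrow tanpr_arrow
  tanl_arrow tanc_arrow fobj_TF tangent_operad_algebra semidirect_operad_algebra

lemma functor_TF: "is_functor C C TF"
proof (rule is_functorI)
  show "fobj TF \<in> extensional (Obj C)" "fmor TF \<in> extensional (Arr C)"
    by (simp_all add: alg_tangent_def Let_def)
  fix f g A B D assume f: "in_hom C f A B"
  then show "in_hom C (fmor TF f) (fobj TF A) (fobj TF B)"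
    using src_algebra[of f R P] tgt_algebra[of f R P] by (auto simp: in_hom_Alg_cat arrow_simps)
  assume "in_hom C g B D"
  then show "fmor TF (g \<cdot>\<^bsub>C\<^esub> f) = fmor TF g \<cdot>\<^bsub>C\<^esub> fmor TF f"
    using f arrow_map_closed[of f R P]
    by (intro arrow_eqI[of _ R P]) (auto simp: in_hom_Alg_cat arrow_simps in_tangent_alg_iff)
next
  fix A assume "A \<in> Obj C"
  then show "fobj TF A \<in> Obj C" "fmor TF (Ident C A) = Ident C (fobj TF A)"
    by (auto simp: arrow_simps in_tangent_alg_iff intro!: arrow_eqI[of _ R P])
qed (rule category_Alg_cat)+

section \<open>Fibre powers and pullbacks under the tangent functor\<close>

lemma alg_powers_TF:
  assumes pow: "alg_powers R P n q Q \<pi>" and n: "1 \<le> n"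
  shows "alg_powers R P n (fmor TF q) (T Q) (\<lambda>k. fmor TF (\<pi> k))"
proof -
  note D = alg_powersD[OF pow]
  have 1: "1 \<in> {1..n}" using n by simp
  have \<pi>: "\<pi> k \<in> Arr C" "src (\<pi> k) = Q" "tgt (\<pi> k) = src q" if "k \<in> {1..n}" for k
    using D(3)[OF that] by auto
  have cl: "arrow_map (\<pi> k) a \<in> carrier (src q)" if "k \<in> {1..n}" "a \<in> carrier Q" for k a
    using arrow_map_closed[OF \<pi>(1)[OF that(1)]] \<pi>[OF that(1)] that(2) by simp
  have T\<pi>: "arrow_map (fmor TF (\<pi> k)) (Tuple [a, b]) = Tuple [arrow_map (\<pi> k) a, arrow_map (\<pi> k) b]"
    if "k \<in> {1..n}" "a \<in> carrier Q" "b \<in> carrier Q" for k a b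
    using TF_arrow(4)[OF \<pi>(1)[OF that(1)], of "Tuple [a, b]"] \<pi>(2)[OF that(1)] that(2,3) by simp
  have Tq: "arrow_map (fmor TF q) (Tuple [a, b]) = Tuple [arrow_map q a, arrow_map q b]"
    if "a \<in> carrier (src q)" "b \<in> carrier (src q)" for a b
    using TF_arrow(4)[OF D(1), of "Tuple [a, b]"] that by simp
  show ?thesis
  proof (rule alg_powersI)
    show "fmor TF q \<in> Arr C" "is_alg (T Q)"
      using D(1,2) by (simp_all add: arrow_simps)
    show "fmor TF (\<pi> k) \<in> Arr C \<and> src (fmor TF (\<pi> k)) = T Q \<and> tgt (fmor TF (\<pi> k)) = src (fmor TF q)"
      if "k \<in> {1..n}" for k
      using \<pi>[OF that] D(1) by (simp add: arrow_simps)
    show "arrow_map (fmor TF q) (arrow_map (fmor TF (\<pi> k)) x) =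
        arrow_map (fmor TF q) (arrow_map (fmor TF (\<pi> 1)) x)" if k: "k \<in> {1..n}" and x: "x \<in> carrier (T Q)" for k x
    proof -
      obtain a b where ab: "a \<in> carrier Q" "b \<in> carrier Q" "x = Tuple [a, b]"
        using x by (auto simp: in_tangent_alg_iff)
      show ?thesis
        unfolding ab(3) T\<pi>[OF k ab(1,2)] T\<pi>[OF 1 ab(1,2)] Tq[OF cl[OF k ab(1)] cl[OF k ab(2)]]
          Tq[OF cl[OF 1 ab(1)] cl[OF 1 ab(2)]] D(4)[OF k ab(1)] D(4)[OF k ab(2)] ..
    qed
    show "x = y" if x: "x \<in> carrier (T Q)" and y: "y \<in> carrier (T Q)"
      and eq: "\<And>k. k \<in> {1..n} \<Longrightarrow> arrow_map (fmor TF (\<pi> k)) x = arrow_map (fmor TF (\<pi> k)) y" for x y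
    proof -
      obtain a b where ab: "a \<in> carrier Q" "b \<in> carrier Q" "x = Tuple [a, b]"
        using x by (auto simp: in_tangent_alg_iff)
      obtain c d where cd: "c \<in> carrier Q" "d \<in> carrier Q" "y = Tuple [c, d]"
        using y by (auto simp: in_tangent_alg_iff)
      have "a = c"
      proof (rule D(5)[OF ab(1) cd(1)])
        show "arrow_map (\<pi> k) a = arrow_map (\<pi> k) c" if "k \<in> {1..n}" for k
          using eq[OF that] unfolding ab(3) cd(3) T\<pi>[OF that ab(1,2)] T\<pi>[OF that cd(1,2)] by simp
      qed
      moreover have "b = d"
      proof (rule D(5)[OF ab(2) cd(2)])
        show "arrow_map (\<pi> k) b = arrow_map (\<pi> k) d" if "k \<in> {1..n}" for k
          using eq[OF that] unfolding ab(3) cd(3) T\<pi>[OF that ab(1,2)] T\<pi>[OF that cd(1,2)] by simp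
      qed
      ultimately show ?thesis by (simp add: ab cd)
    qed
    show "\<exists>x\<in>carrier (T Q). \<forall>k\<in>{1..n}. arrow_map (fmor TF (\<pi> k)) x = e k"
      if e: "\<And>k. k \<in> {1..n} \<Longrightarrow> e k \<in> carrier (src (fmor TF q))"
        and eq: "\<And>k. k \<in> {1..n} \<Longrightarrow> arrow_map (fmor TF q) (e k) = arrow_map (fmor TF q) (e 1)" for e
    proof -
      have e': "e k \<in> carrier (T (src q))" if "k \<in> {1..n}" for k
        using e[OF that] by (simp add: TF_arrow[OF D(1)])
      have ek: "entry 0 (e k) \<in> carrier (src q)" "entry 1 (e k) \<in> carrier (src q)"
        "e k = Tuple [entry 0 (e k), entry 1 (e k)]" if "k \<in> {1..n}" for k
        using e'[OF that] by (auto simp: in_tangent_alg_iff)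
      have eq': "arrow_map q (entry 0 (e k)) = arrow_map q (entry 0 (e 1))"
        "arrow_map q (entry 1 (e k)) = arrow_map q (entry 1 (e 1))" if "k \<in> {1..n}" for k
        using eq[OF that] unfolding TF_arrow(4)[OF D(1) e'[OF that]] TF_arrow(4)[OF D(1) e'[OF 1]]
        by simp_all
      \<comment> \<open>A compatible family of pairs consists of two compatible families, which are
        lifted separately; the two lifts form the required pair.\<close>
      obtain x where x: "x \<in> carrier Q" "\<forall>k\<in>{1..n}. arrow_map (\<pi> k) x = entry 0 (e k)"
        using D(6)[of "\<lambda>k. entry 0 (e k)", OF ek(1) eq'(1)] by blast
      obtain y where y: "y \<in> carrier Q" "\<forall>k\<in>{1..n}. arrow_map (\<pi> k) y = entry 1 (e k)"
        using D(6)[of "\<lambda>k. entry 1 (e k)", OF ek(2) eq'(2)] by blast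
      have "arrow_map (fmor TF (\<pi> k)) (Tuple [x, y]) = e k" if "k \<in> {1..n}" for k
        unfolding T\<pi>[OF that x(1) y(1)] using x(2) y(2) that ek(3)[OF that] by simp
      then show ?thesis using x(1) y(1) by (intro bexI[of _ "Tuple [x, y]"]) auto
    qed
  qed
qed

lemma alg_pullback_TF:
  assumes "alg_pullback R P f g a b"
  shows "alg_pullback R P (fmor TF f) (fmor TF g) (fmor TF a) (fmor TF b)"
proof -
  note arr = alg_pullbackD(1-8)[OF assms] and comm = alg_pullbackD(9)[OF assms]
    and ex1 = alg_pullbackD(10)[OF assms]
  have ac: "arrow_map a w \<in> carrier (src f)" and bc: "arrow_map b w \<in> carrier (src g)"
    if "w \<in> carrier (src a)" for w
    using arrow_map_closed[OF arr(3), of w] arrow_map_closed[OF arr(4), of w] arr that by auto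
  note T = TF_arrow[OF arr(1)] TF_arrow[OF arr(2)] TF_arrow[OF arr(3)] TF_arrow[OF arr(4)]
  show ?thesis
    unfolding alg_pullback_def
  proof (intro conjI ballI impI)
    show "{fmor TF f, fmor TF g, fmor TF a, fmor TF b} \<subseteq> Arr C" using T by simp
    show "tgt (fmor TF f) = tgt (fmor TF g)" "src (fmor TF a) = src (fmor TF b)"
      "tgt (fmor TF a) = src (fmor TF f)" "tgt (fmor TF b) = src (fmor TF g)"
      using T arr by simp_all
  next
    fix w assume "w \<in> carrier (src (fmor TF a))"
    then obtain u v where "u \<in> carrier (src a)" "v \<in> carrier (src a)" "w = Tuple [u, v]"
      unfolding T by (auto simp: in_tangent_alg_iff)
    then show "arrow_map (fmor TF f) (arrow_map (fmor TF a) w) = arrow_map (fmor TF g) (arrow_map (fmor TF b) w)"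
      using arr comm ac bc by (simp add: T)
  next
    fix x y assume "x \<in> carrier (src (fmor TF f))" "y \<in> carrier (src (fmor TF g))"
      and eq: "arrow_map (fmor TF f) x = arrow_map (fmor TF g) y"
    then obtain x0 x1 y0 y1 where x: "x0 \<in> carrier (src f)" "x1 \<in> carrier (src f)" "x = Tuple [x0, x1]"
      and y: "y0 \<in> carrier (src g)" "y1 \<in> carrier (src g)" "y = Tuple [y0, y1]"
      unfolding T by (auto simp: in_tangent_alg_iff)
    have eq': "arrow_map f x0 = arrow_map g y0" "arrow_map f x1 = arrow_map g y1"
      using eq x y by (auto simp: T)
    \<comment> \<open>The condition on a pair decouples into one condition for each entry, so unique
      existence follows from two instances of \<open>ex1\<close>.\<close>
    have char: "w \<in> carrier (src (fmor TF a)) \<and> arrow_map (fmor TF a) w = x \<and> arrow_map (fmor TF b) w = y \<longleftrightarrow>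
        (\<exists>u v. w = Tuple [u, v] \<and> (u \<in> carrier (src a) \<and> arrow_map a u = x0 \<and> arrow_map b u = y0) \<and>
          (v \<in> carrier (src a) \<and> arrow_map a v = x1 \<and> arrow_map b v = y1))" for w
      using arr x(3) y(3) by (auto simp: T in_tangent_alg_iff)
    show "\<exists>!w. w \<in> carrier (src (fmor TF a)) \<and> arrow_map (fmor TF a) w = x \<and> arrow_map (fmor TF b) w = y"
      unfolding char
      using ex1[OF x(1) y(1) eq'(1)] ex1[OF x(2) y(2) eq'(2)] by (elim ex1E) (auto intro!: ex1I)
  qed
qed

lemma alg_powers_tanp:
  assumes A: "is_alg A" and n: "1 \<le> n"
  shows "alg_powers R P n (tanp \<X> A) (tanN \<X> n A) (tanpr \<X> n A)"
proof -
  let ?S = "S n A"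
  have p: "arrow_map (tanp \<X> A) (Tuple [a, b]) = a" if "a \<in> carrier A" "b \<in> carrier A" for a b
    using tanp_arrow(4)[OF A, of "Tuple [a, b]"] that by simp
  have pr: "arrow_map (tanpr \<X> n A k) x = Tuple [entry 0 x, entry k x]" if "x \<in> carrier ?S" "k \<in> {1..n}" for k x
    using tanpr_arrow(4)[OF A _ _ that(1), of k] that(2) by simp
  show ?thesis
    unfolding tanN_alg[OF A n]
  proof (rule alg_powersI)
    show "tanpr \<X> n A k \<in> Arr C \<and> src (tanpr \<X> n A k) = ?S \<and> tgt (tanpr \<X> n A k) = src (tanp \<X> A)"
      if "k \<in> {1..n}" for k
      using that A by (simp add: arrow_simps)
    show "arrow_map (tanp \<X> A) (arrow_map (tanpr \<X> n A k) x) = arrow_map (tanp \<X> A) (arrow_map (tanpr \<X> n A 1) x)"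
      if "k \<in> {1..n}" "x \<in> carrier ?S" for k x
      using that n entry_closed[OF that(2)] by (simp add: pr p)
    show "x = y" if x: "x \<in> carrier ?S" and y: "y \<in> carrier ?S"
      and eq: "\<And>k. k \<in> {1..n} \<Longrightarrow> arrow_map (tanpr \<X> n A k) x = arrow_map (tanpr \<X> n A k) y" for x y
    proof (rule semidirect_eqI[OF x y])
      fix j assume j: "j \<le> n"
      show "entry j x = entry j y"
      proof (cases "j = 0")
        case True
        \<comment> \<open>Every projection keeps the base entry, so a single one determines it;
          \<open>1 \<le> n\<close> provides it.\<close>
        then show ?thesis using eq[of 1] n x y by (simp add: pr)
      next
        case False
        then show ?thesis using eq[of j] j x y by (simp add: pr)
      qed
    qed
    show "\<exists>x\<in>carrier ?S. \<forall>k\<in>{1..n}. arrow_map (tanpr \<X> n A k) x = e k"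
      if e: "\<And>k. k \<in> {1..n} \<Longrightarrow> e k \<in> carrier (src (tanp \<X> A))"
        and eq: "\<And>k. k \<in> {1..n} \<Longrightarrow> arrow_map (tanp \<X> A) (e k) = arrow_map (tanp \<X> A) (e 1)" for e
    proof -
      have e': "e k \<in> carrier (T A)" if "k \<in> {1..n}" for k
        using e[OF that] by (simp add: tanp_arrow[OF A])
      have ek: "entry 0 (e k) \<in> carrier A" "entry 1 (e k) \<in> carrier A"
        "e k = Tuple [entry 0 (e k), entry 1 (e k)]" if "k \<in> {1..n}" for k
        using e'[OF that] by (auto simp: in_tangent_alg_iff)
      have 1: "1 \<in> {1..n}" using n by simp
      have eq': "entry 0 (e k) = entry 0 (e 1)" if "k \<in> {1..n}" for k
        using eq[OF that] unfolding tanp_arrow(4)[OF A e'[OF that]] tanp_arrow(4)[OF A e'[OF 1]] .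
      \<comment> \<open>All members of the family share one base entry, taken from
        \<open>e 1\<close>; the fibre entry of \<open>e j\<close> goes to position \<open>j\<close>,
        since position 0 is the base.\<close>
      let ?f = "\<lambda>j. if j = 0 then entry 0 (e 1) else entry 1 (e j)"
      let ?x = "Tuple (map ?f [0..<Suc n])"
      have x: "?x \<in> carrier ?S"
        using ek(1)[OF 1] ek(2) by (intro tuple_of_entries) auto
      have "arrow_map (tanpr \<X> n A k) ?x = e k" if k: "k \<in> {1..n}" for k
        using pr[OF x k] entry_map_upt[of 0 n ?f] entry_map_upt[of k n ?f] k eq'[OF k] ek(3)[OF k]
        by (simp del: entry_Tuple upt_Suc)
      with x show ?thesis by blast
    qed
  qed (use A in \<open>simp_all add: arrow_simps\<close>)
qed

lemma alg_powers_funpow_TF: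
  assumes "alg_powers R P n q Q \<pi>" "1 \<le> n"
  shows "alg_powers R P n ((fmor TF ^^ m) q) ((fobj TF ^^ m) Q) (\<lambda>k. (fmor TF ^^ m) (\<pi> k))"
proof (induction m)
  case (Suc m)
  from alg_powers_TF[OF this assms(2)] alg_powersD(2)[OF this] show ?case
    by (simp add: fobj_TF)
qed (use assms in simp)

lemma alg_pullback_funpow_TF:
  "alg_pullback R P f g a b \<Longrightarrow> alg_pullback R P ((fmor TF ^^ m) f) ((fmor TF ^^ m) g)
    ((fmor TF ^^ m) a) ((fmor TF ^^ m) b)"
  by (induction m) (auto intro: alg_pullback_TF)

text \<open>A guess \<open>w\<close> with the right projections must be the value of the pairing,
  because the projections are jointly injective. The guess also yields the compatibility of
  \<open>f\<close> and \<open>g\<close>: over each element both are projections of the same point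
  \<open>w z\<close>.\<close>

lemma pair_arrow:
  assumes pow: "alg_powers R P 2 q Q \<pi>" and f: "f \<in> Arr C" "src f = Z" and g: "g \<in> Arr C" "src g = Z"
    and fg: "tgt f = src q" "tgt g = src q"
    and w: "\<And>z. z \<in> carrier Z \<Longrightarrow> w z \<in> carrier Q"
      "\<And>z. z \<in> carrier Z \<Longrightarrow> arrow_map (\<pi> 1) (w z) = arrow_map f z"
      "\<And>z. z \<in> carrier Z \<Longrightarrow> arrow_map (\<pi> 2) (w z) = arrow_map g z"
  shows "pb_tuple C Q \<pi> [f, g] \<in> Arr C" "src (pb_tuple C Q \<pi> [f, g]) = Z"
    "tgt (pb_tuple C Q \<pi> [f, g]) = Q"
    "z \<in> carrier Z \<Longrightarrow> arrow_map (pb_tuple C Q \<pi> [f, g]) z = w z"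
proof -
  note D = alg_powersD[OF pow]
  have 12: "1 \<in> {1..2::nat}" "2 \<in> {1..2::nat}" by auto
  have eq: "q \<cdot>\<^bsub>C\<^esub> f = q \<cdot>\<^bsub>C\<^esub> g"
  proof (rule arrow_eqI[of _ R P])
    fix z assume "z \<in> carrier (src (q \<cdot>\<^bsub>C\<^esub> f))"
    then have z: "z \<in> carrier Z" using D(1) f fg by (simp add: Comp_arrow)
    have "arrow_map q (arrow_map f z) = arrow_map q (arrow_map g z)"
      using D(4)[OF 12(2) w(1)[OF z]] unfolding w(2)[OF z] w(3)[OF z] by simp
    then show "arrow_map (q \<cdot>\<^bsub>C\<^esub> f) z = arrow_map (q \<cdot>\<^bsub>C\<^esub> g) z"
      using D(1) f g fg z by (simp add: Comp_arrow)
  qed (use D(1) f g fg in \<open>simp_all add: Comp_arrow\<close>)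
  have "in_hom C f Z (Dom C q)" "in_hom C g Z (Dom C q)"
    using D(1) f g fg by (simp_all add: in_hom_Alg_cat)
  note pair = pb_pair[OF alg_powers_nfold_pullback[OF pow one_le_numeral] this eq]
  then show arr: "pb_tuple C Q \<pi> [f, g] \<in> Arr C" "src (pb_tuple C Q \<pi> [f, g]) = Z"
    "tgt (pb_tuple C Q \<pi> [f, g]) = Q"
    by (simp_all add: in_hom_Alg_cat)
  assume z: "z \<in> carrier Z"
  show "arrow_map (pb_tuple C Q \<pi> [f, g]) z = w z"
  proof (rule D(5)[OF _ w(1)[OF z]])
    show "arrow_map (pb_tuple C Q \<pi> [f, g]) z \<in> carrier Q"
      using arrow_map_closed[OF arr(1)] z by (simp add: arr)
    fix k :: nat assume k: "k \<in> {1..2}"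
    have comp: "arrow_map (\<pi> k) (arrow_map (pb_tuple C Q \<pi> [f, g]) z) =
        arrow_map (\<pi> k \<cdot>\<^bsub>C\<^esub> pb_tuple C Q \<pi> [f, g]) z"
      using D(3)[OF k] arr z by (intro Comp_arrow(4)[symmetric]) auto
    from k have "k = 1 \<or> k = 2" by auto
    then show "arrow_map (\<pi> k) (arrow_map (pb_tuple C Q \<pi> [f, g]) z) = arrow_map (\<pi> k) (w z)"
      unfolding comp using pair(2,3) w(2,3)[OF z] by auto
  qed
qed

section \<open>Tuple calculus and the values of pairings\<close>

lemma tangent_entry_closed:
  assumes "x \<in> carrier (T A)"
  shows "entry 0 x \<in> carrier A" "entry (Suc 0) x \<in> carrier A"
    "Tuple [entry 0 x, entry (Suc 0) x] = x"
  using assms by (auto simp: in_tangent_alg_iff)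

lemma tangent_tangent_eta:
  assumes "x \<in> carrier (T (T A))"
  shows "Tuple [entry 0 (entry 0 x), entry (Suc 0) (entry 0 x)] = entry 0 x"
    "Tuple [entry 0 (entry (Suc 0) x), entry (Suc 0) (entry (Suc 0) x)] = entry (Suc 0) x"
  using assms by (auto simp: in_tangent_alg_iff)

lemma args_3: "[a, b, c] \<in> args A 3 \<longleftrightarrow> a \<in> carrier A \<and> b \<in> carrier A \<and> c \<in> carrier A"
  by (auto simp: args_def)

lemma semidirect2_entry_closed:
  assumes "x \<in> carrier (S 2 A)"
  shows "entry 0 x \<in> carrier A" "entry (Suc 0) x \<in> carrier A" "entry 2 x \<in> carrier A"
    "Tuple [entry 0 x, entry (Suc 0) x, entry 2 x] = x"
proof -
  obtain a b c where "x = Tuple [a, b, c]" "a \<in> carrier A" "b \<in> carrier A" "c \<in> carrier A"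
    using assms by (auto simp: carrier_semidirect args_def numeral_2_eq_2 length_Suc_conv)
  then show "entry 0 x \<in> carrier A" "entry (Suc 0) x \<in> carrier A" "entry 2 x \<in> carrier A"
    "Tuple [entry 0 x, entry (Suc 0) x, entry 2 x] = x"
    by simp_all
qed

lemma semidirect3_entry_closed:
  assumes "x \<in> carrier (S 3 A)"
  shows "entry 0 x \<in> carrier A" "entry (Suc 0) x \<in> carrier A" "entry 2 x \<in> carrier A"
    "entry 3 x \<in> carrier A"
  using entry_closed[OF assms] by simp_all

lemma tangent_zero: "\<zero>\<^bsub>T A\<^esub> = Tuple [\<zero>\<^bsub>A\<^esub>, \<zero>\<^bsub>A\<^esub>]"
  by (simp add: tangent_alg_def semidirect_def Let_def)

lemma tangent_add:
  "x \<in> carrier (T A) \<Longrightarrow> y \<in> carrier (T A) \<Longrightarrow>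
    x \<oplus>\<^bsub>T A\<^esub> y = Tuple [entry 0 x \<oplus>\<^bsub>A\<^esub> entry 0 y, entry (Suc 0) x \<oplus>\<^bsub>A\<^esub> entry (Suc 0) y]"
  unfolding tangent_alg_def carrier_semidirect by (simp add: semidirect_def Let_def)

lemmas element_simps = tangent_entry_closed args_3 semidirect2_entry_closed
  semidirect3_entry_closed tangent_zero tangent_add

text \<open>Pairing over \<open>p\<close> keeps the common base entry and lists the two fibre
  entries. Compatibility is phrased on entries so that simplification can discharge it for concrete
  arrows.\<close>

lemma tan_pair_arrow:
  assumes A: "is_alg A" and f: "f \<in> Arr C" "tgt f = T A" and g: "g \<in> Arr C" "src g = src f" "tgt g = T A"
    and eq: "\<forall>z\<in>carrier (src f). entry 0 (arrow_map f z) = entry 0 (arrow_map g z)"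
  shows "pair A [f, g] \<in> Arr C"
    "src (pair A [f, g]) = src f"
    "tgt (pair A [f, g]) = S 2 A"
    "z \<in> carrier (src f) \<Longrightarrow> arrow_map (pair A [f, g]) z =
      Tuple [entry 0 (arrow_map f z), entry 1 (arrow_map f z), entry 1 (arrow_map g z)]"
proof -
  let ?w = "\<lambda>z. Tuple [entry 0 (arrow_map f z), entry 1 (arrow_map f z), entry 1 (arrow_map g z)]"
  have fz: "arrow_map f z \<in> carrier (T A)" and gz: "arrow_map g z \<in> carrier (T A)"
    if "z \<in> carrier (src f)" for z
    using that f g arrow_map_closed[OF f(1)] arrow_map_closed[OF g(1)] by auto
  have w: "?w z \<in> carrier (S 2 A)" "arrow_map (tanpr \<X> 2 A 1) (?w z) = arrow_map f z"
    "arrow_map (tanpr \<X> 2 A 2) (?w z) = arrow_map g z" if "z \<in> carrier (src f)" for z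
  proof -
    show w: "?w z \<in> carrier (S 2 A)"
      using fz[OF that] gz[OF that] by (simp add: element_simps)
    show "arrow_map (tanpr \<X> 2 A 1) (?w z) = arrow_map f z"
      using fz[OF that] tanpr_arrow(4)[OF A _ _ w, of 1] by (simp add: element_simps)
    show "arrow_map (tanpr \<X> 2 A 2) (?w z) = arrow_map g z"
      using gz[OF that] tanpr_arrow(4)[OF A _ _ w, of 2] eq that by (simp add: element_simps)
  qed
  note pow = alg_powers_tanp[OF A, of 2, simplified, unfolded tanN_alg[OF A one_le_numeral]]
  note pair = pair_arrow[OF pow f(1) refl g(1,2), of ?w, unfolded tanp_arrow(2)[OF A], OF f(2) g(3) w]
  then show "pair A [f, g] \<in> Arr C"
    "src (pair A [f, g]) = src f"
    "tgt (pair A [f, g]) = S 2 A"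
    "z \<in> carrier (src f) \<Longrightarrow> arrow_map (pair A [f, g]) z = ?w z"
    by (simp_all only: tanN_alg[OF A one_le_numeral])
qed

text \<open>Pairing over \<open>T p\<close>. An element of the target is a pair of triples: the
  outer index belongs to the outer tangent functor, and each inner triple is a base entry with two
  fibre entries. \<open>T p\<close> keeps the inner base entries, so compatibility concerns these in
  both outer positions.\<close>

lemma tangent_pair_arrow:
  assumes A: "is_alg A" and f: "f \<in> Arr C" "tgt f = T (T A)"
    and g: "g \<in> Arr C" "src g = src f" "tgt g = T (T A)"
    and eq: "\<forall>z\<in>carrier (src f).
        entry 0 (entry 0 (arrow_map f z)) = entry 0 (entry 0 (arrow_map g z)) \<and>
        entry 0 (entry 1 (arrow_map f z)) = entry 0 (entry 1 (arrow_map g z))"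
  shows "tpair A [f, g] \<in> Arr C"
    "src (tpair A [f, g]) = src f"
    "tgt (tpair A [f, g]) =
      T (S 2 A)"
    "z \<in> carrier (src f) \<Longrightarrow>
      arrow_map (tpair A [f, g]) z =
      Tuple [Tuple [entry 0 (entry 0 (arrow_map f z)), entry 1 (entry 0 (arrow_map f z)),
          entry 1 (entry 0 (arrow_map g z))],
        Tuple [entry 0 (entry 1 (arrow_map f z)), entry 1 (entry 1 (arrow_map f z)),
          entry 1 (entry 1 (arrow_map g z))]]"
proof -
  let ?u = "\<lambda>z. Tuple [entry 0 (entry 0 (arrow_map f z)), entry 1 (entry 0 (arrow_map f z)),
    entry 1 (entry 0 (arrow_map g z))]"
  let ?v = "\<lambda>z. Tuple [entry 0 (entry 1 (arrow_map f z)), entry 1 (entry 1 (arrow_map f z)),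
    entry 1 (entry 1 (arrow_map g z))]"
  let ?w = "\<lambda>z. Tuple [?u z, ?v z]"
  let ?S = "S 2 A"
  have fz: "arrow_map f z \<in> carrier (T (T A))" and gz: "arrow_map g z \<in> carrier (T (T A))"
    if "z \<in> carrier (src f)" for z
    using that f g arrow_map_closed[OF f(1)] arrow_map_closed[OF g(1)] by auto
  have w: "?w z \<in> carrier (T ?S)" "arrow_map (fmor TF (tanpr \<X> 2 A 1)) (?w z) = arrow_map f z"
    "arrow_map (fmor TF (tanpr \<X> 2 A 2)) (?w z) = arrow_map g z" if "z \<in> carrier (src f)" for z
  proof -
    note fz' = tangent_entry_closed[OF fz[OF that]] and gz' = tangent_entry_closed[OF gz[OF that]]
    have w01: "?u z \<in> carrier ?S" "?v z \<in> carrier ?S"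
      using fz'(1,2) gz'(1,2) by (simp_all add: element_simps)
    then show w: "?w z \<in> carrier (T ?S)" by simp
    have T\<pi>: "arrow_map (fmor TF (tanpr \<X> 2 A k)) (?w z) =
        Tuple [Tuple [entry 0 (?u z), entry k (?u z)], Tuple [entry 0 (?v z), entry k (?v z)]]"
      if "1 \<le> k" "k \<le> 2" for k
      using TF_arrow(4)[OF tanpr_arrow(1)[OF A that], of "?w z"] tanpr_arrow[OF A that] w w01 by simp
    show "arrow_map (fmor TF (tanpr \<X> 2 A 1)) (?w z) = arrow_map f z"
      unfolding T\<pi>[of 1, OF order_refl one_le_numeral]
      using fz' by (simp add: element_simps)
    show "arrow_map (fmor TF (tanpr \<X> 2 A 2)) (?w z) = arrow_map g z"
      unfolding T\<pi>[of 2, OF one_le_numeral order_refl]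
      using gz' eq that by (simp add: element_simps)
  qed
  have S: "fobj TF (tanN \<X> 2 A) = T ?S"
    using A by (simp add: tanN_alg fobj_TF semidirect_operad_algebra)
  note pow = alg_powers_TF[OF alg_powers_tanp[OF A, of 2], simplified,
      unfolded tanN_alg[OF A one_le_numeral]]
  have src: "src (fmor TF (tanp \<X> A)) = T (T A)" using A by (simp add: arrow_simps)
  note pair = pair_arrow[OF pow f(1) refl g(1,2), of ?w, unfolded src, OF f(2) g(3) w]
  then show "tpair A [f, g] \<in> Arr C"
    "src (tpair A [f, g]) = src f"
    "tgt (tpair A [f, g]) = T ?S"
    "z \<in> carrier (src f) \<Longrightarrow>
      arrow_map (tpair A [f, g]) z = ?w z"
    by (simp_all only: S)
qed

section \<open>Additive bundles and their morphisms\<close>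

lemma tan_bundle_sel:
  "bproj (tan_bundle \<X> A) = tanp \<X> A" "bpow (tan_bundle \<X> A) n = tanN \<X> n A"
  "bpr (tan_bundle \<X> A) n = tanpr \<X> n A" "bzero (tan_bundle \<X> A) = tanz \<X> A"
  "bsum (tan_bundle \<X> A) = tans \<X> A"
  by (simp_all add: tan_bundle_def)

text \<open>On elements the monoid laws are those of addition in \<open>A\<close>, applied to the
  fibre entries over a fixed base entry.\<close>

lemma additive_tan_bundle:
  assumes A: "is_alg A"
  shows "additive_bundle C (tan_bundle \<X> A)"
proof -
  interpret A: operad_algebra R P A by (rule A)
  note simps = A arrow_simps tan_pair_arrow element_simps in_hom_Alg_cat
  show ?thesis
    unfolding additive_bundle_def Let_def tan_bundle_sel
  proof (intro conjI allI impI)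
    show "nfold_pullback C n (tanp \<X> A) (tanN \<X> n A) (tanpr \<X> n A)" if "1 \<le> n" for n
      by (rule alg_powers_nfold_pullback[OF alg_powers_tanp[OF A that] that])
    show "tanp \<X> A \<cdot>\<^bsub>C\<^esub> tanz \<X> A = Ident C (Cod C (tanp \<X> A))"
      "tanp \<X> A \<cdot>\<^bsub>C\<^esub> tans \<X> A = tanp \<X> A \<cdot>\<^bsub>C\<^esub> tanpr \<X> 2 A 1"
      by (rule arrow_eqI[of _ R P]; simp add: simps)+
    show "tans \<X> A \<cdot>\<^bsub>C\<^esub> pair A
        [tanz \<X> A \<cdot>\<^bsub>C\<^esub> tanp \<X> A, Ident C (Dom C (tanp \<X> A))] = Ident C (Dom C (tanp \<X> A))"
      by (rule arrow_eqI[of _ R P]; simp add: simps)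
    show "tans \<X> A \<cdot>\<^bsub>C\<^esub> pair A
        [Ident C (Dom C (tanp \<X> A)), tanz \<X> A \<cdot>\<^bsub>C\<^esub> tanp \<X> A] = Ident C (Dom C (tanp \<X> A))"
      by (rule arrow_eqI[of _ R P]; simp add: simps)
    show "tans \<X> A \<cdot>\<^bsub>C\<^esub> pair A [tanpr \<X> 2 A 2, tanpr \<X> 2 A 1] = tans \<X> A"
      by (rule arrow_eqI[of _ R P]; simp add: simps A.A.M.a_comm)
    show "tans \<X> A \<cdot>\<^bsub>C\<^esub> pair A [tans \<X> A \<cdot>\<^bsub>C\<^esub>
          pair A [tanpr \<X> 3 A 1, tanpr \<X> 3 A 2], tanpr \<X> 3 A 3] =
        tans \<X> A \<cdot>\<^bsub>C\<^esub> pair A [tanpr \<X> 3 A 1, tans \<X> A \<cdot>\<^bsub>C\<^esub>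
          pair A [tanpr \<X> 3 A 2, tanpr \<X> 3 A 3]]"
      by (rule arrow_eqI[of _ R P]; simp add: simps A.A.M.a_assoc)
  qed (simp_all add: simps tanN_alg)
qed

lemma additive_tangent_bundle:
  assumes A: "is_alg A"
  shows "additive_bundle C (map_bundle TF (tan_bundle \<X> A))"
proof (rule additive_bundle_map[OF functor_TF additive_tan_bundle[OF A]], unfold tan_bundle_sel)
  fix n :: nat assume n: "1 \<le> n"
  have "fobj TF (tanN \<X> n A) = T (tanN \<X> n A)"
    using A n by (simp add: tanN_alg fobj_TF semidirect_operad_algebra)
  then show "nfold_pullback C n (fmor TF (tanp \<X> A)) (fobj TF (tanN \<X> n A)) (\<lambda>k. fmor TF (tanpr \<X> n A k))"
    using alg_powers_nfold_pullback[OF alg_powers_TF[OF alg_powers_tanp[OF A n] n] n] by simp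
qed

lemma map_tan_bundle_sel:
  "bproj (map_bundle TF (tan_bundle \<X> A)) = fmor TF (tanp \<X> A)"
  "bpow (map_bundle TF (tan_bundle \<X> A)) n = fobj TF (tanN \<X> n A)"
  "bpr (map_bundle TF (tan_bundle \<X> A)) n = (\<lambda>k. fmor TF (tanpr \<X> n A k))"
  "bzero (map_bundle TF (tan_bundle \<X> A)) = fmor TF (tanz \<X> A)"
  "bsum (map_bundle TF (tan_bundle \<X> A)) = fmor TF (tans \<X> A)"
  by (simp_all add: map_bundle_def tan_bundle_sel)

text \<open>The target bundle is \<open>T p\<close>, whose fibre consists of the inner second
  entries; the lift sends a fibre entry over \<open>a\<close> into the fibre over
  \<open>(a, 0)\<close>, in which addition takes place entrywise.\<close>

lemma additive_lift:
  assumes A: "is_alg A"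
  shows "additive_bundle_morphism C (tan_bundle \<X> A) (map_bundle TF (tan_bundle \<X> A))
    (tanl \<X> A) (tanz \<X> A)"
proof -
  interpret A: operad_algebra R P A by (rule A)
  note simps = A arrow_simps tangent_pair_arrow element_simps in_hom_Alg_cat
  show ?thesis
    unfolding additive_bundle_morphism_def tan_bundle_sel map_tan_bundle_sel
  proof (intro conjI)
    show "fmor TF (tanp \<X> A) \<cdot>\<^bsub>C\<^esub> tanl \<X> A = tanz \<X> A \<cdot>\<^bsub>C\<^esub> tanp \<X> A"
      "tanl \<X> A \<cdot>\<^bsub>C\<^esub> tanz \<X> A = fmor TF (tanz \<X> A) \<cdot>\<^bsub>C\<^esub> tanz \<X> A"
      by (rule arrow_eqI[of _ R P]; simp add: simps)+
    show "tanl \<X> A \<cdot>\<^bsub>C\<^esub> tans \<X> A = fmor TF (tans \<X> A) \<cdot>\<^bsub>C\<^esub>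
        tpair A
          [tanl \<X> A \<cdot>\<^bsub>C\<^esub> tanpr \<X> 2 A 1, tanl \<X> A \<cdot>\<^bsub>C\<^esub> tanpr \<X> 2 A 2]"
      by (rule arrow_eqI[of _ R P]; simp add: simps)
  qed (simp_all add: simps additive_tan_bundle additive_tangent_bundle)
qed

text \<open>The flip exchanges the two bundle structures on the double tangent algebra: the inner
  second entries, which form the fibre of \<open>T p\<close>, become the outer second entry, which
  is the fibre of the projection at \<open>T A\<close>.\<close>

lemma additive_flip:
  assumes A: "is_alg A"
  shows "additive_bundle_morphism C (map_bundle TF (tan_bundle \<X> A)) (tan_bundle \<X> (fobj TF A))
    (tanc \<X> A) (Ident C (fobj TF A))"
proof -
  interpret A: operad_algebra R P A by (rule A)
  note simps = A arrow_simps tan_pair_arrow element_simps in_hom_Alg_cat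
  show ?thesis
    unfolding additive_bundle_morphism_def tan_bundle_sel map_tan_bundle_sel fobj_TF[OF A]
  proof (intro conjI)
    show "tanp \<X> (T A) \<cdot>\<^bsub>C\<^esub> tanc \<X> A = Ident C (T A) \<cdot>\<^bsub>C\<^esub> fmor TF (tanp \<X> A)"
      "tanc \<X> A \<cdot>\<^bsub>C\<^esub> fmor TF (tanz \<X> A) = tanz \<X> (T A) \<cdot>\<^bsub>C\<^esub> Ident C (T A)"
      by (rule arrow_eqI[of _ R P]; simp add: simps)+
    show "tanc \<X> A \<cdot>\<^bsub>C\<^esub> fmor TF (tans \<X> A) = tans \<X> (T A) \<cdot>\<^bsub>C\<^esub>
        pair (T A)
          [tanc \<X> A \<cdot>\<^bsub>C\<^esub> fmor TF (tanpr \<X> 2 A 1), tanc \<X> A \<cdot>\<^bsub>C\<^esub> fmor TF (tanpr \<X> 2 A 2)]"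
      by (rule arrow_eqI[of _ R P]; simp add: simps)
  qed (simp_all add: simps additive_tan_bundle additive_tangent_bundle)
qed

lemma tanT2_arrow:
  assumes f: "f \<in> Arr C"
  shows "fmor (tanT2 \<X>) f \<in> Arr C" "src (fmor (tanT2 \<X>) f) = S 2 (src f)"
    "tgt (fmor (tanT2 \<X>) f) = S 2 (tgt f)"
    "x \<in> carrier (S 2 (src f)) \<Longrightarrow> arrow_map (fmor (tanT2 \<X>) f) x =
      Tuple [arrow_map f (entry 0 x), arrow_map f (entry 1 x), arrow_map f (entry 2 x)]"
proof -
  have ucat: "ucat \<X> = C" by (simp add: alg_tangent_def Let_def)
  have eq: "fmor (tanT2 \<X>) f = pair (tgt f)
      [fmor TF f \<cdot>\<^bsub>C\<^esub> tanpr \<X> 2 (src f) 1, fmor TF f \<cdot>\<^bsub>C\<^esub> tanpr \<X> 2 (src f) 2]"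
    using f by (simp add: tanT2_def Let_def ucat tan_pair_def)
  note simps = f src_algebra[OF f] tgt_algebra[OF f] arrow_simps tan_pair_arrow element_simps
  show "fmor (tanT2 \<X>) f \<in> Arr C" "src (fmor (tanT2 \<X>) f) = S 2 (src f)"
    "tgt (fmor (tanT2 \<X>) f) = S 2 (tgt f)"
    "x \<in> carrier (S 2 (src f)) \<Longrightarrow> arrow_map (fmor (tanT2 \<X>) f) x =
      Tuple [arrow_map f (entry 0 x), arrow_map f (entry 1 x), arrow_map f (entry 2 x)]"
    unfolding eq by (simp_all add: simps)
qed

lemma fobj_tanT2: "is_alg A \<Longrightarrow> fobj (tanT2 \<X>) A = S 2 A"
  by (simp add: tanT2_def alg_tangent_def Let_def)

lemma functor_tanT2: "is_functor C C (tanT2 \<X>)"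
proof (rule is_functorI)
  show "fobj (tanT2 \<X>) \<in> extensional (Obj C)" "fmor (tanT2 \<X>) \<in> extensional (Arr C)"
    by (simp_all add: tanT2_def alg_tangent_def Let_def)
  fix f g A B D assume f: "in_hom C f A B"
  then show "in_hom C (fmor (tanT2 \<X>) f) (fobj (tanT2 \<X>) A) (fobj (tanT2 \<X>) B)"
    using src_algebra[of f R P] tgt_algebra[of f R P]
    by (auto simp: in_hom_Alg_cat tanT2_arrow fobj_tanT2)
  assume g: "in_hom C g B D"
  have "arrow_map f a \<in> carrier B" if "a \<in> carrier A" for a
    using f arrow_map_closed[of f R P a] that by (auto simp: in_hom_Alg_cat)
  then show "fmor (tanT2 \<X>) (g \<cdot>\<^bsub>C\<^esub> f) = fmor (tanT2 \<X>) g \<cdot>\<^bsub>C\<^esub> fmor (tanT2 \<X>) f"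
    using f g by (intro arrow_eqI[of _ R P]) (auto simp: in_hom_Alg_cat tanT2_arrow Comp_arrow element_simps)
next
  fix A assume "A \<in> Obj C"
  then show "fobj (tanT2 \<X>) A \<in> Obj C" "fmor (tanT2 \<X>) (Ident C A) = Ident C (fobj (tanT2 \<X>) A)"
    by (auto simp: arrow_simps tanT2_arrow fobj_tanT2 element_simps intro!: arrow_eqI[of _ R P])
qed (rule category_Alg_cat)+

lemma lift_universal:
  assumes A: "is_alg A"
  shows "alg_pullback R P (fmor TF (tanp \<X> A)) (tanz \<X> A)
    (fmor TF (tans \<X> A) \<cdot>\<^bsub>C\<^esub> tpair A
      [tanl \<X> A \<cdot>\<^bsub>C\<^esub> tanpr \<X> 2 A 1, tanz \<X> (fobj TF A) \<cdot>\<^bsub>C\<^esub> tanpr \<X> 2 A 2])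
    (tanp \<X> A \<cdot>\<^bsub>C\<^esub> tanpr \<X> 2 A 1)"
    (is "alg_pullback R P _ _ ?\<nu> _")
proof -
  interpret A: operad_algebra R P A by (rule A)
  note simps = A arrow_simps tangent_pair_arrow element_simps
  \<comment> \<open>On \<open>(a; b1, b2)\<close> the two paired arrows have values
    \<open>((a, 0), (0, b1))\<close> and \<open>((a, b2), (0, 0))\<close>. Adding them in the fibre
    of \<open>T p\<close> gives \<open>((a, b2), (0, b1))\<close>.\<close>
  have \<nu>: "?\<nu> \<in> Arr C" "src ?\<nu> = S 2 A" "tgt ?\<nu> = T (T A)"
    "\<And>x. x \<in> carrier (S 2 A) \<Longrightarrow> arrow_map ?\<nu> x =
      Tuple [Tuple [entry 0 x, entry 2 x], Tuple [\<zero>\<^bsub>A\<^esub>, entry 1 x]]"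
    by (simp_all add: simps)
  show ?thesis
    unfolding alg_pullback_def
  proof (intro conjI ballI impI)
    fix x y assume x: "x \<in> carrier (src (fmor TF (tanp \<X> A)))" and "y \<in> carrier (src (tanz \<X> A))"
      and eq: "arrow_map (fmor TF (tanp \<X> A)) x = arrow_map (tanz \<X> A) y"
    then have y: "y \<in> carrier A" by (simp add: simps)
    from x obtain a b c d where abcd: "a \<in> carrier A" "b \<in> carrier A" "c \<in> carrier A" "d \<in> carrier A"
      "x = Tuple [Tuple [a, b], Tuple [c, d]]"
      by (auto simp: simps in_tangent_alg_iff)
    then have "a = y" "c = \<zero>\<^bsub>A\<^esub>"
      using eq y by (auto simp: simps)
    \<comment> \<open>For \<open>x = ((a, b), (c, d))\<close> the compatibility says that
      \<open>(a, c)\<close> is \<open>(y, 0)\<close>. Solving the formula for \<open>?\<nu>\<close>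
      then gives \<open>a\<close> as base entry, \<open>d\<close> as first and \<open>b\<close> as
      second fibre entry.\<close>
    then show "\<exists>!w. w \<in> carrier (src ?\<nu>) \<and> arrow_map ?\<nu> w = x \<and>
        arrow_map (tanp \<X> A \<cdot>\<^bsub>C\<^esub> tanpr \<X> 2 A 1) w = y"
      using abcd
      by (intro ex1I[of _ "Tuple [a, d, b]"])
        (auto simp: \<nu> simps dest: semidirect2_entry_closed(4)[symmetric])
  qed (simp_all add: \<nu>, simp_all add: simps)
qed

theorem tangent_structure: "tangent_structure \<X> C TF"
proof
  have id: "is_functor C C (id_functor C)" by (rule is_functor_id[OF category_Alg_cat])
  note TT = is_functor_comp[OF functor_TF functor_TF]
  have fobj: "is_alg A \<Longrightarrow> fobj (id_functor C) A = A"
    "is_alg A \<Longrightarrow> fobj (comp_functor C TF TF) A = T (T A)" for A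
    by (simp_all add: id_functor_def comp_functor_def fobj_TF tangent_operad_algebra)
  have fmor: "f \<in> Arr C \<Longrightarrow> fmor (id_functor C) f = f"
    "f \<in> Arr C \<Longrightarrow> fmor (comp_functor C TF TF) f = fmor TF (fmor TF f)" for f
    by (simp_all add: id_functor_def comp_functor_def)
  note simps = arrow_simps element_simps in_hom_Alg_cat fobj fmor tanT2_arrow fobj_tanT2
  have ext: "tanp \<X> \<in> extensional (Obj C)" "tanz \<X> \<in> extensional (Obj C)"
    "tans \<X> \<in> extensional (Obj C)" "tanl \<X> \<in> extensional (Obj C)" "tanc \<X> \<in> extensional (Obj C)"
    by (simp_all add: alg_tangent_def Let_def)
  show "is_functor C C TF" by (rule functor_TF)
  show "tanN \<X> n A = undefined" if "\<not> (1 \<le> n \<and> A \<in> Obj C)" for n A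
    using that by (auto simp: alg_tangent_def Let_def)
  show "tanpr \<X> n A k = undefined" if "\<not> (1 \<le> n \<and> A \<in> Obj C \<and> k \<in> {1..n})" for n A k
    using that by (auto simp: alg_tangent_def Let_def)
  \<comment> \<open>What the naturality squares use about an arrow: closure on carriers throughout,
    preservation of zero for the zero section and the lift, preservation of addition for the
    sum.\<close>
  have arr: "f \<in> Arr C" "src f = A" "tgt f = B" "is_alg A" "is_alg B"
      "\<And>a. a \<in> carrier A \<Longrightarrow> arrow_map f a \<in> carrier B"
      "arrow_map f \<zero>\<^bsub>A\<^esub> = \<zero>\<^bsub>B\<^esub>"
      "\<And>a b. a \<in> carrier A \<Longrightarrow> b \<in> carrier A \<Longrightarrow> arrow_map f (a \<oplus>\<^bsub>A\<^esub> b) = arrow_map f a \<oplus>\<^bsub>B\<^esub> arrow_map f b"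
    if "in_hom C f A B" for f A B
  proof -
    show f: "f \<in> Arr C" "src f = A" "tgt f = B" using that by (auto simp: in_hom_Alg_cat)
    show A: "is_alg A" and B: "is_alg B" using src_algebra[OF f(1)] tgt_algebra[OF f(1)] f by auto
    interpret A: operad_algebra R P A by (rule A)
    interpret B: operad_algebra R P B by (rule B)
    have lin: "linear_map R A B (arrow_map f)"
      using alg_map_linear[OF arrow_alg_map[OF f(1)]] f by simp
    show "\<And>a. a \<in> carrier A \<Longrightarrow> arrow_map f a \<in> carrier B"
      by (rule linear_map_closed[OF lin])
    show "arrow_map f \<zero>\<^bsub>A\<^esub> = \<zero>\<^bsub>B\<^esub>"
      by (rule linear_map_zero[OF A.A.module_axioms B.A.module_axioms lin])
    show "\<And>a b. a \<in> carrier A \<Longrightarrow> b \<in> carrier A \<Longrightarrow> arrow_map f (a \<oplus>\<^bsub>A\<^esub> b) = arrow_map f a \<oplus>\<^bsub>B\<^esub> arrow_map f b"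
      by (rule linear_map_add[OF lin])
  qed
  have zero: "\<zero>\<^bsub>A\<^esub> \<in> carrier A" and add: "\<And>a b. a \<in> carrier A \<Longrightarrow> b \<in> carrier A \<Longrightarrow> a \<oplus>\<^bsub>A\<^esub> b \<in> carrier A"
    if "is_alg A" for A
  proof -
    interpret A: operad_algebra R P A by (rule that)
    show "\<zero>\<^bsub>A\<^esub> \<in> carrier A" by simp
    show "\<And>a b. a \<in> carrier A \<Longrightarrow> b \<in> carrier A \<Longrightarrow> a \<oplus>\<^bsub>A\<^esub> b \<in> carrier A" by simp
  qed
  show "nat_trans C C TF (id_functor C) (tanp \<X>)"
  proof (rule nat_transI[OF functor_TF id ext(1)])
    fix f A B assume "in_hom C f A B"
    note arr = arr[OF this]
    show "tanp \<X> B \<cdot>\<^bsub>C\<^esub> fmor TF f = fmor (id_functor C) f \<cdot>\<^bsub>C\<^esub> tanp \<X> A"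
      by (rule arrow_eqI[of _ R P]; simp add: simps arr)
  qed (simp add: simps)
  show "nat_trans C C (id_functor C) TF (tanz \<X>)"
  proof (rule nat_transI[OF id functor_TF ext(2)])
    fix f A B assume "in_hom C f A B"
    note arr = arr[OF this]
    show "tanz \<X> B \<cdot>\<^bsub>C\<^esub> fmor (id_functor C) f = fmor TF f \<cdot>\<^bsub>C\<^esub> tanz \<X> A"
      by (rule arrow_eqI[of _ R P]; simp add: simps arr zero)
  qed (simp add: simps)
  show "nat_trans C C (tanT2 \<X>) TF (tans \<X>)"
  proof (rule nat_transI[OF functor_tanT2 functor_TF ext(3)])
    fix f A B assume "in_hom C f A B"
    note arr = arr[OF this]
    show "tans \<X> B \<cdot>\<^bsub>C\<^esub> fmor (tanT2 \<X>) f = fmor TF f \<cdot>\<^bsub>C\<^esub> tans \<X> A"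
      by (rule arrow_eqI[of _ R P]; simp add: simps arr add)
  qed (simp add: simps)
  show "nat_trans C C TF (comp_functor C TF TF) (tanl \<X>)"
  proof (rule nat_transI[OF functor_TF TT ext(4)])
    fix f A B assume "in_hom C f A B"
    note arr = arr[OF this]
    show "tanl \<X> B \<cdot>\<^bsub>C\<^esub> fmor TF f = fmor (comp_functor C TF TF) f \<cdot>\<^bsub>C\<^esub> tanl \<X> A"
      by (rule arrow_eqI[of _ R P]; simp add: simps arr zero)
  qed (simp add: simps)
  show "nat_trans C C (comp_functor C TF TF) (comp_functor C TF TF) (tanc \<X>)"
  proof (rule nat_transI[OF TT TT ext(5)])
    fix f A B assume "in_hom C f A B"
    note arr = arr[OF this]
    show "tanc \<X> B \<cdot>\<^bsub>C\<^esub> fmor (comp_functor C TF TF) f = fmor (comp_functor C TF TF) f \<cdot>\<^bsub>C\<^esub> tanc \<X> A"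
      by (rule arrow_eqI[of _ R P]; simp add: simps arr)
  qed (simp add: simps)
  fix A assume "A \<in> Obj C"
  then have A: "is_alg A" by simp
  \<comment> \<open>Composites such as the flip with itself rebuild nested tuples from their
    entries; the eta rules collapse these again.\<close>
  note simps = simps A zero[OF A] tangent_tangent_eta
  show "nfold_pullback C n ((fmor TF ^^ m) (tanp \<X> A)) ((fobj TF ^^ m) (tanN \<X> n A))
      (\<lambda>k. (fmor TF ^^ m) (tanpr \<X> n A k))" if "1 \<le> n" for n m
    by (rule alg_powers_nfold_pullback[OF alg_powers_funpow_TF[OF alg_powers_tanp[OF A that] that] that])
  show "additive_bundle C (tan_bundle \<X> A)" by (rule additive_tan_bundle[OF A])
  show "additive_bundle_morphism C (tan_bundle \<X> A) (map_bundle TF (tan_bundle \<X> A)) (tanl \<X> A) (tanz \<X> A)"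
    by (rule additive_lift[OF A])
  show "additive_bundle_morphism C (map_bundle TF (tan_bundle \<X> A)) (tan_bundle \<X> (fobj TF A))
      (tanc \<X> A) (Ident C (fobj TF A))"
    by (rule additive_flip[OF A])
  show "tanc \<X> A \<cdot>\<^bsub>C\<^esub> tanc \<X> A = Ident C (fobj TF (fobj TF A))"
    "tanc \<X> A \<cdot>\<^bsub>C\<^esub> tanl \<X> A = tanl \<X> A"
    "fmor TF (tanl \<X> A) \<cdot>\<^bsub>C\<^esub> tanl \<X> A = tanl \<X> (fobj TF A) \<cdot>\<^bsub>C\<^esub> tanl \<X> A"
    by (rule arrow_eqI[of _ R P]; simp add: simps)+
  show "fmor TF (tanc \<X> A) \<cdot>\<^bsub>C\<^esub> tanc \<X> (fobj TF A) \<cdot>\<^bsub>C\<^esub> fmor TF (tanc \<X> A) =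
      tanc \<X> (fobj TF A) \<cdot>\<^bsub>C\<^esub> fmor TF (tanc \<X> A) \<cdot>\<^bsub>C\<^esub> tanc \<X> (fobj TF A)"
    by (rule arrow_eqI[of _ R P]; simp add: simps)
  show "tanc \<X> (fobj TF A) \<cdot>\<^bsub>C\<^esub> fmor TF (tanc \<X> A) \<cdot>\<^bsub>C\<^esub> tanl \<X> (fobj TF A) =
      fmor TF (tanl \<X> A) \<cdot>\<^bsub>C\<^esub> tanc \<X> A"
    by (rule arrow_eqI[of _ R P]; simp add: simps)
  show "let \<pi> = tanpr \<X> 2 A; \<nu> = fmor TF (tans \<X> A) \<cdot>\<^bsub>C\<^esub>
        pb_tuple C (fobj TF (tanN \<X> 2 A)) (\<lambda>k. fmor TF (\<pi> k))
          [tanl \<X> A \<cdot>\<^bsub>C\<^esub> \<pi> 1, tanz \<X> (fobj TF A) \<cdot>\<^bsub>C\<^esub> \<pi> 2]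
      in is_pullback C ((fmor TF ^^ m) (fmor TF (tanp \<X> A))) ((fmor TF ^^ m) (tanz \<X> A))
        ((fmor TF ^^ m) \<nu>) ((fmor TF ^^ m) (tanp \<X> A \<cdot>\<^bsub>C\<^esub> \<pi> 1))" for m
    unfolding Let_def
    by (rule alg_pullback_is_pullback[OF alg_pullback_funpow_TF[OF lift_universal[OF A]]])
qed

corollary tangent_category: "tangent_category \<X>"
  using tangent_structure by (simp add: tangent_category_def) (simp add: alg_tangent_def Let_def)

end

section \<open>Restriction along a morphism of operads\<close>

text \<open>Restriction changes \<open>act\<close> only. Whatever depends on the module part alone,
  finite sums included, is literally the same before and after.\<close>

lemma restrict_alg_sel [simp]:
  "carrier (restrict_alg P \<phi> B) = carrier B" "zero (restrict_alg P \<phi> B) = zero B"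
  "add (restrict_alg P \<phi> B) = add B" "smult (restrict_alg P \<phi> B) = smult B"
  "monoid.mult (restrict_alg P \<phi> B) = monoid.mult B" "one (restrict_alg P \<phi> B) = one B"
  "args (restrict_alg P \<phi> B) = args B" "finsum (restrict_alg P \<phi> B) = finsum B"
  by (simp_all add: restrict_alg_def args_def fun_eq_iff finsum_def)

lemma act_restrict_alg:
  "\<mu> \<in> ops P n \<Longrightarrow> bs \<in> args B n \<Longrightarrow> act (restrict_alg P \<phi> B) n \<mu> bs = act B n (\<phi> n \<mu>) bs"
  by (simp add: restrict_alg_def)

lemma linear_map_restrict_alg [simp]:
  "linear_map R (restrict_alg P \<phi> A) N h \<longleftrightarrow> linear_map R A N h"
  "linear_map R M (restrict_alg P \<phi> B) h \<longleftrightarrow> linear_map R M B h"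
  by (simp_all add: linear_map_def)

lemma normal_module_restrict_alg [simp]: "normal_module R (restrict_alg P \<phi> B) \<longleftrightarrow> normal_module R B"
  by (simp add: normal_module_def module_def module_axioms_def abelian_group_def
      abelian_monoid_def abelian_group_axioms_def)

text \<open>Each axiom at operations of \<open>P\<close> is the axiom of \<open>B\<close> at their
  images in \<open>Q\<close>, once the corresponding law for \<open>\<phi>\<close> has moved it
  through the unit, the composition or the symmetric action.\<close>

lemma restrict_operad_algebra:
  assumes P: "symmetric_operad R P" and \<phi>: "\<phi> \<in> operad_hom R P Q" and B: "operad_algebra R Q B"
  shows "operad_algebra R P (restrict_alg P \<phi> B)"
proof -
  interpret P: symmetric_operad R P by (rule P)
  interpret B: operad_algebra R Q B by (rule B)
  note closed = operad_hom_closed[OF \<phi>]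
  show ?thesis
  proof
    show "normal_module R (restrict_alg P \<phi> B)" using B.module by simp
  next
    fix \<mu> n as assume "\<not> (\<mu> \<in> ops P n \<and> as \<in> args (restrict_alg P \<phi> B) n)"
    then show "act (restrict_alg P \<phi> B) n \<mu> as = undefined"
      by (auto simp: restrict_alg_def args_def)
  next
    fix as n assume "as \<in> args (restrict_alg P \<phi> B) n"
    then have as: "as \<in> args B n" by simp
    have "linear_map R (omod P n) B (\<lambda>\<mu>. act (restrict_alg P \<phi> B) n \<mu> as)"
      using linear_map_compose[OF operad_hom_linear[OF \<phi>] B.act_linear_op[OF as]]
      by (subst linear_map_cong[OF P.operad_module]) (auto simp: act_restrict_alg as ops_def)
    then show "linear_map R (omod P n) (restrict_alg P \<phi> B) (\<lambda>\<mu>. act (restrict_alg P \<phi> B) n \<mu> as)"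
      by simp
  next
    fix \<mu> n as i assume \<mu>: "\<mu> \<in> ops P n" and "as \<in> args (restrict_alg P \<phi> B) n" and i: "i < n"
    then have as: "as \<in> args B n" by simp
    have "linear_map R B B (\<lambda>a. act (restrict_alg P \<phi> B) n \<mu> (as[i := a]))"
      using B.act_linear_arg[OF closed[OF \<mu>] as i]
      by (subst linear_map_cong[OF B.A.module_axioms]) (auto simp: act_restrict_alg \<mu> args_update[OF as])
    then show "linear_map R (restrict_alg P \<phi> B) (restrict_alg P \<phi> B)
        (\<lambda>a. act (restrict_alg P \<phi> B) n \<mu> (as[i := a]))"
      by simp
  next
    fix a assume "a \<in> carrier (restrict_alg P \<phi> B)"
    then have "[a] \<in> args B 1" and a: "a \<in> carrier B" by (auto simp: args_def)
    show "act (restrict_alg P \<phi> B) 1 (ounit P) [a] = a"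
      unfolding act_restrict_alg[OF P.unit \<open>[a] \<in> args B 1\<close>] operad_hom_unit[OF \<phi>]
      by (rule B.act_unit[OF a])
  next
    fix \<mu> ks \<nu>s ass
    assume \<mu>: "\<mu> \<in> ops P (length ks)" and \<nu>s: "ops_list P ks \<nu>s"
      and "list_all2 (\<lambda>k as. as \<in> args (restrict_alg P \<phi> B) k) ks ass"
    then have ass: "list_all2 (\<lambda>k as. as \<in> args B k) ks ass" by simp
    have nth: "\<nu>s ! i \<in> ops P (ks ! i)" "ass ! i \<in> args B (ks ! i)" "map2 \<phi> ks \<nu>s ! i = \<phi> (ks ! i) (\<nu>s ! i)"
      if "i < length ks" for i
      using \<nu>s ass that by (auto simp: ops_list_def list_all2_conv_all_nth)
    let ?V = "map (\<lambda>i. act B (ks ! i) (map2 \<phi> ks \<nu>s ! i) (ass ! i)) [0..<length ks]"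
    have V: "map (\<lambda>i. act (restrict_alg P \<phi> B) (ks ! i) (\<nu>s ! i) (ass ! i)) [0..<length ks] = ?V"
      using nth by (simp add: act_restrict_alg)
    have args: "?V \<in> args B (length ks)"
      using nth by (auto simp: args_iff_nth[of ?V] intro!: B.act_closed closed)
    show "act (restrict_alg P \<phi> B) (sum_list ks) (ocomp P ks \<mu> \<nu>s) (concat ass) =
        act (restrict_alg P \<phi> B) (length ks) \<mu>
          (map (\<lambda>i. act (restrict_alg P \<phi> B) (ks ! i) (\<nu>s ! i) (ass ! i)) [0..<length ks])"
      unfolding V act_restrict_alg[OF P.comp_closed[OF \<mu> \<nu>s] args_concat[OF ass, THEN conjunct1]]
        act_restrict_alg[OF \<mu> args] operad_hom_ocomp[OF \<phi> \<mu> \<nu>s]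
      by (rule B.act_comp[OF closed[OF \<mu>] operad_hom_ops_list[OF \<phi> \<nu>s] ass])
  next
    fix \<mu> n as \<sigma> assume \<mu>: "\<mu> \<in> ops P n" and "as \<in> args (restrict_alg P \<phi> B) n" and \<sigma>: "\<sigma> permutes {..<n}"
    then have as: "as \<in> args B n" by simp
    show "act (restrict_alg P \<phi> B) n (osym P n \<sigma> \<mu>) as = act (restrict_alg P \<phi> B) n \<mu> (perm_args \<sigma> as)"
      unfolding act_restrict_alg[OF P.sym_closed[OF \<sigma> \<mu>] as] act_restrict_alg[OF \<mu> args_perm_args[OF \<sigma> as]]
        operad_hom_sym[OF \<phi> \<mu> \<sigma>]
      by (rule B.act_sym[OF closed[OF \<mu>] as \<sigma>])
  qed
qed

lemma restrict_alg_hom_restrict: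
  assumes \<phi>: "\<phi> \<in> operad_hom R P Q" and h: "h \<in> alg_hom R Q A B"
  shows "h \<in> alg_hom R P (restrict_alg P \<phi> A) (restrict_alg P \<phi> B)"
proof -
  have "h (act (restrict_alg P \<phi> A) n \<mu> as) = act (restrict_alg P \<phi> B) n \<mu> (map h as)"
    if \<mu>: "\<mu> \<in> ops P n" and as: "as \<in> args A n" for n \<mu> as
  proof -
    have hs: "map h as \<in> args B n" by (rule args_map[OF as alg_hom_closed[OF h]])
    show ?thesis
      unfolding act_restrict_alg[OF \<mu> as] act_restrict_alg[OF \<mu> hs]
      by (rule alg_hom_act[OF h operad_hom_closed[OF \<phi> \<mu>] as])
  qed
  with h show ?thesis by (simp add: alg_hom_def)
qed

text \<open>The action on a semidirect product evaluates one operation at several argument lists and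
  never composes operations, so the sums agree term by term. Equality of records, not just
  isomorphism, is what strictness of the restriction functor rests on.\<close>

lemma semidirect_restrict_alg:
  assumes \<phi>: "\<phi> \<in> operad_hom R P Q" and B: "operad_algebra R Q B"
  shows "semidirect R P n (restrict_alg P \<phi> B) = restrict_alg P \<phi> (semidirect R Q n B)"
proof (rule alg.equality)
  interpret B: operad_algebra R Q B by (rule B)
  show "act (semidirect R P n (restrict_alg P \<phi> B)) = act (restrict_alg P \<phi> (semidirect R Q n B))"
  proof (intro ext)
    fix m \<mu> xs
    show "act (semidirect R P n (restrict_alg P \<phi> B)) m \<mu> xs =
        act (restrict_alg P \<phi> (semidirect R Q n B)) m \<mu> xs"
    proof (cases "\<mu> \<in> ops P m \<and> xs \<in> args (semidirect R Q n B) m")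
      case True
      then have \<mu>: "\<mu> \<in> ops P m" and xs: "xs \<in> args (semidirect R Q n B) m" by auto
      note e0 = args_entry[OF xs le0]
      have "(\<Oplus>\<^bsub>B\<^esub>k\<in>{..<m}. act (restrict_alg P \<phi> B) m \<mu> ((map (entry 0) xs)[k := entry j (xs ! k)])) =
          (\<Oplus>\<^bsub>B\<^esub>k\<in>{..<m}. act B m (\<phi> m \<mu>) ((map (entry 0) xs)[k := entry j (xs ! k)]))" if "j \<le> n" for j
      proof (rule B.A.M.finsum_cong')
        have "(map (entry 0) xs)[k := entry j (xs ! k)] \<in> args B m" if "k < m" for k
          using args_update[OF e0] entry_closed[OF args_nth[OF xs that] \<open>j \<le> n\<close>] by blast
        then show "(\<lambda>k. act B m (\<phi> m \<mu>) ((map (entry 0) xs)[k := entry j (xs ! k)])) \<in> {..<m} \<rightarrow> carrier B"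
          "\<And>k. k \<in> {..<m} \<Longrightarrow> act (restrict_alg P \<phi> B) m \<mu> ((map (entry 0) xs)[k := entry j (xs ! k)]) =
            act B m (\<phi> m \<mu>) ((map (entry 0) xs)[k := entry j (xs ! k)])"
          using operad_hom_closed[OF \<phi> \<mu>] by (auto simp: act_restrict_alg \<mu> intro!: B.act_closed)
      qed simp
      moreover have "length xs = m \<and> set xs \<subseteq> Tuple ` args B (Suc n)"
        using xs by (simp add: args_def carrier_semidirect)
      ultimately show ?thesis
        using \<mu> operad_hom_closed[OF \<phi> \<mu>] xs e0
        by (simp add: act_restrict_alg[OF \<mu> xs]) (simp add: semidirect_def Let_def act_restrict_alg del: upt_Suc)
    next
      \<comment> \<open>Outside their common domain both actions are undefined, as literal equality
        of the records demands.\<close>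
      case False
      moreover have "args (semidirect R P n (restrict_alg P \<phi> B)) m = args (semidirect R Q n B) m"
        by (simp add: args_def carrier_semidirect)
      ultimately show ?thesis
        unfolding semidirect_args[symmetric]
        by (auto simp: semidirect_def Let_def restrict_alg_def args_def)
    qed
  qed
qed (simp_all add: semidirect_def Let_def cong: if_cong)

lemma ucat_alg_tangent [simp]: "ucat (alg_tangent R P) = Alg_cat R P"
  by (simp add: alg_tangent_def Let_def)

section \<open>Strictness of restriction along a fixed operad morphism\<close>

locale operad_morphism = P: symmetric_operad R P + Q: symmetric_operad R Q
  for R :: "('r, 'x) ring_scheme" and P :: "('r, 'p) operad" and Q :: "('r, 'p) operad" +
  fixes \<phi> :: "nat \<Rightarrow> 'p \<Rightarrow> 'p"
  assumes hom: "\<phi> \<in> operad_hom R P Q"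
begin

sublocale PA: operad_algebras R P .
sublocale QA: operad_algebras R Q .

abbreviation "res \<equiv> restrict_alg P \<phi>"
abbreviation "F \<equiv> restriction_functor R P \<phi> Q"

lemma res_algebra: "operad_algebra R Q B \<Longrightarrow> operad_algebra R P (res B)"
  by (rule restrict_operad_algebra[OF P.symmetric_operad_axioms hom])

lemma fobj_F: "operad_algebra R Q B \<Longrightarrow> fobj F B = res B"
  by (simp add: restriction_functor_def)

lemma F_arrow:
  assumes "f \<in> Arr (Alg_cat R Q)"
  shows "fmor F f \<in> Arr (Alg_cat R P)" "src (fmor F f) = res (src f)" "tgt (fmor F f) = res (tgt f)"
    "arrow_map (fmor F f) = arrow_map f"
  using assms restrict_alg_hom_restrict[OF hom]
  by (auto simp: restriction_functor_def Arr_Alg_cat res_algebra)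

lemma functor_F: "is_functor (Alg_cat R Q) (Alg_cat R P) F"
proof (rule is_functorI)
  show "fobj F \<in> extensional (Obj (Alg_cat R Q))" "fmor F \<in> extensional (Arr (Alg_cat R Q))"
    by (simp_all add: restriction_functor_def)
  fix f g A B D assume f: "in_hom (Alg_cat R Q) f A B"
  then show "in_hom (Alg_cat R P) (fmor F f) (fobj F A) (fobj F B)"
    using src_algebra[of f R Q] tgt_algebra[of f R Q] by (auto simp: in_hom_Alg_cat F_arrow fobj_F)
  assume "in_hom (Alg_cat R Q) g B D"
  then show "fmor F (g \<cdot>\<^bsub>Alg_cat R Q\<^esub> f) = fmor F g \<cdot>\<^bsub>Alg_cat R P\<^esub> fmor F f"
    using f by (intro arrow_eqI[of _ R P]) (auto simp: in_hom_Alg_cat F_arrow Comp_arrow)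
next
  fix B assume "B \<in> Obj (Alg_cat R Q)"
  then show "fobj F B \<in> Obj (Alg_cat R P)" "fmor F (Ident (Alg_cat R Q) B) = Ident (Alg_cat R P) (fobj F B)"
    by (auto simp: fobj_F res_algebra F_arrow Ident_arrow intro!: arrow_eqI[of _ R P])
qed (rule category_Alg_cat)+

lemma semidirect_res:
  "operad_algebra R Q B \<Longrightarrow> semidirect R P n (res B) = res (semidirect R Q n B)"
  by (rule semidirect_restrict_alg[OF hom])

lemma tangent_res: "operad_algebra R Q B \<Longrightarrow> tangent_alg R P (res B) = res (tangent_alg R Q B)"
  by (simp add: tangent_alg_def semidirect_res)

lemmas res_simps = PA.arrow_simps QA.arrow_simps PA.element_simps QA.element_simps res_algebra fobj_F F_arrow
  semidirect_res tangent_res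

theorem strict: "strict_tangent_morphism (alg_tangent R Q) (alg_tangent R P) F
  (snd (restriction_tangent_map R P \<phi> Q))"
  unfolding strict_tangent_morphism_iff[OF QA.tangent_category PA.tangent_category] ucat_alg_tangent
proof (intro conjI ballI)
  show "is_functor (Alg_cat R Q) (Alg_cat R P) F" by (rule functor_F)
  have fobj: "fobj F (fobj QA.TF B) = fobj PA.TF (fobj F B)" if "operad_algebra R Q B" for B
    using that by (simp add: res_simps)
  have fmor: "fmor F (fmor QA.TF f) = fmor PA.TF (fmor F f)" if "f \<in> Arr (Alg_cat R Q)" for f
    using that src_algebra[OF that] tgt_algebra[OF that]
    by (intro arrow_eqI[of _ R P]) (simp_all add: res_simps)
  show "comp_functor (Alg_cat R Q) F QA.TF = comp_functor (Alg_cat R Q) PA.TF F"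
    by (simp add: comp_functor_def fobj fmor cong: restrict_cong)
  show "snd (restriction_tangent_map R P \<phi> Q) =
      (\<lambda>B\<in>Obj (Alg_cat R Q). Ident (Alg_cat R P) (fobj F (fobj QA.TF B)))"
    by (simp add: restriction_tangent_map_def res_simps cong: restrict_cong)
  fix B assume "B \<in> Obj (Alg_cat R Q)"
  then have B: "operad_algebra R Q B" by simp
  note simps = B res_simps
  show "fmor F (tanp QA.\<X> B) = tanp PA.\<X> (fobj F B)" "fmor F (tanz QA.\<X> B) = tanz PA.\<X> (fobj F B)"
    "fmor F (tanl QA.\<X> B) = tanl PA.\<X> (fobj F B)" "fmor F (tanc QA.\<X> B) = tanc PA.\<X> (fobj F B)"
    by (rule arrow_eqI[of _ R P]; simp add: simps)+
  \<comment> \<open>The comparison map is the identity on elements: by \<open>semidirect_res\<close>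
    the restricted fibre square is the fibre square of the restricted algebra, and pairing its two
    projections rebuilds each triple.\<close>
  show "fmor F (tans QA.\<X> B) = tans PA.\<X> (fobj F B) \<cdot>\<^bsub>Alg_cat R P\<^esub>
      tan_pair PA.\<X> (fobj F B) (fmor F (tanpr QA.\<X> 2 B 1)) (fmor F (tanpr QA.\<X> 2 B 2))"
    unfolding tan_pair_def ucat_alg_tangent
    by (rule arrow_eqI[of _ R P]; simp add: simps PA.tan_pair_arrow)
qed

end

section \<open>Functoriality in the operad\<close>

lemma restriction_tangent_map_hom:
  assumes "symmetric_operad R P" "symmetric_operad R Q" "\<phi> \<in> operad_hom R P Q"
  shows "strict_tangent_morphism (alg_tangent R Q) (alg_tangent R P)
    (fst (restriction_tangent_map R P \<phi> Q)) (snd (restriction_tangent_map R P \<phi> Q))"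
  using operad_morphism.strict[OF operad_morphism.intro[OF assms(1,2) operad_morphism_axioms.intro[OF assms(3)]]]
  by (simp add: restriction_tangent_map_def)

lemma tangent_category_alg_tangent: "tangent_category (alg_tangent R P)"
  by (rule operad_algebras.tangent_category)

text \<open>The restricted action is reset to undefined outside the operations and arguments;
  \<open>act_undefined\<close> says that the action of \<open>B\<close> already has this value
  there.\<close>

lemma restrict_alg_id:
  assumes "operad_algebra R P B"
  shows "restrict_alg P (\<lambda>n. \<lambda>\<mu>\<in>ops P n. \<mu>) B = B"
proof -
  interpret operad_algebra R P B by (rule assms)
  show ?thesis
    by (rule alg.equality) (auto simp: fun_eq_iff restrict_alg_def act_undefined)
qed

text \<open>The inner restriction tests membership in the operations of \<open>Q\<close>, which
  holds for every \<open>\<phi> n \<mu>\<close>; so the two nested case distinctions merge into the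
  single one on the left.\<close>

lemma restrict_alg_comp:
  assumes "\<phi> \<in> operad_hom R P Q" and "operad_algebra R S B"
  shows "restrict_alg P (\<lambda>n. compose (ops P n) (\<psi> n) (\<phi> n)) B = restrict_alg P \<phi> (restrict_alg Q \<psi> B)"
  using operad_hom_closed[OF assms(1)]
  by (intro alg.equality) (auto simp: fun_eq_iff restrict_alg_def compose_def args_def)

lemma restriction_functor_id:
  "restriction_functor R P (\<lambda>n. \<lambda>\<mu>\<in>ops P n. \<mu>) P = id_functor (Alg_cat R P)"
proof -
  let ?res = "restrict_alg P (\<lambda>n. \<lambda>\<mu>\<in>ops P n. \<mu>)"
  have fobj: "(\<lambda>B\<in>Obj (Alg_cat R P). ?res B) = (\<lambda>B\<in>Obj (Alg_cat R P). B)"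
    by (rule restrict_ext) (simp only: Obj_Alg_cat restrict_alg_id)
  have fmor: "(\<lambda>h\<in>Arr (Alg_cat R P). Arrow (?res (src h)) (arrow_map h) (?res (tgt h))) =
      (\<lambda>h\<in>Arr (Alg_cat R P). h)"
    by (rule restrict_ext) (simp only: restrict_alg_id[OF src_algebra] restrict_alg_id[OF tgt_algebra]
        arrow.collapse)
  show ?thesis
    unfolding restriction_functor_def id_functor_def fobj fmor ..
qed

lemma restriction_functor_comp:
  assumes "symmetric_operad R P" "symmetric_operad R Q" "symmetric_operad R S"
    and \<phi>: "\<phi> \<in> operad_hom R P Q" and \<psi>: "\<psi> \<in> operad_hom R Q S"
  shows "restriction_functor R P (\<lambda>n. compose (ops P n) (\<psi> n) (\<phi> n)) S =
    comp_functor (Alg_cat R S) (restriction_functor R P \<phi> Q) (restriction_functor R Q \<psi> S)"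
proof -
  interpret \<phi>: operad_morphism R P Q \<phi>
    by (intro operad_morphism.intro operad_morphism_axioms.intro assms)
  interpret \<psi>: operad_morphism R Q S \<psi>
    by (intro operad_morphism.intro operad_morphism_axioms.intro assms)
  let ?\<psi>\<phi> = "\<lambda>n. compose (ops P n) (\<psi> n) (\<phi> n)"
  interpret \<psi>\<phi>: operad_morphism R P S ?\<psi>\<phi>
    using operad_hom_comp[OF assms(1,2) \<phi> \<psi>]
    by (intro operad_morphism.intro operad_morphism_axioms.intro assms)
  have "fobj \<psi>\<phi>.F = fobj (comp_functor (Alg_cat R S) \<phi>.F \<psi>.F)"
  proof (rule extensionalityI[of _ "Obj (Alg_cat R S)"])
    show "fobj \<psi>\<phi>.F B = fobj (comp_functor (Alg_cat R S) \<phi>.F \<psi>.F) B" if "B \<in> Obj (Alg_cat R S)" for B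
      using that by (simp add: comp_functor_def \<psi>\<phi>.fobj_F \<psi>.fobj_F \<phi>.fobj_F \<psi>.res_algebra
          restrict_alg_comp[OF \<phi>])
  qed (simp_all add: restriction_functor_def comp_functor_def)
  moreover have "fmor \<psi>\<phi>.F = fmor (comp_functor (Alg_cat R S) \<phi>.F \<psi>.F)"
  proof (rule extensionalityI[of _ "Arr (Alg_cat R S)"])
    show "fmor \<psi>\<phi>.F f = fmor (comp_functor (Alg_cat R S) \<phi>.F \<psi>.F) f" if f: "f \<in> Arr (Alg_cat R S)" for f
      using f src_algebra[OF f] tgt_algebra[OF f]
      by (intro arrow_eqI[of _ R P])
        (simp_all add: comp_functor_def \<psi>\<phi>.F_arrow \<psi>.F_arrow \<phi>.F_arrow restrict_alg_comp[OF \<phi>])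
  qed (simp_all add: restriction_functor_def comp_functor_def)
  ultimately show ?thesis by (intro cfunctor.equality) simp_all
qed

theorem proposition2p1:
  fixes R :: "('r, 'x) ring_scheme"
  assumes "cring R"
  shows "\<exists>Alg :: (('r, 'p) operad, (('r, 'p) operad, nat \<Rightarrow> 'p \<Rightarrow> 'p) arrow,
        (('r, 'u, 'p) talg, ('r, 'u, 'p) talg_arrow) tangent_cat,
        ((('r, 'u, 'p) talg, ('r, 'u, 'p) talg_arrow) tangent_cat,
         (('r, 'u, 'p) talg, ('r, 'u, 'p) talg_arrow) tangent_map) arrow) cfunctor.
      is_functor (op_cat (Operad_cat R)) TngCat_strict Alg \<and>
      (\<forall>P. symmetric_operad R P \<longrightarrow> fobj Alg P = alg_tangent R P) \<and>
      (\<forall>P Q \<phi>. symmetric_operad R P \<and> symmetric_operad R Q \<and> \<phi> \<in> operad_hom R P Q \<longrightarrow>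
         fmor Alg (Arrow P \<phi> Q) =
           Arrow (alg_tangent R Q) (restriction_tangent_map R P \<phi> Q) (alg_tangent R P))"
proof -
  let ?Op = "Operad_cat R :: (('r, 'p) operad, (('r, 'p) operad, nat \<Rightarrow> 'p \<Rightarrow> 'p) arrow) cat"
  \<comment> \<open>Arrows of the opposite category keep the endpoints they have in
    \<open>Operad_cat\<close>, so \<open>tgt f\<close> is the source there; this is why the
    endpoints appear exchanged in the value on arrows.\<close>
  define Alg :: "(('r, 'p) operad, (('r, 'p) operad, nat \<Rightarrow> 'p \<Rightarrow> 'p) arrow,
        (('r, 'u, 'p) talg, ('r, 'u, 'p) talg_arrow) tangent_cat,
        ((('r, 'u, 'p) talg, ('r, 'u, 'p) talg_arrow) tangent_cat,
         (('r, 'u, 'p) talg, ('r, 'u, 'p) talg_arrow) tangent_map) arrow) cfunctor"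
    where "Alg = \<lparr>fobj = (\<lambda>P\<in>Obj ?Op. alg_tangent R P),
      fmor = (\<lambda>f\<in>Arr ?Op. Arrow (alg_tangent R (tgt f))
        (restriction_tangent_map R (src f) (arrow_map f) (tgt f)) (alg_tangent R (src f)))\<rparr>"
  have Obj: "P \<in> Obj ?Op \<longleftrightarrow> symmetric_operad R P" for P
    by (simp add: Operad_cat_def)
  have fobj: "fobj Alg P = alg_tangent R P" if "symmetric_operad R P" for P
    using that by (simp add: Alg_def Obj)
  have fmor: "fmor Alg (Arrow P \<phi> Q) =
      Arrow (alg_tangent R Q) (restriction_tangent_map R P \<phi> Q) (alg_tangent R P)"
    if "symmetric_operad R P" "symmetric_operad R Q" "\<phi> \<in> operad_hom R P Q" for P Q \<phi>
    using that by (simp add: Alg_def Operad_cat_def)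
  \<comment> \<open>An arrow from \<open>Q\<close> to \<open>P\<close> in the opposite category is
    stored as an operad morphism from \<open>P\<close> to \<open>Q\<close>.\<close>
  have op_hom: "\<exists>\<phi>. symmetric_operad R P \<and> symmetric_operad R Q \<and> \<phi> \<in> operad_hom R P Q \<and> f = Arrow P \<phi> Q"
    if "in_hom (op_cat ?Op) f Q P" for f P Q
  proof -
    have "in_hom ?Op f P Q" using that by (simp add: in_hom_def op_cat_def)
    then show ?thesis by (auto simp: Operad_cat_def in_hom_hom_category)
  qed
  let ?H = "\<lambda>\<X> \<Y> :: (('r, 'u, 'p) talg, ('r, 'u, 'p) talg_arrow) tangent_cat.
    {(F, \<alpha>). strict_tangent_morphism \<X> \<Y> F \<alpha>}"
  have map_hom: "restriction_tangent_map R P \<phi> Q \<in> ?H (alg_tangent R Q) (alg_tangent R P)"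
    if "symmetric_operad R P" "symmetric_operad R Q" "\<phi> \<in> operad_hom R P Q" for P Q \<phi>
    using restriction_tangent_map_hom[OF that] by (simp add: case_prod_beta)
  have ext: "f = g" if "f \<in> ?H (alg_tangent R Q) (alg_tangent R P)"
    "g \<in> ?H (alg_tangent R Q) (alg_tangent R P)" "fst f = fst g" for f g P Q
    using strict_tangent_morphism_unique[OF tangent_category_alg_tangent tangent_category_alg_tangent]
      that by (auto simp: prod_eq_iff)
  have "is_functor (op_cat ?Op) TngCat_strict Alg"
  proof (rule is_functorI)
    show "category (op_cat ?Op)" by (rule category.category_op[OF category_Operad_cat])
    show "category (TngCat_strict :: ((('r, 'u, 'p) talg, ('r, 'u, 'p) talg_arrow) tangent_cat, _) cat)"
      by (rule category_TngCat_strict)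
    show "fobj Alg \<in> extensional (Obj (op_cat ?Op))" "fmor Alg \<in> extensional (Arr (op_cat ?Op))"
      by (simp_all add: Alg_def op_cat_def)
  next
    fix P assume "P \<in> Obj (op_cat ?Op)"
    then have P: "symmetric_operad R P" by (simp add: op_cat_def Obj)
    show "fobj Alg P \<in> Obj TngCat_strict"
      by (simp add: fobj[OF P] TngCat_strict_def tangent_category_alg_tangent)
    let ?id = "\<lambda>n. \<lambda>\<mu>\<in>ops P n. \<mu>"
    have "Ident (op_cat ?Op) P = Arrow P ?id P"
      using P by (simp add: op_cat_def Operad_cat_def)
    moreover
    let ?i = "(id_functor (Alg_cat R P),
        \<lambda>A\<in>Obj (Alg_cat R P). Ident (Alg_cat R P) (fobj (tanT (alg_tangent R P)) A))
        :: (('r, 'u, 'p) talg, ('r, 'u, 'p) talg_arrow) tangent_map"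
    have i: "?i \<in> ?H (alg_tangent R P) (alg_tangent R P)"
      using strict_tangent_morphism_id[OF tangent_category_alg_tangent[of R P]] by simp
    have "restriction_tangent_map R P ?id P = ?i"
      by (rule ext[OF map_hom[OF P P operad_hom_id[OF P]] i])
        (simp only: restriction_tangent_map_def restriction_functor_id fst_conv)
    ultimately show "fmor Alg (Ident (op_cat ?Op) P) = Ident TngCat_strict (fobj Alg P)"
      by (simp add: fobj[OF P] fmor[OF P P operad_hom_id[OF P]] TngCat_strict_def
          tangent_category_alg_tangent)
  next
    fix f P Q assume "in_hom (op_cat ?Op) f P Q"
    from op_hom[OF this] obtain \<phi> where f: "symmetric_operad R Q" "symmetric_operad R P"
      "\<phi> \<in> operad_hom R Q P" "f = Arrow Q \<phi> P" by blast
    show "in_hom TngCat_strict (fmor Alg f) (fobj Alg P) (fobj Alg Q)"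
      unfolding f(4) fmor[OF f(1-3)] fobj[OF f(1)] fobj[OF f(2)] TngCat_strict_def in_hom_hom_category
      using map_hom[OF f(1-3)] tangent_category_alg_tangent by blast
    fix g S assume "in_hom (op_cat ?Op) g Q S"
    from op_hom[OF this] obtain \<psi> where g: "symmetric_operad R S" "symmetric_operad R Q"
      "\<psi> \<in> operad_hom R S Q" "g = Arrow S \<psi> Q" by blast
    \<comment> \<open>The composite of \<open>g\<close> after \<open>f\<close> in the opposite
      category is \<open>\<phi>\<close> after \<open>\<psi>\<close> among operads: from
      \<open>S\<close> through \<open>Q\<close> to \<open>P\<close>.\<close>
    let ?\<phi>\<psi> = "\<lambda>n. compose (ops S n) (\<phi> n) (\<psi> n)"
    note hom = operad_hom_comp[OF g(1,2) g(3) f(3)]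
    have "g \<cdot>\<^bsub>op_cat ?Op\<^esub> f = Arrow S ?\<phi>\<psi> P"
      using f g by (simp add: op_cat_def Operad_cat_def Comp_hom_category)
    moreover
    \<comment> \<open>Composition in \<open>TngCat_strict\<close> written out for these tangent
      categories. Knowing that its value is a strict morphism reduces the equation below to
      \<open>restriction_functor_comp\<close>.\<close>
    let ?k = "\<lambda>(G, \<beta>) 
        (F :: (('r, 'u, 'p) talg, ('r, 'u, 'p) talg_arrow, ('r, 'u, 'p) talg, ('r, 'u, 'p) talg_arrow) cfunctor,
         \<alpha>). (comp_functor (Alg_cat R P) G F,
      \<lambda>X\<in>Obj (Alg_cat R P). \<beta> (fobj F X) \<cdot>\<^bsub>Alg_cat R S\<^esub> fmor G (\<alpha> X))
      :: (('r, 'u, 'p) talg, ('r, 'u, 'p) talg_arrow) tangent_map"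
    have k: "?k (restriction_tangent_map R S \<psi> Q) (restriction_tangent_map R Q \<phi> P) \<in>
        ?H (alg_tangent R P) (alg_tangent R S)"
      using strict_tangent_morphism_comp[OF tangent_category_alg_tangent tangent_category_alg_tangent
          tangent_category_alg_tangent restriction_tangent_map_hom[OF f(1-3)]
          restriction_tangent_map_hom[OF g(1-3)]]
      by (simp add: case_prod_beta)
    have "restriction_tangent_map R S ?\<phi>\<psi> P =
        ?k (restriction_tangent_map R S \<psi> Q) (restriction_tangent_map R Q \<phi> P)"
      by (rule ext[OF map_hom[OF g(1) f(2) hom] k])
        (simp only: restriction_tangent_map_def restriction_functor_comp[OF g(1,2) f(2) g(3) f(3)]
          fst_conv case_prod_conv)
    moreover have "fmor Alg g \<cdot>\<^bsub>TngCat_strict\<^esub> fmor Alg f = Arrow (alg_tangent R P)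
        (?k (restriction_tangent_map R S \<psi> Q) (restriction_tangent_map R Q \<phi> P)) (alg_tangent R S)"
      unfolding f(4) g(4) fmor[OF f(1-3)] fmor[OF g(1-3)] TngCat_strict_def
      using map_hom[OF f(1-3)] map_hom[OF g(1-3)]
      by (subst Comp_hom_category) (simp_all add: tangent_category_alg_tangent case_prod_beta)
    ultimately show "fmor Alg (g \<cdot>\<^bsub>op_cat ?Op\<^esub> f) = fmor Alg g \<cdot>\<^bsub>TngCat_strict\<^esub> fmor Alg f"
      by (simp add: fmor[OF g(1) f(2) hom])
  qed
  with fobj fmor show ?thesis by blast
qed

end
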